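(* For any $p=p(n)\in[0,1]$, with probability tending to $1$ as $n\to\infty$, the random graph $G=G_{n,p}$ satisfies $\tau(G)\le 2\nu(G)$.
   Context: $G_{n,p}$ is the binomial random graph on vertex set $[n]$ in which each of the $\binom n2$ possible edges is present independently with probability $p$. For a finite graph $H$, $\nu(H)$ is the maximum number of pairwise edge-disjoint triangles in $H$, and $\tau(H)$ is the minimum size of a set $F$ of edges of $H$ such that every triangle of $H$ contains an edge of $F$. *)

theory Defs
  imports "HOL-Probability.Probability"
begin

text \<open>
  A finite simple graph is represented by its set of edges, each edge being a two-element set of
  vertices. The vertex set is left implicit: isolated vertices affect neither \<open>\<nu>\<close> nor \<open>\<tau>\<close>.
\<close>

definition all_edges :: "'a set \<Rightarrow> 'a set set" where
  "all_edges V = {e. e \<subseteq> V \<and> card e = 2}"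

text \<open>A triangle is identified with the set of its three edges, so that two triangles are
  edge-disjoint exactly when they are disjoint as sets.\<close>

definition triangles :: "'a set set \<Rightarrow> 'a set set set" where
  "triangles E = {{{a, b}, {b, c}, {a, c}} | a b c.
     a \<noteq> b \<and> b \<noteq> c \<and> a \<noteq> c \<and> {a, b} \<in> E \<and> {b, c} \<in> E \<and> {a, c} \<in> E}"

definition triangle_packing :: "'a set set \<Rightarrow> 'a set set set \<Rightarrow> bool" where
  "triangle_packing E T \<longleftrightarrow> T \<subseteq> triangles E \<and> disjoint T"

definition triangle_cover :: "'a set set \<Rightarrow> 'a set set \<Rightarrow> bool" where
  "triangle_cover E F \<longleftrightarrow> F \<subseteq> E \<and> (\<forall>t\<in>triangles E. t \<inter> F \<noteq> {})"

text \<open>Both are meant for finite \<open>E\<close>; the maximum and the minimum then range over finite nonempty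
  sets of natural numbers.\<close>

definition nu :: "'a set set \<Rightarrow> nat" where
  "nu E = Max {card T | T. triangle_packing E T}"

definition tau :: "'a set set \<Rightarrow> nat" where
  "tau E = Min {card F | F. triangle_cover E F}"

definition random_graph :: "nat \<Rightarrow> real \<Rightarrow> nat set set pmf" where
  "random_graph n p =
     map_pmf (\<lambda>present. {e \<in> all_edges {1..n}. present e})
       (Pi_pmf (all_edges {1..n}) False (\<lambda>_. bernoulli_pmf p))"

end

theory Submission
  imports Defs "HOL-Real_Asymp.Real_Asymp"
begin

text \<open>
  Put \<open>f = 2 \<nu> - \<tau>\<close> and \<open>\<lambda> = n p\<^sup>2\<close>, the average number of triangles on an edge. Toggling an edge
  changes \<open>f\<close> by at most two, and not at all unless the edge closes a triangle, so by Efron--Stein and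
  Chebyshev it is enough to bound the mean of \<open>f\<close> below by a constant fraction of \<open>n\<^sup>3 p\<^sup>3\<close> (for
  \<open>\<lambda> \<le> 1/6\<close>) or of \<open>n\<^sup>2 p\<close> (for \<open>\<lambda> \<ge> 1/6\<close>); when \<open>p \<le> n powr (-9/10)\<close>, typically no two
  triangles share an edge and there is nothing to prove.

  For small \<open>\<lambda>\<close> most triangles are edge-disjoint, so both \<open>\<nu>\<close> and \<open>\<tau>\<close> are close to their number. For
  bounded \<open>\<lambda>\<close>, random greedy packing gives
  \<open>\<nu> \<ge> (1 - (1 + 2 \<lambda>) powr (-1/2)) |E| / 3\<close> up to lower order terms. Take a random bipartition, delete
  the edges inside the parts that have a common neighbour in the other part, and one edge from each
  triangle that still survives; this gives \<open>\<tau> \<le> (1 - q + \<lambda> q\<^sup>3 / 6) |E| / 2\<close> with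
  \<open>q = exp (- \<lambda> / 2)\<close>. The two bounds are compatible for every \<open>\<lambda>\<close>. For large \<open>\<lambda>\<close> split
  the graph into independent sparser ones and use that \<open>\<nu>\<close> is superadditive.

  To analyse the greedy packing, view \<open>G(n, p)\<close> as a random thinning of a denser \<open>G(n, p')\<close>, whose
  triangles form a nearly regular triple system that has no short cycles after few deletions. On
  such a fixed system all randomness is independent, and the relevant events depend on disjoint
  branches.
\<close>

subsection \<open>Random subsets\<close>

text \<open>The ranges come from comparing variance with squared mean. For \<lambda> \<le> 1/6 both
  the mean and the variance bound have order (n p)^3, so Chebyshev leaves O((n p)^(-3)), which says
  nothing for bounded n p. Below the cutoff n powr (-9/10) the expected number of pairs of triangles
  sharing an edge, O(n^4 p^5), is small instead. For \<lambda> \<ge> 1/6 the variance bound n^2 p is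
  of the order of the mean itself, so a gap by a constant factor suffices. Where the gap comes from:
  for small \<lambda> both bounds are close to the number \<lambda> |E| / 3 of triangles, and the
  factor two is all slack; for large \<lambda> the bounds on 2 \<nu> and \<tau> tend to 2 |E| / 3
  and |E| / 2. The asymptotic bounds are proved for one fixed \<lambda> at a time. Monotonicity of
  the means of \<nu> and \<tau> in p makes them uniform near each \<lambda>, hence for 1/6 \<le>
  \<lambda> \<le> 4000. Beyond that p is at least ten times the density at \<lambda> = 40, so
  splitting into an integer number of pieces loses little.\<close>

abbreviation expect :: "'a pmf \<Rightarrow> ('a \<Rightarrow> real) \<Rightarrow> real" where
  "expect M f \<equiv> measure_pmf.expectation M f"

definition rset :: "'a set \<Rightarrow> real \<Rightarrow> 'a set pmf" where
  "rset U p = map_pmf (\<lambda>b. {e \<in> U. b e}) (Pi_pmf U False (\<lambda>_. bernoulli_pmf p))"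

lemma random_graph_eq_rset: "random_graph n p = rset (all_edges {1..n}) p"
  by (simp add: random_graph_def rset_def)

lemma rset_empty [simp]: "rset {} p = return_pmf {}"
  by (simp add: rset_def)

lemma rset_insert:
  assumes "finite U" "e \<notin> U"
  shows "rset (insert e U) p =
    bernoulli_pmf p \<bind> (\<lambda>b. map_pmf (\<lambda>A. if b then insert e A else A) (rset U p))"
proof -
  have "rset (insert e U) p = map_pmf (\<lambda>(b, f). {x \<in> insert e U. (f(e := b)) x})
      (pair_pmf (bernoulli_pmf p) (Pi_pmf U False (\<lambda>_. bernoulli_pmf p)))"
    unfolding rset_def using assms
    by (subst Pi_pmf_insert) (simp_all add: pmf.map_comp o_def case_prod_unfold)
  also have "(\<lambda>(b, f). {x \<in> insert e U. (f(e := b)) x}) =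
      (\<lambda>(b, f). if b then insert e {x \<in> U. f x} else {x \<in> U. f x})"
    using assms by (auto simp: fun_eq_iff)
  finally show ?thesis
    by (simp add: rset_def pair_pmf_def map_bind_pmf map_pmf_def bind_assoc_pmf bind_return_pmf
        cong: bind_pmf_cong)
qed

lemma set_rset: "finite U \<Longrightarrow> set_pmf (rset U p) \<subseteq> Pow U"
  by (auto simp: rset_def)

lemma rset_subset: "finite U \<Longrightarrow> A \<in> set_pmf (rset U p) \<Longrightarrow> A \<subseteq> U"
  using set_rset by blast

lemma finite_set_rset [simp]: "finite U \<Longrightarrow> finite (set_pmf (rset U p))"
  by (rule finite_subset[OF set_rset]) auto

lemma integrable_rset [simp]: "finite U \<Longrightarrow> integrable (measure_pmf (rset U p)) (f :: _ \<Rightarrow> real)"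
  by (rule integrable_measure_pmf_finite) simp

text \<open>Conditioning on whether \<open>e\<close> is chosen. The inductions on \<open>U\<close>
  below run on this two-point formula.\<close>

lemma expect_rset_insert:
  fixes f :: "'a set \<Rightarrow> real"
  assumes "finite U" "e \<notin> U" "0 \<le> p" "p \<le> 1"
  shows "expect (rset (insert e U) p) f =
    p * expect (rset U p) (\<lambda>A. f (insert e A)) + (1 - p) * expect (rset U p) f"
proof -
  have "expect (rset (insert e U) p) f = (\<Sum>b\<in>UNIV. pmf (bernoulli_pmf p) b *\<^sub>R
      expect (map_pmf (\<lambda>A. if b then insert e A else A) (rset U p)) f)"
    unfolding rset_insert[OF assms(1,2)]
    by (rule pmf_expectation_bind) (use assms in auto)
  then show ?thesis using assms by (simp add: UNIV_bool)
qed

lemma expect_cong: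
  "(\<And>x. x \<in> set_pmf M \<Longrightarrow> f x = g x) \<Longrightarrow> expect M f = expect M g"
  by (intro integral_cong_AE) (auto simp: AE_measure_pmf_iff)

lemma expect_mono:
  assumes "finite (set_pmf M)" "\<And>x. x \<in> set_pmf M \<Longrightarrow> f x \<le> g x"
  shows "expect M f \<le> expect M g"
  using assms by (intro integral_mono_AE integrable_measure_pmf_finite) (auto simp: AE_measure_pmf_iff)

lemma expect_rset_add [simp]:
  "finite U \<Longrightarrow> expect (rset U p) (\<lambda>x. f x + g x) = expect (rset U p) f + expect (rset U p) g"
  by (rule Bochner_Integration.integral_add) auto

lemma expect_rset_diff [simp]:
  "finite U \<Longrightarrow> expect (rset U p) (\<lambda>x. f x - g x) = expect (rset U p) f - expect (rset U p) g"
  by (rule Bochner_Integration.integral_diff) auto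

lemma expect_rset_sum:
  "finite U \<Longrightarrow> expect (rset U p) (\<lambda>x. \<Sum>i\<in>I. f i x) = (\<Sum>i\<in>I. expect (rset U p) (f i))"
  by (rule Bochner_Integration.integral_sum) auto

lemma expect_of_bool: "expect M (\<lambda>x. of_bool (P x)) = measure_pmf.prob M {x. P x}"
proof -
  have "(\<lambda>x. of_bool (P x) :: real) = indicator {x. P x}" by (auto simp: indicator_def)
  then show ?thesis by simp
qed

lemma expect_rset_supset:
  assumes "finite U" "F \<subseteq> U" "0 \<le> p" "p \<le> 1"
  shows "expect (rset U p) (\<lambda>A. of_bool (F \<subseteq> A)) = p ^ card F"
  using assms
proof (induction U arbitrary: F rule: finite_induct)
  case empty
  then show ?case by simp
next
  case (insert e U)
  show ?case
  proof (cases "e \<in> F")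
    case True
    have "expect (rset U p) (\<lambda>A. of_bool (F \<subseteq> A)) = expect (rset U p) (\<lambda>A. 0)"
      using True insert.hyps by (intro expect_cong) (auto dest: rset_subset)
    moreover have "(\<lambda>A. of_bool (F \<subseteq> insert e A) :: real) = (\<lambda>A. of_bool (F - {e} \<subseteq> A))"
      by (auto simp: fun_eq_iff)
    moreover have "expect (rset U p) (\<lambda>A. of_bool (F - {e} \<subseteq> A)) = p ^ card (F - {e})"
      using insert by (intro insert.IH) auto
    moreover have "card F = Suc (card (F - {e}))"
      using True insert.prems(1) insert.hyps(1) by (metis card.remove finite_insert finite_subset)
    ultimately show ?thesis using insert by (simp add: expect_rset_insert)
  next
    case False
    then have "(\<lambda>A. of_bool (F \<subseteq> insert e A) :: real) = (\<lambda>A. of_bool (F \<subseteq> A))"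
      by (auto simp: fun_eq_iff)
    moreover have "expect (rset U p) (\<lambda>A. of_bool (F \<subseteq> A)) = p ^ card F"
      using insert False by (intro insert.IH) auto
    ultimately show ?thesis using insert by (simp add: expect_rset_insert algebra_simps)
  qed
qed

text \<open>Two independent coins per element act as one coin of bias \<open>p * q\<close>. This
  moves bounds for a sample of a fixed graph to a random graph, and it underlies superadditivity in
  the density.\<close>

lemma expect_rset_thin:
  assumes "finite U" "0 \<le> p" "p \<le> 1" "0 \<le> q" "q \<le> 1"
  shows "expect (rset U p) (\<lambda>G. expect (rset G q) f) = expect (rset U (p * q)) f"
  using assms(1)
proof (induction U arbitrary: f rule: finite_induct)
  case empty
  then show ?case by simp
next
  case (insert e U)
  have pq: "0 \<le> p * q" "p * q \<le> 1" using assms by (auto simp: mult_le_one)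
  have "expect (rset U p) (\<lambda>G. expect (rset (insert e G) q) f) =
      expect (rset U p) (\<lambda>G. q * expect (rset G q) (\<lambda>A. f (insert e A)) + (1 - q) * expect (rset G q) f)"
  proof (intro expect_cong)
    fix G assume "G \<in> set_pmf (rset U p)"
    then have "G \<subseteq> U" using insert.hyps by (auto dest: rset_subset)
    then show "expect (rset (insert e G) q) f =
        q * expect (rset G q) (\<lambda>A. f (insert e A)) + (1 - q) * expect (rset G q) f"
      using insert assms finite_subset by (intro expect_rset_insert) auto
  qed
  also have "\<dots> = q * expect (rset U (p * q)) (\<lambda>A. f (insert e A)) + (1 - q) * expect (rset U (p * q)) f"
    using insert by simp
  finally show ?case using insert assms pq
    by (simp add: expect_rset_insert) (simp add: algebra_simps)
qed

lemma expect_rset_complement: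
  assumes "finite U" "0 \<le> q" "q \<le> 1"
  shows "expect (rset U q) (\<lambda>A. f (U - A)) = expect (rset U (1 - q)) f"
  using assms(1)
proof (induction U arbitrary: f rule: finite_induct)
  case empty
  then show ?case by simp
next
  case (insert e U)
  have "expect (rset U q) (\<lambda>A. f (insert e U - insert e A)) = expect (rset U q) (\<lambda>A. f (U - A))"
    using insert by (intro expect_cong arg_cong[of _ _ f]) auto
  moreover have "expect (rset U q) (\<lambda>A. f (insert e U - A)) = expect (rset U q) (\<lambda>A. f (insert e (U - A)))"
    using insert.hyps by (intro expect_cong arg_cong[of _ _ f]) (auto dest: rset_subset)
  ultimately show ?case using insert.IH[of f] insert.IH[of "\<lambda>A. f (insert e A)"] insert.hyps assms(2,3)
    by (simp add: expect_rset_insert)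
qed

text \<open>A random set of density \<open>a + b\<close> is coloured at random with two colours,
  whose classes have densities \<open>a\<close> and \<open>b\<close>. The classes are dependent, but
  only their marginals enter, so superadditivity of \<open>f\<close> can be averaged over the
  outcomes.\<close>

lemma expect_rset_superadditive:
  fixes f :: "'a set \<Rightarrow> real"
  assumes "finite U" "0 \<le> a" "0 \<le> b" "a + b \<le> 1"
    and super: "\<And>A B. A \<subseteq> U \<Longrightarrow> B \<subseteq> U \<Longrightarrow> A \<inter> B = {} \<Longrightarrow> f A + f B \<le> f (A \<union> B)"
  shows "expect (rset U a) f + expect (rset U b) f \<le> expect (rset U (a + b)) f"
proof (cases "a + b = 0")
  case True
  then have [simp]: "a = 0" "b = 0" using assms by auto
  have "f {} \<le> 0" using super[of "{}" "{}"] by simp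
  moreover have "expect (rset U 0) g = g {}" for g :: "'a set \<Rightarrow> real"
    using assms(1) by (induction U rule: finite_induct) (auto simp: expect_rset_insert)
  ultimately show ?thesis by simp
next
  case False
  \<comment> \<open>The probability of the first colour for an element that is present.\<close>
  define q where "q = a / (a + b)"
  have q: "0 \<le> q" "q \<le> 1" "(a + b) * q = a" "(a + b) * (1 - q) = b"
    using assms False by (auto simp: q_def field_simps)
  have "expect (rset U a) f + expect (rset U b) f =
      expect (rset U (a + b)) (\<lambda>G. expect (rset G q) f + expect (rset G (1 - q)) f)"
    using expect_rset_thin[of U "a + b" q f] expect_rset_thin[of U "a + b" "1 - q" f] assms q by simp
  also have "\<dots> \<le> expect (rset U (a + b)) f"
  proof (intro expect_mono)
    fix G assume "G \<in> set_pmf (rset U (a + b))"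
    then have G: "G \<subseteq> U" using assms(1) by (auto dest: rset_subset)
    then have "finite G" using assms(1) finite_subset by auto
    note G = G this
    have "expect (rset G q) f + expect (rset G (1 - q)) f = expect (rset G q) (\<lambda>A. f A + f (G - A))"
      using G q by (simp add: expect_rset_complement)
    also have "\<dots> \<le> expect (rset G q) (\<lambda>A. f G)"
    proof (intro expect_mono)
      fix A assume "A \<in> set_pmf (rset G q)"
      then have A: "A \<subseteq> G" using G(2) by (auto dest: rset_subset)
      have "f A + f (G - A) \<le> f (A \<union> (G - A))" using A G by (intro super) auto
      also have "A \<union> (G - A) = G" using A by auto
      finally show "f A + f (G - A) \<le> f G" .
    qed (use G in auto)
    finally show "expect (rset G q) f + expect (rset G (1 - q)) f \<le> f G" by simp
  qed (use assms in auto)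
  finally show ?thesis .
qed

lemma expect_rset_superadditive_mult:
  fixes f :: "'a set \<Rightarrow> real"
  assumes "finite U" "0 \<le> a" "real k * a \<le> 1"
    and super: "\<And>A B. A \<subseteq> U \<Longrightarrow> B \<subseteq> U \<Longrightarrow> A \<inter> B = {} \<Longrightarrow> f A + f B \<le> f (A \<union> B)"
    and nonneg: "\<And>A. 0 \<le> f A"
  shows "real k * expect (rset U a) f \<le> expect (rset U (real k * a)) f"
  using assms(3)
proof (induction k)
  case 0
  then show ?case by (simp add: nonneg)
next
  case (Suc k)
  have le: "real k * a \<le> 1" using Suc.prems assms(2) by (simp add: algebra_simps)
  have "real (Suc k) * expect (rset U a) f \<le> expect (rset U (real k * a)) f + expect (rset U a) f"
    using Suc.IH[OF le] by (simp add: algebra_simps)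
  also have "\<dots> \<le> expect (rset U (real k * a + a)) f"
    by (rule expect_rset_superadditive) (use assms Suc.prems in \<open>auto simp: algebra_simps\<close>)
  finally show ?case by (simp add: algebra_simps)
qed

lemma expect_rset_mono:
  fixes f :: "'a set \<Rightarrow> real"
  assumes "finite U" "0 \<le> a" "a \<le> b" "b \<le> 1"
    and super: "\<And>A B. A \<subseteq> U \<Longrightarrow> B \<subseteq> U \<Longrightarrow> A \<inter> B = {} \<Longrightarrow> f A + f B \<le> f (A \<union> B)"
    and nonneg: "\<And>A. 0 \<le> f A"
  shows "expect (rset U a) f \<le> expect (rset U b) f"
proof -
  have "0 \<le> expect (rset U (b - a)) f" using nonneg by (simp add: Bochner_Integration.integral_nonneg)
  moreover have "expect (rset U a) f + expect (rset U (b - a)) f \<le> expect (rset U (a + (b - a))) f"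
    by (rule expect_rset_superadditive) (use assms in auto)
  ultimately show ?thesis by simp
qed

subsection \<open>The Efron--Stein inequality\<close>

text \<open>The right-hand side of the Efron--Stein inequality, with the factor \<open>1 - p\<close>
  bounded by one. Each summand compares \<open>A\<close> with and without \<open>e\<close> whatever
  the status of \<open>e\<close> in \<open>A\<close>, so it does not depend on the coin of
  \<open>e\<close>.\<close>

definition influence :: "'a set \<Rightarrow> real \<Rightarrow> ('a set \<Rightarrow> real) \<Rightarrow> real" where
  "influence U p f = p * (\<Sum>e\<in>U. expect (rset U p) (\<lambda>A. (f (insert e A) - f (A - {e}))\<^sup>2))"

text \<open>Induction by conditioning on one coin: \<open>g\<close> averages \<open>f\<close> over
  the coin of \<open>e\<close>, and the variance of \<open>f\<close> is that of \<open>g\<close>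
  plus \<open>p * (1 - p)\<close> times the mean square difference between the two outcomes of the
  coin. Convexity of the square bounds the influences on \<open>g\<close> by those on
  \<open>f\<close>.\<close>

lemma efron_stein:
  fixes f :: "'a set \<Rightarrow> real"
  assumes "finite U" "0 \<le> p" "p \<le> 1"
  shows "expect (rset U p) (\<lambda>A. (f A)\<^sup>2) - (expect (rset U p) f)\<^sup>2 \<le> influence U p f"
  unfolding influence_def using assms(1)
proof (induction U arbitrary: f rule: finite_induct)
  case empty
  then show ?case by simp
next
  case (insert e U)
  define g1 where "g1 = (\<lambda>A. f (insert e A))"
  define g where "g = (\<lambda>A. p * g1 A + (1 - p) * f A)"
  define E where "E = expect (rset U p)"
  note [simp] = insert.hyps
  have Ef: "expect (rset (insert e U) p) f = E g"
    using assms by (simp add: expect_rset_insert E_def g_def g1_def)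
  have "(\<lambda>A. p * (g1 A)\<^sup>2 + (1 - p) * (f A)\<^sup>2) = (\<lambda>A. (g A)\<^sup>2 + p * (1 - p) * (g1 A - f A)\<^sup>2)"
    by (auto simp: fun_eq_iff g_def power2_eq_square algebra_simps)
  then have "E (\<lambda>A. p * (g1 A)\<^sup>2 + (1 - p) * (f A)\<^sup>2) = E (\<lambda>A. (g A)\<^sup>2 + p * (1 - p) * (g1 A - f A)\<^sup>2)"
    by simp
  then have Ef2: "expect (rset (insert e U) p) (\<lambda>A. (f A)\<^sup>2) = E (\<lambda>A. (g A)\<^sup>2) + p * (1 - p) * E (\<lambda>A. (g1 A - f A)\<^sup>2)"
    using assms by (simp add: expect_rset_insert E_def g1_def)
  have De: "expect (rset (insert e U) p) (\<lambda>A. (f (insert e A) - f (A - {e}))\<^sup>2) = E (\<lambda>A. (g1 A - f A)\<^sup>2)"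
  proof -
    have "E (\<lambda>A. (f (insert e A) - f (A - {e}))\<^sup>2) = E (\<lambda>A. (g1 A - f A)\<^sup>2)"
      unfolding E_def
    proof (intro expect_cong)
      fix A assume "A \<in> set_pmf (rset U p)"
      then have "A \<subseteq> U" by (intro rset_subset) auto
      then have "e \<notin> A" using insert.hyps(2) by blast
      then show "(f (insert e A) - f (A - {e}))\<^sup>2 = (g1 A - f A)\<^sup>2" by (simp add: g1_def)
    qed
    moreover have "E (\<lambda>A. (f (insert e A) - f (insert e A - {e}))\<^sup>2) = E (\<lambda>A. (g1 A - f A)\<^sup>2)"
      unfolding E_def
    proof (intro expect_cong)
      fix A assume "A \<in> set_pmf (rset U p)"
      then have "A \<subseteq> U" by (intro rset_subset) auto
      then have "e \<notin> A" using insert.hyps(2) by blast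
      then show "(f (insert e A) - f (insert e A - {e}))\<^sup>2 = (g1 A - f A)\<^sup>2" by (simp add: g1_def)
    qed
    ultimately show ?thesis using assms by (simp add: expect_rset_insert E_def algebra_simps)
  qed
  have Dx: "E (\<lambda>A. (g (insert x A) - g (A - {x}))\<^sup>2) \<le>
      expect (rset (insert e U) p) (\<lambda>A. (f (insert x A) - f (A - {x}))\<^sup>2)" if x: "x \<in> U" for x
  proof -
    have xe: "x \<noteq> e" using x insert.hyps by auto
    have "E (\<lambda>A. (g (insert x A) - g (A - {x}))\<^sup>2) \<le>
       E (\<lambda>A. p * (g1 (insert x A) - g1 (A - {x}))\<^sup>2 + (1 - p) * (f (insert x A) - f (A - {x}))\<^sup>2)"
      unfolding E_def
    proof (intro expect_mono)
      fix A
      define a where "a = g1 (insert x A) - g1 (A - {x})"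
      define b where "b = f (insert x A) - f (A - {x})"
      have "p * a\<^sup>2 + (1 - p) * b\<^sup>2 - (p * a + (1 - p) * b)\<^sup>2 = p * (1 - p) * (a - b)\<^sup>2"
        by (simp add: power2_eq_square algebra_simps)
      moreover have "0 \<le> p * (1 - p) * (a - b)\<^sup>2" using assms by simp
      ultimately have "(p * a + (1 - p) * b)\<^sup>2 \<le> p * a\<^sup>2 + (1 - p) * b\<^sup>2" by linarith
      moreover have "g (insert x A) - g (A - {x}) = p * a + (1 - p) * b"
        by (simp add: g_def a_def b_def algebra_simps)
      ultimately show "(g (insert x A) - g (A - {x}))\<^sup>2 \<le>
          p * (g1 (insert x A) - g1 (A - {x}))\<^sup>2 + (1 - p) * (f (insert x A) - f (A - {x}))\<^sup>2"
        by (simp add: a_def b_def)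
    qed auto
    also have "\<dots> = expect (rset (insert e U) p) (\<lambda>A. (f (insert x A) - f (A - {x}))\<^sup>2)"
      using assms xe by (simp add: expect_rset_insert E_def g1_def insert_Diff_if insert_commute)
    finally show ?thesis .
  qed
  have IH: "E (\<lambda>A. (g A)\<^sup>2) - (E g)\<^sup>2 \<le> p * (\<Sum>x\<in>U. E (\<lambda>A. (g (insert x A) - g (A - {x}))\<^sup>2))"
    unfolding E_def by (rule insert.IH)
  have "expect (rset (insert e U) p) (\<lambda>A. (f A)\<^sup>2) - (expect (rset (insert e U) p) f)\<^sup>2 =
      E (\<lambda>A. (g A)\<^sup>2) - (E g)\<^sup>2 + p * (1 - p) * E (\<lambda>A. (g1 A - f A)\<^sup>2)"
    using Ef Ef2 by simp
  also have "\<dots> \<le> p * (\<Sum>x\<in>U. E (\<lambda>A. (g (insert x A) - g (A - {x}))\<^sup>2)) + p * E (\<lambda>A. (g1 A - f A)\<^sup>2)"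
  proof -
    have "0 \<le> E (\<lambda>A. (g1 A - f A)\<^sup>2)" unfolding E_def by (rule Bochner_Integration.integral_nonneg) simp
    then have "p * (1 - p) * E (\<lambda>A. (g1 A - f A)\<^sup>2) \<le> p * 1 * E (\<lambda>A. (g1 A - f A)\<^sup>2)"
      using assms by (intro mult_right_mono mult_left_mono) auto
    then show ?thesis using IH by simp
  qed
  also have "\<dots> \<le> p * (\<Sum>x\<in>U. expect (rset (insert e U) p) (\<lambda>A. (f (insert x A) - f (A - {x}))\<^sup>2))
      + p * E (\<lambda>A. (g1 A - f A)\<^sup>2)"
    using assms Dx by (intro add_right_mono mult_left_mono sum_mono) auto
  also have "\<dots> = p * (\<Sum>x\<in>insert e U. expect (rset (insert e U) p) (\<lambda>A. (f (insert x A) - f (A - {x}))\<^sup>2))"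
    using De by (simp add: algebra_simps)
  finally show ?case .
qed

text \<open>Chebyshev: a negative value lies farther from the positive mean than the mean lies from
  zero.\<close>

lemma prob_neg_le_variance:
  fixes f :: "'a set \<Rightarrow> real"
  assumes "finite U" "0 \<le> p" "p \<le> 1" "expect (rset U p) f > 0"
    and var: "influence U p f \<le> V"
  shows "measure_pmf.prob (rset U p) {A. f A < 0} \<le> V / (expect (rset U p) f)\<^sup>2"
proof -
  define \<mu> where "\<mu> = expect (rset U p) f"
  have "measure_pmf.prob (rset U p) {A. f A < 0} = expect (rset U p) (\<lambda>A. of_bool (f A < 0))"
    by (simp add: expect_of_bool)
  also have "\<dots> \<le> expect (rset U p) (\<lambda>A. (f A - \<mu>)\<^sup>2 * (1 / \<mu>\<^sup>2))"
  proof (intro expect_mono)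
    fix A
    have "1 \<le> (f A - \<mu>)\<^sup>2 * (1 / \<mu>\<^sup>2)" if "f A < 0"
    proof -
      have "\<mu>\<^sup>2 \<le> (\<mu> - f A)\<^sup>2" using that assms(4) by (intro power_mono) (auto simp: \<mu>_def)
      then show ?thesis using assms(4) by (simp add: \<mu>_def[symmetric] power2_commute)
    qed
    then show "of_bool (f A < 0) \<le> (f A - \<mu>)\<^sup>2 * (1 / \<mu>\<^sup>2)" by auto
  qed (use assms in auto)
  also have "\<dots> = expect (rset U p) (\<lambda>A. (f A)\<^sup>2 + \<mu>\<^sup>2 - 2 * \<mu> * f A) * (1 / \<mu>\<^sup>2)"
    by (simp add: power2_diff mult_ac)
  also have "expect (rset U p) (\<lambda>A. (f A)\<^sup>2 + \<mu>\<^sup>2 - 2 * \<mu> * f A) = expect (rset U p) (\<lambda>A. (f A)\<^sup>2) - \<mu>\<^sup>2"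
    using assms(1) by (simp add: \<mu>_def power2_eq_square)
  also have "\<dots> * (1 / \<mu>\<^sup>2) \<le> V * (1 / \<mu>\<^sup>2)"
    using efron_stein[OF assms(1-3), of f] var by (intro mult_right_mono) (auto simp: \<mu>_def)
  finally show ?thesis by (simp add: \<mu>_def)
qed

subsection \<open>Independence in product distributions\<close>

text \<open>Plays the part of measurability with respect to the coordinates in \<open>A\<close>. It
  quantifies over all functions, not only those in the support, and so passes through connectives
  and quantifiers without reference to a distribution.\<close>

definition dep_on :: "(('i \<Rightarrow> 'b) \<Rightarrow> bool) \<Rightarrow> 'i set \<Rightarrow> bool" where
  "dep_on P A \<longleftrightarrow> (\<forall>f g. (\<forall>x\<in>A. f x = g x) \<longrightarrow> P f = P g)"

lemma dep_onI:
  assumes "\<And>f g. (\<And>x. x \<in> A \<Longrightarrow> f x = g x) \<Longrightarrow> P f = P g"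
  shows "dep_on P A"
  unfolding dep_on_def by (intro allI impI, rule assms) simp

lemma dep_onD:
  assumes "dep_on P A" "\<And>x. x \<in> A \<Longrightarrow> f x = g x"
  shows "P f = P g"
proof -
  have "(\<forall>x\<in>A. f x = g x) \<longrightarrow> P f = P g" using assms(1) unfolding dep_on_def by (elim allE)
  then show ?thesis using assms(2) by simp
qed

lemma dep_on_not: "dep_on P A \<Longrightarrow> dep_on (\<lambda>f. \<not> P f) A"
  unfolding dep_on_def by blast

lemma dep_on_conj: "dep_on P A \<Longrightarrow> dep_on Q B \<Longrightarrow> dep_on (\<lambda>f. P f \<and> Q f) (A \<union> B)"
  unfolding dep_on_def by (intro allI impI arg_cong2[of _ _ _ _ "(\<and>)"]) blast+

lemma dep_on_all:
  fixes P :: "'j \<Rightarrow> ('i \<Rightarrow> 'b) \<Rightarrow> bool"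
  assumes "\<And>j. j \<in> J \<Longrightarrow> dep_on (P j) (A j)"
  shows "dep_on (\<lambda>f. \<forall>j\<in>J. P j f) (\<Union>j\<in>J. A j)"
proof (rule dep_onI)
  fix f g :: "'i \<Rightarrow> 'b" assume e: "\<And>x. x \<in> (\<Union>j\<in>J. A j) \<Longrightarrow> f x = g x"
  have "P j f = P j g" if "j \<in> J" for j
    by (rule dep_onD[OF assms[OF that]]) (use that e in blast)
  then show "(\<forall>j\<in>J. P j f) = (\<forall>j\<in>J. P j g)" by simp
qed

lemma prob_Pi_pmf_dep_on:
  assumes "finite I" "A \<subseteq> I" "dep_on P A"
  shows "measure_pmf.prob (Pi_pmf I d \<mu>) {f. P f} = measure_pmf.prob (Pi_pmf A d \<mu>) {f. P f}"
proof -
  have "measure_pmf.prob (Pi_pmf A d \<mu>) {f. P f} =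
      measure_pmf.prob (Pi_pmf I d \<mu>) {f. P (\<lambda>x. if x \<in> A then f x else d)}"
    using assms by (subst Pi_pmf_subset[of I A]) (auto simp: vimage_def)
  also have "(\<lambda>f. P (\<lambda>x. if x \<in> A then f x else d)) = P"
    by (intro ext dep_onD[OF assms(3)]) auto
  finally show ?thesis by simp
qed

lemma prob_indep2:
  fixes \<mu> :: "'i \<Rightarrow> 'b :: countable pmf"
  assumes "finite I" "A \<subseteq> I" "B \<subseteq> I" "A \<inter> B = {}" "dep_on P A" "dep_on Q B"
  shows "measure_pmf.prob (Pi_pmf I d \<mu>) {f. P f \<and> Q f} =
    measure_pmf.prob (Pi_pmf I d \<mu>) {f. P f} * measure_pmf.prob (Pi_pmf I d \<mu>) {f. Q f}"
proof -
  have fin: "finite A" "finite B" using assms(1-3) by (auto intro: finite_subset)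
  have "measure_pmf.prob (Pi_pmf I d \<mu>) {f. P f \<and> Q f} =
     measure_pmf.prob (Pi_pmf (A \<union> B) d \<mu>) {f. P f \<and> Q f}"
    using assms by (intro prob_Pi_pmf_dep_on dep_on_conj) auto
  also have "\<dots> = measure_pmf.prob (pair_pmf (Pi_pmf A d \<mu>) (Pi_pmf B d \<mu>))
      {(f, g). P (\<lambda>x. if x \<in> A then f x else g x) \<and> Q (\<lambda>x. if x \<in> A then f x else g x)}"
    using assms fin by (subst Pi_pmf_union) (auto simp: vimage_def case_prod_unfold)
  also have "{(f, g). P (\<lambda>x. if x \<in> A then f x else g x) \<and> Q (\<lambda>x. if x \<in> A then f x else g x)} =
      {f. P f} \<times> {g. Q g}"
  proof -
    have "P (\<lambda>x. if x \<in> A then f x else g x) = P f" for f g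
      by (intro dep_onD[OF assms(5)]) auto
    moreover have "Q (\<lambda>x. if x \<in> A then f x else g x) = Q g" for f g
      using assms(4) by (intro dep_onD[OF assms(6)]) auto
    ultimately show ?thesis by auto
  qed
  \<comment> \<open>Cutting down to the supports makes both factors countable, as the product
    formula requires.\<close>
  also have "measure_pmf.prob (pair_pmf (Pi_pmf A d \<mu>) (Pi_pmf B d \<mu>)) ({f. P f} \<times> {g. Q g}) =
      measure_pmf.prob (pair_pmf (Pi_pmf A d \<mu>) (Pi_pmf B d \<mu>))
       (({f. P f} \<inter> set_pmf (Pi_pmf A d \<mu>)) \<times> ({g. Q g} \<inter> set_pmf (Pi_pmf B d \<mu>)))"
    by (intro measure_prob_cong_0) (auto simp: pmf_pair set_pmf_iff)
  also have "\<dots> = measure_pmf.prob (Pi_pmf A d \<mu>) {f. P f} * measure_pmf.prob (Pi_pmf B d \<mu>) {f. Q f}"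
    by (subst measure_pmf_prob_product) (auto simp: measure_Int_set_pmf)
  finally show ?thesis using assms by (simp add: prob_Pi_pmf_dep_on)
qed

lemma prob_indep:
  fixes \<mu> :: "'i \<Rightarrow> 'b :: countable pmf"
  assumes "finite I" "finite J" "\<And>j. j \<in> J \<Longrightarrow> A j \<subseteq> I" "\<And>j. j \<in> J \<Longrightarrow> dep_on (P j) (A j)"
    and "\<And>i j. i \<in> J \<Longrightarrow> j \<in> J \<Longrightarrow> i \<noteq> j \<Longrightarrow> A i \<inter> A j = {}"
  shows "measure_pmf.prob (Pi_pmf I d \<mu>) {f. \<forall>j\<in>J. P j f} =
    (\<Prod>j\<in>J. measure_pmf.prob (Pi_pmf I d \<mu>) {f. P j f})"
  using assms(2-5)
proof (induction J rule: finite_induct)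
  case empty
  then show ?case by simp
next
  case (insert j J)
  have "measure_pmf.prob (Pi_pmf I d \<mu>) {f. P j f \<and> (\<forall>j\<in>J. P j f)} =
     measure_pmf.prob (Pi_pmf I d \<mu>) {f. P j f} * measure_pmf.prob (Pi_pmf I d \<mu>) {f. \<forall>j\<in>J. P j f}"
  proof (rule prob_indep2[where A = "A j" and B = "\<Union>i\<in>J. A i"])
    show "A j \<inter> (\<Union>i\<in>J. A i) = {}" using insert.prems(3) insert.hyps by blast
    show "dep_on (\<lambda>f. \<forall>j\<in>J. P j f) (\<Union>i\<in>J. A i)"
      by (rule dep_on_all) (use insert.prems in auto)
  qed (use assms(1) insert.prems in auto)
  also have "measure_pmf.prob (Pi_pmf I d \<mu>) {f. \<forall>j\<in>J. P j f} =
    (\<Prod>j\<in>J. measure_pmf.prob (Pi_pmf I d \<mu>) {f. P j f})"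
    by (rule insert.IH) (use insert.prems in auto)
  finally show ?case using insert.hyps by simp
qed

subsection \<open>Non-backtracking walks\<close>

text \<open>The bipartite incidence graph of a triple system, with vertices tagged
  \<open>Inl\<close> and triples tagged \<open>Inr\<close>.\<close>

fun incident :: "'v set set \<Rightarrow> 'v + 'v set \<Rightarrow> 'v + 'v set \<Rightarrow> bool" where
  "incident Ts (Inl v) (Inr T) \<longleftrightarrow> v \<in> T \<and> T \<in> Ts"
| "incident Ts (Inr T) (Inl v) \<longleftrightarrow> v \<in> T \<and> T \<in> Ts"
| "incident Ts _ _ \<longleftrightarrow> False"

fun nb_walk :: "'v set set \<Rightarrow> ('v + 'v set) list \<Rightarrow> bool" where
  "nb_walk Ts [] \<longleftrightarrow> True"
| "nb_walk Ts [x] \<longleftrightarrow> True"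
| "nb_walk Ts [x, y] \<longleftrightarrow> incident Ts x y"
| "nb_walk Ts (x # y # z # xs) \<longleftrightarrow> incident Ts x y \<and> x \<noteq> z \<and> nb_walk Ts (y # z # xs)"

lemma incident_sym: "incident Ts x y \<longleftrightarrow> incident Ts y x"
  by (cases x; cases y) auto

lemma nb_walk_snoc: "nb_walk Ts (xs @ [x, y, z]) \<longleftrightarrow> nb_walk Ts (xs @ [x, y]) \<and> incident Ts y z \<and> x \<noteq> z"
  by (induction Ts xs rule: nb_walk.induct) auto

lemma nb_walk_rev: "nb_walk Ts (rev xs) = nb_walk Ts xs"
proof (induction Ts xs rule: nb_walk.induct)
  case (4 Ts x y z xs)
  have "nb_walk Ts (rev (x # y # z # xs)) = nb_walk Ts (rev xs @ [z, y, x])" by simp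
  also have "\<dots> \<longleftrightarrow> nb_walk Ts (rev (y # z # xs)) \<and> incident Ts y x \<and> z \<noteq> x"
    unfolding nb_walk_snoc by simp
  finally show ?case using 4 by (auto simp: incident_sym)
qed (auto simp: incident_sym)

lemma nb_walk_glue: "nb_walk Ts (xs @ [y, x]) \<Longrightarrow> nb_walk Ts (x # z # ys) \<Longrightarrow> y \<noteq> z \<Longrightarrow> nb_walk Ts (xs @ y # x # z # ys)"
  by (induction Ts xs rule: nb_walk.induct) auto

text \<open>\<open>M\<close> counts nodes, not steps. Turning back is forbidden only in the interior
  of a walk, so closed walks in the shape of a lasso are excluded too, and neighbourhoods of small
  radius are trees.\<close>

definition no_closed_walk :: "'v set set \<Rightarrow> nat \<Rightarrow> bool" where
  "no_closed_walk Ts M \<longleftrightarrow> (\<forall>xs. nb_walk Ts xs \<and> 2 \<le> length xs \<and> length xs \<le> M \<longrightarrow> hd xs \<noteq> last xs)"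

text \<open>The part of the incidence graph that hangs from \<open>x\<close> on the side away from
  \<open>y\<close>, to depth \<open>n\<close>; \<open>x\<close> has depth zero, and \<open>y\<close>
  is there to forbid turning back.\<close>

definition branch :: "'v set set \<Rightarrow> nat \<Rightarrow> 'v + 'v set \<Rightarrow> 'v + 'v set \<Rightarrow> ('v + 'v set) set" where
  "branch Ts n y x = {last (x # ws) | ws. nb_walk Ts (y # x # ws) \<and> length ws \<le> n}"

text \<open>Branches that meet give a closed walk: up one of them in reverse, through
  \<open>x\<close>, down the other. Each branch supplies at most \<open>n + 1\<close> nodes, hence
  \<open>2 * n + 3\<close>.\<close>

lemma branch_disjoint:
  assumes "no_closed_walk Ts M" "2 * n + 3 \<le> M" "y1 \<noteq> y2"
  shows "branch Ts n x y1 \<inter> branch Ts n x y2 = {}"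
proof (rule ccontr)
  assume "branch Ts n x y1 \<inter> branch Ts n x y2 \<noteq> {}"
  then obtain us ws where u: "nb_walk Ts (x # y1 # us)" "length us \<le> n"
    and w: "nb_walk Ts (x # y2 # ws)" "length ws \<le> n" and eq: "last (y1 # us) = last (y2 # ws)"
    by (auto simp: branch_def)
  have "nb_walk Ts (rev us @ [y1, x])" using u(1) nb_walk_rev[of Ts "x # y1 # us"] by simp
  then have "nb_walk Ts (rev us @ y1 # x # y2 # ws)" using w(1) assms(3) by (rule nb_walk_glue)
  moreover have "hd (rev us @ y1 # x # y2 # ws) = last (y1 # us)"
    by (cases us rule: rev_cases) auto
  moreover have "last (rev us @ y1 # x # y2 # ws) = last (y2 # ws)" by simp
  moreover have "length (rev us @ y1 # x # y2 # ws) \<le> M" using u(2) w(2) assms(2) by simp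
  moreover have "2 \<le> length (rev us @ y1 # x # y2 # ws)" by simp
  ultimately have "last (y1 # us) \<noteq> last (y2 # ws)" using assms(1) unfolding no_closed_walk_def by metis
  then show False using eq by contradiction
qed

lemma not_in_branch:
  assumes "no_closed_walk Ts M" "n + 2 \<le> M"
  shows "x \<notin> branch Ts n x y"
proof
  assume "x \<in> branch Ts n x y"
  then obtain ws where "nb_walk Ts (x # y # ws)" "length ws \<le> n" "x = last (y # ws)"
    by (auto simp: branch_def)
  moreover from this have "2 \<le> length (x # y # ws)" "length (x # y # ws) \<le> M"
    using assms(2) by auto
  ultimately have "hd (x # y # ws) \<noteq> last (x # y # ws)" using assms(1) unfolding no_closed_walk_def by blast
  then show False using \<open>x = last (y # ws)\<close> by simp
qed

lemma in_branch_self: "incident Ts y x \<Longrightarrow> x \<in> branch Ts n y x"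
  by (auto simp: branch_def intro!: exI[of _ "[]"])

lemma branch_step:
  assumes "incident Ts y x" "y \<noteq> z"  "Suc n \<le> m"
  shows "branch Ts n x z \<subseteq> branch Ts m y x"
proof
  fix u assume "u \<in> branch Ts n x z"
  then obtain ws where "nb_walk Ts (x # z # ws)" "length ws \<le> n" "u = last (z # ws)"
    by (auto simp: branch_def)
  then show "u \<in> branch Ts m y x" using assms unfolding branch_def
    by (auto intro!: exI[of _ "z # ws"])
qed

lemma branch_mono:
  assumes "n \<le> m"
  shows "branch Ts n y x \<subseteq> branch Ts m y x"
proof
  fix u assume "u \<in> branch Ts n y x"
  then obtain ws where "nb_walk Ts (y # x # ws)" "length ws \<le> m" "u = last (x # ws)"
    using assms unfolding branch_def by (blast intro: le_trans)
  then show "u \<in> branch Ts m y x" unfolding branch_def by blast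
qed

lemma branch_subset_nodes:
  assumes "incident Ts y x" "\<Union>Ts \<subseteq> V"
  shows "branch Ts n y x \<subseteq> Inl ` V \<union> Inr ` Ts"
proof -
  have *: "nb_walk Ts (y # x # ws) \<Longrightarrow> incident Ts y x \<Longrightarrow> last (x # ws) \<in> Inl ` V \<union> Inr ` Ts" for ws y x
  proof (induction ws arbitrary: y x)
    case Nil
    then show ?case using assms(2) by (cases x; cases y) auto
  next
    case (Cons w ws)
    have "incident Ts x w" using Cons.prems by (cases ws) auto
    moreover have "nb_walk Ts (x # w # ws)" using Cons.prems by (cases ws) auto
    ultimately show ?case using Cons.IH[of x w] by simp
  qed
  show ?thesis
  proof
    fix u assume "u \<in> branch Ts n y x"
    then obtain ws where ws: "nb_walk Ts (y # x # ws)" "u = last (x # ws)" unfolding branch_def by blast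
    show "u \<in> Inl ` V \<union> Inr ` Ts" unfolding ws(2) by (rule *[OF ws(1) assms(1)])
  qed
qed

subsection \<open>Random greedy packings in locally acyclic triple systems\<close>

lemma exists_pmf_nat:
  fixes w :: "nat \<Rightarrow> real"
  assumes "\<And>k. k \<le> N \<Longrightarrow> 0 \<le> w k" "(\<Sum>k\<le>N. w k) = 1"
  shows "\<exists>M. \<forall>k. pmf M k = (if k \<le> N then w k else 0)"
proof -
  define w' where "w' = (\<lambda>k. if k \<le> N then w k else 0)"
  have "(\<integral>\<^sup>+ x. ennreal (w' x) \<partial>count_space UNIV) = (\<Sum>x\<le>N. ennreal (w' x))"
    by (rule nn_integral_count_space') (auto simp: w'_def)
  also have "\<dots> = ennreal (\<Sum>x\<le>N. w' x)"
    using assms(1) by (intro sum_ennreal) (auto simp: w'_def)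
  also have "(\<Sum>x\<le>N. w' x) = 1" using assms(2) by (simp add: w'_def)
  finally have "pmf (embed_pmf w') k = w' k" for k
    using assms(1) by (intro pmf_embed_pmf) (auto simp: w'_def)
  then show ?thesis unfolding w'_def by blast
qed

text \<open>Consecutive differences of \<open>c\<close> are the point masses; the mass
  \<open>1 - c 0\<close> sits at zero and the remaining \<open>c R\<close> at
  \<open>Suc R\<close>.\<close>

lemma exists_pmf_tail:
  fixes c :: "nat \<Rightarrow> real"
  assumes "c 0 \<le> 1" "0 \<le> c R" "\<And>k. k < R \<Longrightarrow> c (Suc k) \<le> c k"
  shows "\<exists>M. \<forall>k\<le>R. measure_pmf.prob M {x. k < x} = c k"
proof -
  define w where "w = (\<lambda>k. (if k = 0 then 1 else c (k - 1)) - (if k = Suc R then 0 else c k))"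
  have tel: "(\<Sum>i\<le>k. w i) = 1 - (if k = Suc R then 0 else c k)" if "k \<le> Suc R" for k
    using that by (induction k) (auto simp: w_def)
  have "0 \<le> w k" if "k \<le> Suc R" for k
    using assms(1,2) assms(3)[of "k - 1"] that by (cases k) (auto simp: w_def)
  then obtain M where M: "\<And>k. pmf M k = (if k \<le> Suc R then w k else 0)"
    using exists_pmf_nat[of "Suc R" w] tel[of "Suc R"] by auto
  have "measure_pmf.prob M {x. k < x} = c k" if "k \<le> R" for k
  proof -
    have "measure_pmf.prob M {x. k < x} = 1 - measure_pmf.prob M {..k}"
    proof -
      have "{x. k < x} = UNIV - {..k}" by auto
      then show ?thesis using measure_pmf.prob_compl[of "{..k}" M] by simp
    qed
    also have "measure_pmf.prob M {..k} = (\<Sum>i\<le>k. w i)"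
      using that by (subst measure_measure_pmf_finite) (auto simp: M intro!: sum.cong)
    finally show ?thesis using tel[of k] that by simp
  qed
  then show ?thesis by blast
qed

lemma prob_exclusive:
  assumes "finite J" "\<And>i j f. i \<in> J \<Longrightarrow> j \<in> J \<Longrightarrow> P i f \<Longrightarrow> P j f \<Longrightarrow> i = j"
  shows "measure_pmf.prob M {f. \<exists>j\<in>J. P j f} = (\<Sum>j\<in>J. measure_pmf.prob M {f. P j f})"
proof -
  have "{f. \<exists>j\<in>J. P j f} = (\<Union>j\<in>J. {f. P j f})" by auto
  moreover have "disjoint_family_on (\<lambda>j. {f. P j f}) J"
    using assms(2) by (auto simp: disjoint_family_on_def)
  ultimately show ?thesis
    using assms(1) by (simp add: measure_pmf.finite_measure_finite_Union)
qed

lemma prob_Pi_component: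
  assumes "finite I" "x \<in> I"
  shows "measure_pmf.prob (Pi_pmf I d \<mu>) {f. P (f x)} = measure_pmf.prob (\<mu> x) {y. P y}"
proof -
  have "\<mu> x = map_pmf (\<lambda>f. f x) (Pi_pmf I d \<mu>)" using assms by (simp add: Pi_pmf_component)
  then show ?thesis by (simp add: vimage_def)
qed

primrec alive :: "'v set set \<Rightarrow> ('v + 'v set \<Rightarrow> nat) \<Rightarrow> nat \<Rightarrow> 'v \<Rightarrow> 'v set \<Rightarrow> bool" where
  "alive Ts f 0 v T \<longleftrightarrow> 0 < f (Inl v)"
| "alive Ts f (Suc k) v T \<longleftrightarrow> alive Ts f k v T \<and> Suc k < f (Inl v) \<and>
     (\<forall>T'\<in>Ts. v \<in> T' \<and> T' \<noteq> T \<and> f (Inr T') = k \<longrightarrow> \<not> (\<forall>u\<in>T' - {v}. alive Ts f k u T'))"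

text \<open>Unrolling the recursion in time turns survival into one condition on the clock and one
  for each further triple at \<open>v\<close>. When there are no short cycles, these concern
  disjoint branches.\<close>

lemma alive_unfold:
  "alive Ts f k v T \<longleftrightarrow> k < f (Inl v) \<and>
     (\<forall>T'\<in>{T' \<in> Ts. v \<in> T' \<and> T' \<noteq> T}. \<not> (\<exists>j\<in>{..<k}. f (Inr T') = j \<and> (\<forall>u\<in>T' - {v}. alive Ts f j u T')))"
proof (induction k)
  case (Suc k)
  show ?case unfolding alive.simps Suc.IH lessThan_Suc by auto
qed auto

text \<open>One unit of time looks one triple further, which is two steps in the incidence graph,
  hence depth \<open>2 * k\<close>. Ignoring \<open>T\<close> keeps the dependence on the side of
  \<open>v\<close> away from \<open>T\<close>.\<close>

lemma alive_cong:
  assumes "T \<in> Ts" "v \<in> T" "\<And>x. x \<in> branch Ts (2 * k) (Inr T) (Inl v) \<Longrightarrow> f x = g x"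
  shows "alive Ts f k v T = alive Ts g k v T"
  using assms
proof (induction k arbitrary: v T)
  case 0
  then have "f (Inl v) = g (Inl v)" by (intro 0(3) in_branch_self) auto
  then show ?case by simp
next
  case (Suc k)
  have v: "f (Inl v) = g (Inl v)" using Suc.prems by (intro Suc.prems(3) in_branch_self) auto
  have 1: "alive Ts f k v T = alive Ts g k v T"
  proof (rule Suc.IH)
    fix x assume "x \<in> branch Ts (2 * k) (Inr T) (Inl v)"
    moreover have "branch Ts (2 * k) (Inr T) (Inl v) \<subseteq> branch Ts (2 * Suc k) (Inr T) (Inl v)"
      by (rule branch_mono) simp
    ultimately show "f x = g x" using Suc.prems by blast
  qed (use Suc.prems in auto)
  have 2: "f (Inr T') = g (Inr T')" if "T' \<in> Ts" "v \<in> T'" "T' \<noteq> T" for T'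
  proof (rule Suc.prems(3))
    have "branch Ts 0 (Inl v) (Inr T') \<subseteq> branch Ts (2 * Suc k) (Inr T) (Inl v)"
      using that Suc.prems by (intro branch_step) auto
    moreover have "Inr T' \<in> branch Ts 0 (Inl v) (Inr T')" using that by (intro in_branch_self) auto
    ultimately show "Inr T' \<in> branch Ts (2 * Suc k) (Inr T) (Inl v)" by blast
  qed
  have 3: "alive Ts f k u T' = alive Ts g k u T'" if "T' \<in> Ts" "v \<in> T'" "T' \<noteq> T" "u \<in> T'" "u \<noteq> v" for T' u
  proof (rule Suc.IH)
    fix x assume x: "x \<in> branch Ts (2 * k) (Inr T') (Inl u)"
    have "branch Ts (2 * k) (Inr T') (Inl u) \<subseteq> branch Ts (2 * k + 1) (Inl v) (Inr T')"
      using that by (intro branch_step) auto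
    also have "\<dots> \<subseteq> branch Ts (2 * Suc k) (Inr T) (Inl v)"
      using that Suc.prems by (intro branch_step) auto
    finally show "f x = g x" using Suc.prems x by blast
  qed (use that in auto)
  show ?case unfolding alive.simps v 1 using 2 3 by (metis DiffE insertI1)
qed

lemma dep_on_alive: "T \<in> Ts \<Longrightarrow> v \<in> T \<Longrightarrow> dep_on (\<lambda>f. alive Ts f k v T) (branch Ts (2 * k) (Inr T) (Inl v))"
  by (intro dep_onI alive_cong) auto

text \<open>Each vertex carries a clock (it is retained iff the clock is positive) and each triple a label,
  the time at which it is considered. \<open>alive Ts f k v T\<close> says that \<open>v\<close> survives up to time \<open>k\<close> when
  \<open>T\<close> is ignored. The clocks compensate for the missing triples at vertices of small degree, so that
  the survival probability is the same, \<open>a k\<close>, at every vertex; the label weights \<open>wt\<close> make it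
  geometric in \<open>k\<close>, a discretisation of \<open>\<theta> (1 + 2 lam t) powr (-1/2)\<close>, without error terms.\<close>

locale nibble =
  fixes Ts :: "'v set set" and V :: "'v set" and R d :: nat and D \<theta> :: real
  assumes finV: "finite V" and TsV: "\<Union>Ts \<subseteq> V"
    and card3: "\<And>T. T \<in> Ts \<Longrightarrow> card T = 3"
    and deg: "\<And>v. v \<in> V \<Longrightarrow> card {T \<in> Ts. v \<in> T} \<le> d"
    and no_closed_walk: "no_closed_walk Ts (4 * R + 8)"
    and \<theta>: "0 < \<theta>" "\<theta> \<le> 1" and R: "0 < R" and d: "1 \<le> d"
    and D: "real d + ln (1 + 2 * (D * \<theta>\<^sup>2)) / 2 \<le> D" "0 < D"
begin

definition lam where "lam = D * \<theta>\<^sup>2"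
text \<open>The value for which \<open>exp (2 * x) / lam\<close> has integral one over the interval
  from 0 to \<open>S\<close>, so that labels below \<open>R\<close> carry almost all the mass when
  \<open>R\<close> is large.\<close>

definition S where "S = ln (1 + 2 * lam) / 2"
definition h where "h = S / R"
definition a :: "nat \<Rightarrow> real" where "a k = \<theta> * exp (- (real k * h))"
text \<open>Chosen so that \<open>wt k * (a k)\<^sup>2 = h / D\<close>: a further triple at a vertex
  is equally likely to remove it at every time.\<close>

definition wt :: "nat \<Rightarrow> real" where "wt k = h * exp (2 * (real k * h)) / lam"
text \<open>The target \<open>a k\<close> divided by the probability that none of the other
  \<open>g - 1\<close> triples at a vertex of degree \<open>g\<close> has removed it by time
  \<open>k\<close>. The minus one accounts for the ignored triple.\<close>

definition tail :: "nat \<Rightarrow> nat \<Rightarrow> real" where "tail g k = a k / (1 - real k * h / D) ^ (g - 1)"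

lemma lam_pos: "0 < lam" using \<theta> D by (simp add: lam_def)
lemma S_pos: "0 < S" using lam_pos by (simp add: S_def)
lemma h_pos: "0 < h" using S_pos R by (simp add: h_def)
lemma S_eq: "S = real R * h" using R by (simp add: h_def)
lemma exp_2S: "exp (2 * S) = 1 + 2 * lam" using lam_pos by (simp add: S_def)
lemma kh_le: "k \<le> R \<Longrightarrow> real k * h \<le> S" using h_pos by (simp add: S_eq)
lemma D_ge: "real d + S \<le> D" using D by (simp add: S_def lam_def)
lemma finTs: "finite Ts" using finV TsV by (metis finite_UnionD finite_subset)

lemma wt_nonneg: "0 \<le> wt k" using h_pos lam_pos by (simp add: wt_def)
lemma wt_a2: "wt k * (a k)\<^sup>2 = h / D"
proof -
  have "exp (2 * (real k * h)) * (exp (- (real k * h)))\<^sup>2 = 1"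
    by (simp add: power2_eq_square flip: exp_add)
  then show ?thesis using \<theta> D unfolding wt_def a_def lam_def power_mult_distrib
    by (simp add: field_simps)
qed

text \<open>A left Riemann sum of an increasing function lies below its integral, which is one by
  the choice of \<open>S\<close>. The sum is geometric, so this amounts to
  \<open>exp (2 * h) - 1 \<ge> 2 * h\<close>.\<close>

lemma wt_sum: "(\<Sum>k<R. wt k) \<le> 1"
proof -
  define x where "x = exp (2 * h)"
  have "1 + 2 * h \<le> x" unfolding x_def by (rule exp_ge_add_one_self)
  then have x: "x - 1 \<ge> 2 * h" "x > 1" using h_pos by auto
  have "exp (2 * (real k * h)) = x ^ k" for k
    by (simp add: x_def flip: exp_of_nat_mult)
  then have "(\<Sum>k<R. wt k) = h / lam * (\<Sum>k<R. x ^ k)"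
    by (simp add: wt_def sum_distrib_left)
  also have "(\<Sum>k<R. x ^ k) = (x ^ R - 1) / (x - 1)" using x by (intro geometric_sum) auto
  also have "x ^ R = 1 + 2 * lam"
    using exp_2S by (simp add: x_def S_eq mult.left_commute flip: exp_of_nat_mult)
  also have "h / lam * ((1 + 2 * lam - 1) / (x - 1)) = 2 * h / (x - 1)" using lam_pos by simp
  also have "\<dots> \<le> 1" using x by simp
  finally show ?thesis .
qed

text \<open>The sum is the probability that a triple becomes a candidate. Its terms are proportional
  to \<open>exp (- (real k * h))\<close>, and a left Riemann sum of this decreasing function lies
  above the integral \<open>1 - exp (- S)\<close>.\<close>

lemma wt_a3: "(\<Sum>k<R. wt k * a k ^ 3) \<ge> \<theta> ^ 3 / lam * (1 - 1 / sqrt (1 + 2 * lam))"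
proof -
  define x where "x = exp (- h)"
  have x: "1 - x \<le> h" "0 < x" "x < 1" using exp_ge_add_one_self[of "- h"] h_pos by (auto simp: x_def)
  have eS: "exp (- S) = 1 / sqrt (1 + 2 * lam)"
  proof -
    have "(exp S)\<^sup>2 = 1 + 2 * lam" using exp_2S by (simp add: exp_double)
    then have "exp S = sqrt (1 + 2 * lam)" by (metis exp_ge_zero real_sqrt_unique)
    then show ?thesis by (simp add: exp_minus field_simps)
  qed
  have "wt k * a k ^ 3 = \<theta> ^ 3 * h / lam * x ^ k" for k
  proof -
    have "wt k * a k ^ 3 = (wt k * (a k)\<^sup>2) * a k" by (simp add: power3_eq_cube power2_eq_square)
    also have "\<dots> = h / D * (\<theta> * x ^ k)" unfolding wt_a2
      by (simp add: a_def x_def flip: exp_of_nat_mult)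
    also have "\<dots> = \<theta> ^ 3 * h / lam * x ^ k"
      using \<theta> D by (simp add: lam_def power3_eq_cube power2_eq_square)
    finally show ?thesis .
  qed
  then have "(\<Sum>k<R. wt k * a k ^ 3) = \<theta> ^ 3 / lam * (h * (\<Sum>k<R. x ^ k))"
    by (simp add: sum_distrib_left mult.assoc)
  also have "(\<Sum>k<R. x ^ k) = (1 - x ^ R) / (1 - x)"
    using x by (subst geometric_sum) (auto simp: field_simps)
  also have "x ^ R = exp (- S)" by (simp add: x_def S_eq flip: exp_of_nat_mult)
  finally have eq: "(\<Sum>k<R. wt k * a k ^ 3) = \<theta> ^ 3 / lam * (h * ((1 - exp (- S)) / (1 - x)))" .
  have "h * ((1 - exp (- S)) / (1 - x)) \<ge> 1 - exp (- S)"
  proof -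
    have "1 \<le> h / (1 - x)" using x by simp
    then have "(1 - exp (- S)) * 1 \<le> (1 - exp (- S)) * (h / (1 - x))"
      using S_pos by (intro mult_left_mono) auto
    then show ?thesis by (simp add: mult.commute)
  qed
  then show ?thesis unfolding eq eS using \<theta> lam_pos by (intro mult_left_mono) auto
qed

lemma kh_D: "k \<le> R \<Longrightarrow> real k * h / D < 1" "0 \<le> real k * h / D"
proof -
  assume "k \<le> R"
  then have "real k * h < D" using kh_le[of k] D_ge d by simp
  then show "real k * h / D < 1" using D by simp
next
  show "0 \<le> real k * h / D" using h_pos D by simp
qed

text \<open>Needs \<open>real d + S \<le> D\<close>: one step multiplies the tail by
  \<open>exp (- h) * ((y + h) / y) ^ (g - 1)\<close> with \<open>y \<ge> d\<close>, which is at most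
  one. A decreasing tail is what allows the clock to exist.\<close>

lemma tail_step:
  assumes "k < R" "g \<le> d"
  shows "tail g (Suc k) \<le> tail g k"
proof -
  define y where "y = D - real (Suc k) * h"
  have y: "y \<ge> real d" using kh_le[of "Suc k"] D_ge assms by (simp add: y_def)
  then have y0: "y > 0" using d by simp
  have p: "1 - real (Suc k) * h / D = y / D" "1 - real k * h / D = (y + h) / D"
    using D by (auto simp: y_def field_simps)
  have "((y + h) / y) ^ (g - 1) \<le> exp h"
  proof -
    have "((y + h) / y) ^ (g - 1) = (1 + h / y) ^ (g - 1)" using y0 by (simp add: field_simps)
    also have "\<dots> \<le> (exp (h / y)) ^ (g - 1)"
      using exp_ge_add_one_self[of "h / y"] y0 h_pos by (intro power_mono) auto
    also have "\<dots> = exp (real (g - 1) * (h / y))" by (simp flip: exp_of_nat_mult)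
    also have "\<dots> \<le> exp h"
    proof -
      have "real (g - 1) \<le> y" using assms y by linarith
      then have "real (g - 1) * h \<le> h * y" using h_pos by (simp add: mult.commute)
      then show ?thesis using y0 by (simp add: pos_divide_le_eq)
    qed
    finally show ?thesis .
  qed
  then have "exp (- h) * ((y + h) / y) ^ (g - 1) \<le> exp (- h) * exp h"
    by (intro mult_left_mono) auto
  then have le1: "exp (- h) * ((y + h) / y) ^ (g - 1) \<le> 1" by (simp flip: exp_add)
  have "tail g (Suc k) = tail g k * (exp (- h) * ((y + h) / y) ^ (g - 1))"
  proof -
    have "a (Suc k) = a k * exp (- h)"
      by (simp add: a_def algebra_simps flip: exp_add)
    then show ?thesis unfolding tail_def p using y0 D h_pos by (simp add: field_simps)
  qed
  also have "\<dots> \<le> tail g k * 1"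
  proof (intro mult_left_mono le1)
    show "0 \<le> tail g k" unfolding tail_def p a_def using y0 h_pos \<theta> D by simp
  qed
  finally show ?thesis by simp
qed

definition clk :: "nat \<Rightarrow> nat pmf" where
  "clk g = (SOME M. \<forall>k\<le>R. measure_pmf.prob M {x. k < x} = tail g k)"

lemma clk:
  assumes "g \<le> d" "k \<le> R"
  shows "measure_pmf.prob (clk g) {x. k < x} = tail g k"
proof -
  have "\<exists>M. \<forall>k\<le>R. measure_pmf.prob M {x. k < x} = tail g k"
  proof (rule exists_pmf_tail)
    show "tail g 0 \<le> 1" using \<theta> by (simp add: tail_def a_def)
    show "0 \<le> tail g R" using kh_D(1)[of R] \<theta> by (simp add: tail_def a_def)
  qed (use tail_step assms in auto)
  then have "\<forall>k\<le>R. measure_pmf.prob (clk g) {x. k < x} = tail g k"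
    unfolding clk_def by (rule someI_ex)
  then show ?thesis using assms by blast
qed

text \<open>The value \<open>R\<close> collects the remaining mass; a triple with this label is
  never considered.\<close>

definition lab :: "nat pmf" where
  "lab = (SOME M. \<forall>k. pmf M k = (if k \<le> R then (if k < R then wt k else 1 - (\<Sum>k<R. wt k)) else 0))"

lemma lab: "k < R \<Longrightarrow> pmf lab k = wt k"
proof -
  define w where "w = (\<lambda>k. if k < R then wt k else 1 - (\<Sum>k<R. wt k))"
  have "(\<Sum>k\<le>R. w k) = 1"
    by (simp add: w_def flip: lessThan_Suc_atMost)
  then have "\<exists>M. \<forall>k. pmf M k = (if k \<le> R then w k else 0)"
    using wt_nonneg wt_sum by (intro exists_pmf_nat) (auto simp: w_def)
  then have "\<forall>k. pmf lab k = (if k \<le> R then w k else 0)"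
    unfolding lab_def w_def by (rule someI_ex)
  then show "k < R \<Longrightarrow> pmf lab k = wt k" by (simp add: w_def)
qed

section \<open>The product space of clocks and labels\<close>

definition \<mu> :: "'v + 'v set \<Rightarrow> nat pmf" where
  "\<mu> x = (case x of Inl v \<Rightarrow> clk (card {T \<in> Ts. v \<in> T}) | Inr T \<Rightarrow> lab)"

definition nodes where "nodes = Inl ` V \<union> Inr ` Ts"

definition \<Omega> where "\<Omega> = Pi_pmf nodes 0 \<mu>"

abbreviation prb :: "(('v + 'v set \<Rightarrow> nat) \<Rightarrow> bool) \<Rightarrow> real" where
  "prb P \<equiv> measure_pmf.prob \<Omega> {f. P f}"

lemma fin_nodes: "finite nodes" using finV finTs by (simp add: nodes_def)

lemma prb_clock: "v \<in> V \<Longrightarrow> k \<le> R \<Longrightarrow> prb (\<lambda>f. k < f (Inl v)) = tail (card {T \<in> Ts. v \<in> T}) k"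
  unfolding \<Omega>_def using fin_nodes deg
  by (subst prob_Pi_component) (auto simp: nodes_def \<mu>_def clk)

lemma prb_label: "T \<in> Ts \<Longrightarrow> k < R \<Longrightarrow> prb (\<lambda>f. f (Inr T) = k) = wt k"
  unfolding \<Omega>_def using fin_nodes
  by (subst prob_Pi_component) (auto simp: nodes_def \<mu>_def lab measure_pmf_single)

lemma branch_nodes: "T \<in> Ts \<Longrightarrow> v \<in> T \<Longrightarrow> branch Ts n (Inr T) (Inl v) \<subseteq> nodes"
  unfolding nodes_def using TsV by (intro branch_subset_nodes) auto

lemma branch_nodes': "T \<in> Ts \<Longrightarrow> v \<in> T \<Longrightarrow> branch Ts n (Inl v) (Inr T) \<subseteq> nodes"
  unfolding nodes_def using TsV by (intro branch_subset_nodes) auto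

text \<open>The vertices of \<open>T\<close> see disjoint branches, none containing
  \<open>T\<close>, so the label and the survivals are independent. Used with
  \<open>U = T - {v}\<close> for the removal of \<open>v\<close>, and with \<open>U = T\<close> for
  the selection of \<open>T\<close>.\<close>

lemma prb_label_alive:
  assumes T: "T \<in> Ts" "U \<subseteq> T" and j: "j < R" and IH: "\<And>u. u \<in> T \<Longrightarrow> prb (\<lambda>f. alive Ts f j u T) = a j"
  shows "prb (\<lambda>f. f (Inr T) = j \<and> (\<forall>u\<in>U. alive Ts f j u T)) = wt j * a j ^ card U"
proof -
  have finU: "finite U" using T finV TsV by (meson Sup_upper finite_subset)
  have "prb (\<lambda>f. f (Inr T) = j \<and> (\<forall>u\<in>U. alive Ts f j u T)) =
     prb (\<lambda>f. f (Inr T) = j) * prb (\<lambda>f. \<forall>u\<in>U. alive Ts f j u T)"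
    unfolding \<Omega>_def
  proof (rule prob_indep2[where A = "{Inr T}" and B = "\<Union>u\<in>U. branch Ts (2 * j) (Inr T) (Inl u)"])
    show "{Inr T} \<inter> (\<Union>u\<in>U. branch Ts (2 * j) (Inr T) (Inl u)) = {}"
      using not_in_branch[OF no_closed_walk] j by auto
    show "(\<Union>u\<in>U. branch Ts (2 * j) (Inr T) (Inl u)) \<subseteq> nodes" using branch_nodes T by blast
    show "dep_on (\<lambda>f. \<forall>u\<in>U. alive Ts f j u T) (\<Union>u\<in>U. branch Ts (2 * j) (Inr T) (Inl u))"
      using T by (intro dep_on_all dep_on_alive) auto
  qed (use fin_nodes T in \<open>auto simp: nodes_def intro: dep_onI\<close>)
  also have "prb (\<lambda>f. \<forall>u\<in>U. alive Ts f j u T) = (\<Prod>u\<in>U. prb (\<lambda>f. alive Ts f j u T))"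
    unfolding \<Omega>_def
  proof (rule prob_indep[where A = "\<lambda>u. branch Ts (2 * j) (Inr T) (Inl u)"])
    show "branch Ts (2 * j) (Inr T) (Inl u) \<inter> branch Ts (2 * j) (Inr T) (Inl v) = {}" if "u \<noteq> v" for u v
      using that j by (intro branch_disjoint[OF no_closed_walk]) auto
    show "branch Ts (2 * j) (Inr T) (Inl u) \<subseteq> nodes" if "u \<in> U" for u
      using that T by (intro branch_nodes) auto
    show "dep_on (\<lambda>f. alive Ts f j u T) (branch Ts (2 * j) (Inr T) (Inl u))" if "u \<in> U" for u
      using that T by (intro dep_on_alive) auto
  qed (use fin_nodes finU in auto)
  also have "\<dots> = a j ^ card U" using IH T by (simp add: subset_iff)
  finally show ?thesis using prb_label[OF T(1) j] by simp
qed

text \<open>By induction, a further triple at \<open>v\<close> has removed it by time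
  \<open>k\<close> with probability \<open>(\<Sum>j<k. wt j * (a j)\<^sup>2) = k * h / D\<close>,
  independently of the other triples. The resulting power is the denominator in the tail of the
  clock, so the degree of \<open>v\<close> cancels.\<close>

lemma prb_alive: "k \<le> R \<Longrightarrow> T \<in> Ts \<Longrightarrow> v \<in> T \<Longrightarrow> prb (\<lambda>f. alive Ts f k v T) = a k"
proof (induction k arbitrary: v T rule: less_induct)
  case (less k)
  define N where "N = {T' \<in> Ts. v \<in> T' \<and> T' \<noteq> T}"
  define Q where "Q = (\<lambda>T' f. \<exists>j\<in>{..<k}. f (Inr T') = j \<and> (\<forall>u\<in>T' - {v}. alive Ts f j u T'))"
  define G where "G = {T' \<in> Ts. v \<in> T'}"
  have finN: "finite N" using finTs by (simp add: N_def)
  have vV: "v \<in> V" using less.prems TsV by auto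
  have cardN: "card N = card G - 1"
  proof -
    have "N = G - {T}" by (auto simp: N_def G_def)
    then show ?thesis using less.prems finTs by (simp add: G_def card_Diff_singleton)
  qed
  have depQ: "dep_on (Q T') (branch Ts (2 * k) (Inl v) (Inr T'))" if "T' \<in> N" for T'
  proof (rule dep_onI)
    fix f g :: "'v + 'v set \<Rightarrow> nat"
    assume fg: "\<And>x. x \<in> branch Ts (2 * k) (Inl v) (Inr T') \<Longrightarrow> f x = g x"
    have T': "T' \<in> Ts" "v \<in> T'" using that by (auto simp: N_def)
    have 1: "f (Inr T') = g (Inr T')" using T' by (intro fg in_branch_self) auto
    have 2: "alive Ts f j u T' = alive Ts g j u T'" if "j < k" "u \<in> T' - {v}" for j u
    proof (rule alive_cong)
      fix x assume x: "x \<in> branch Ts (2 * j) (Inr T') (Inl u)"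
      have "branch Ts (2 * j) (Inr T') (Inl u) \<subseteq> branch Ts (2 * k) (Inl v) (Inr T')"
        using that T' by (intro branch_step) auto
      then show "f x = g x" using fg x by blast
    qed (use T' that in auto)
    show "Q T' f = Q T' g" unfolding Q_def using 1 2 by (intro bex_cong refl conj_cong ball_cong) auto
  qed
  have prQ: "prb (\<lambda>f. \<not> Q T' f) = 1 - real k * h / D" if "T' \<in> N" for T'
  proof -
    have T': "T' \<in> Ts" "v \<in> T'" using that by (auto simp: N_def)
    have "prb (Q T') = (\<Sum>j<k. prb (\<lambda>f. f (Inr T') = j \<and> (\<forall>u\<in>T' - {v}. alive Ts f j u T')))"
      unfolding Q_def by (rule prob_exclusive) auto
    also have "\<dots> = (\<Sum>j<k. wt j * a j ^ card (T' - {v}))"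
      using T' less.prems less.IH by (intro sum.cong prb_label_alive) auto
    also have "card (T' - {v}) = 2" using T' card3[of T'] by simp
    finally have "prb (Q T') = real k * h / D" by (simp add: wt_a2)
    moreover have "prb (\<lambda>f. \<not> Q T' f) = 1 - prb (Q T')"
    proof -
      have "{f. \<not> Q T' f} = UNIV - {f. Q T' f}" by auto
      then show ?thesis using measure_pmf.prob_compl[of "{f. Q T' f}" \<Omega>] by simp
    qed
    ultimately show ?thesis by simp
  qed
  have "prb (\<lambda>f. alive Ts f k v T) = prb (\<lambda>f. k < f (Inl v) \<and> (\<forall>T'\<in>N. \<not> Q T' f))"
    unfolding N_def Q_def by (subst alive_unfold) simp
  also have "\<dots> = prb (\<lambda>f. k < f (Inl v)) * prb (\<lambda>f. \<forall>T'\<in>N. \<not> Q T' f)"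
    unfolding \<Omega>_def
  proof (rule prob_indep2[where A = "{Inl v}" and B = "\<Union>T'\<in>N. branch Ts (2 * k) (Inl v) (Inr T')"])
    show "{Inl v} \<inter> (\<Union>T'\<in>N. branch Ts (2 * k) (Inl v) (Inr T')) = {}"
      using not_in_branch[OF no_closed_walk] less.prems by auto
    show "(\<Union>T'\<in>N. branch Ts (2 * k) (Inl v) (Inr T')) \<subseteq> nodes"
      unfolding N_def using branch_nodes' by blast
    show "dep_on (\<lambda>f. \<forall>T'\<in>N. \<not> Q T' f) (\<Union>T'\<in>N. branch Ts (2 * k) (Inl v) (Inr T'))"
      by (intro dep_on_all dep_on_not depQ)
  qed (use fin_nodes vV in \<open>auto simp: nodes_def intro: dep_onI\<close>)
  also have "prb (\<lambda>f. \<forall>T'\<in>N. \<not> Q T' f) = (\<Prod>T'\<in>N. prb (\<lambda>f. \<not> Q T' f))"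
    unfolding \<Omega>_def
  proof (rule prob_indep[where A = "\<lambda>T'. branch Ts (2 * k) (Inl v) (Inr T')"])
    show "branch Ts (2 * k) (Inl v) (Inr T') \<inter> branch Ts (2 * k) (Inl v) (Inr T'') = {}" if "T' \<noteq> T''" for T' T''
      using that less.prems by (intro branch_disjoint[OF no_closed_walk]) auto
    show "branch Ts (2 * k) (Inl v) (Inr T') \<subseteq> nodes" if "T' \<in> N" for T'
      using that by (intro branch_nodes') (auto simp: N_def)
  qed (use fin_nodes finN depQ in \<open>auto intro: dep_on_not\<close>)
  also have "\<dots> = (1 - real k * h / D) ^ (card G - 1)"
    by (simp add: prQ cardN)
  also have "prb (\<lambda>f. k < f (Inl v)) = tail (card G) k"
    unfolding G_def using vV less.prems by (intro prb_clock)
  finally have "prb (\<lambda>f. alive Ts f k v T) = tail (card G) k * (1 - real k * h / D) ^ (card G - 1)" .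
  moreover have "1 - real k * h / D \<noteq> 0" using kh_D(1)[OF less.prems(1)] by linarith
  moreover have "x \<noteq> 0 \<Longrightarrow> a k / x ^ n * x ^ n = a k" for x n by simp
  ultimately show ?case by (simp only: tail_def)
qed

definition candidate where "candidate f T \<longleftrightarrow> f (Inr T) < R \<and> (\<forall>u\<in>T. alive Ts f (f (Inr T)) u T)"

lemma prb_candidate:
  assumes "T \<in> Ts"
  shows "prb (\<lambda>f. candidate f T) = (\<Sum>k<R. wt k * a k ^ 3)"
proof -
  have "prb (\<lambda>f. candidate f T) = prb (\<lambda>f. \<exists>k\<in>{..<R}. f (Inr T) = k \<and> (\<forall>u\<in>T. alive Ts f k u T))"
    by (intro arg_cong[of _ _ "measure_pmf.prob \<Omega>"]) (auto simp: candidate_def)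
  also have "\<dots> = (\<Sum>k<R. prb (\<lambda>f. f (Inr T) = k \<and> (\<forall>u\<in>T. alive Ts f k u T)))"
    by (rule prob_exclusive) auto
  also have "\<dots> = (\<Sum>k<R. wt k * a k ^ card T)"
    using assms prb_alive by (intro sum.cong prb_label_alive) auto
  finally show ?thesis using card3[OF assms] by simp
qed

text \<open>If \<open>T'\<close> had the smaller label, its selection would already have removed
  \<open>v\<close>, and \<open>T\<close> could not be a candidate. So candidates that intersect are
  tied.\<close>

lemma candidate_conflict_le:
  assumes "candidate f T" "candidate f T'" "T' \<in> Ts" "T \<noteq> T'" "v \<in> T" "v \<in> T'"
  shows "f (Inr T) \<le> f (Inr T')"
proof (rule ccontr)
  assume "\<not> ?thesis"
  then have lt: "f (Inr T') < f (Inr T)" by simp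
  have "alive Ts f (f (Inr T)) v T" using assms by (simp add: candidate_def)
  then have "\<not> (\<forall>u\<in>T' - {v}. alive Ts f (f (Inr T')) u T')"
    using lt assms by (subst (asm) alive_unfold) auto
  then show False using assms(2) by (simp add: candidate_def)
qed

lemma candidate_conflict:
  assumes "candidate f T" "candidate f T'" "T \<in> Ts" "T' \<in> Ts" "T \<noteq> T'" "v \<in> T" "v \<in> T'"
  shows "f (Inr T) = f (Inr T')"
  using candidate_conflict_le[of f T T' v] candidate_conflict_le[of f T' T v] assms by auto

section \<open>Ties between intersecting triples\<close>

definition pairs where "pairs = {(T, T'). T \<in> Ts \<and> T' \<in> Ts \<and> T \<noteq> T' \<and> T \<inter> T' \<noteq> {}}"

lemma card_pairs: "card pairs \<le> card Ts * (3 * d)"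
proof -
  have "pairs \<subseteq> Sigma Ts (\<lambda>T. \<Union>v\<in>T. {T' \<in> Ts. v \<in> T'})" by (auto simp: pairs_def)
  moreover have fin: "finite T" if "T \<in> Ts" for T using card3[OF that] by (simp add: card_ge_0_finite)
  ultimately have "card pairs \<le> card (Sigma Ts (\<lambda>T. \<Union>v\<in>T. {T' \<in> Ts. v \<in> T'}))"
    using finTs by (intro card_mono finite_SigmaI) auto
  also have "\<dots> = (\<Sum>T\<in>Ts. card (\<Union>v\<in>T. {T' \<in> Ts. v \<in> T'}))"
    using finTs fin by (intro card_SigmaI) auto
  also have "\<dots> \<le> (\<Sum>T\<in>Ts. 3 * d)"
  proof (intro sum_mono)
    fix T assume T: "T \<in> Ts"
    have "card (\<Union>v\<in>T. {T' \<in> Ts. v \<in> T'}) \<le> (\<Sum>v\<in>T. card {T' \<in> Ts. v \<in> T'})"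
      using fin[OF T] by (rule card_UN_le)
    also have "\<dots> \<le> (\<Sum>v\<in>T. d)" using TsV T by (intro sum_mono deg) auto
    finally show "card (\<Union>v\<in>T. {T' \<in> Ts. v \<in> T'}) \<le> 3 * d" using card3[OF T] by simp
  qed
  finally show ?thesis by simp
qed

text \<open>The sum of the squared weights is at most the largest weight, which is of order
  \<open>h\<close>; ties become negligible as \<open>R\<close> grows.\<close>

lemma prb_same_label:
  assumes "T \<in> Ts" "T' \<in> Ts" "T \<noteq> T'"
  shows "prb (\<lambda>f. f (Inr T) < R \<and> f (Inr T) = f (Inr T')) \<le> h * (1 + 2 * lam) / lam"
proof -
  have "prb (\<lambda>f. f (Inr T) < R \<and> f (Inr T) = f (Inr T')) =
      prb (\<lambda>f. \<exists>k\<in>{..<R}. f (Inr T) = k \<and> f (Inr T') = k)"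
    by (intro arg_cong[of _ _ "measure_pmf.prob \<Omega>"]) auto
  also have "\<dots> = (\<Sum>k<R. prb (\<lambda>f. f (Inr T) = k \<and> f (Inr T') = k))"
    by (rule prob_exclusive) auto
  also have "\<dots> = (\<Sum>k<R. prb (\<lambda>f. f (Inr T) = k) * prb (\<lambda>f. f (Inr T') = k))"
    unfolding \<Omega>_def
  proof (intro sum.cong refl prob_indep2)
    show "{Inr T} \<inter> {Inr T'} = ({} :: ('v + 'v set) set)" using assms by auto
  qed (use fin_nodes assms in \<open>auto simp: nodes_def intro: dep_onI\<close>)
  also have "\<dots> = (\<Sum>k<R. wt k * wt k)" using assms by (simp add: prb_label)
  also have "\<dots> \<le> (\<Sum>k<R. h * (1 + 2 * lam) / lam * wt k)"
  proof (intro sum_mono mult_right_mono wt_nonneg)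
    fix k assume "k \<in> {..<R}"
    then have "exp (2 * (real k * h)) \<le> exp (2 * S)" using kh_le[of k] by simp
    then show "wt k \<le> h * (1 + 2 * lam) / lam" unfolding wt_def exp_2S
      using h_pos lam_pos by (intro divide_right_mono mult_left_mono) auto
  qed
  also have "\<dots> = h * (1 + 2 * lam) / lam * (\<Sum>k<R. wt k)" by (simp add: sum_distrib_left)
  also have "\<dots> \<le> h * (1 + 2 * lam) / lam * 1"
    using wt_sum h_pos lam_pos by (intro mult_left_mono) auto
  finally show ?thesis by simp
qed

text \<open>\<open>tail g 0 = \<theta>\<close> for every degree \<open>g\<close>: the vertices with
  positive clock form a uniform \<theta>-sample although the clocks depend on the degrees.\<close>

lemma retained: "map_pmf (\<lambda>f. {v \<in> V. 0 < f (Inl v)}) \<Omega> = rset V \<theta>"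
proof -
  have clk0: "map_pmf (\<lambda>x. 0 < x) (clk g) = bernoulli_pmf \<theta>" if "g \<le> d" for g
  proof (rule pmf_eqI)
    fix b
    have "pmf (map_pmf (\<lambda>x. 0 < x) (clk g)) True = \<theta>"
      using clk[OF that, of 0] by (simp add: pmf_map vimage_def tail_def a_def)
    moreover from this have "pmf (map_pmf (\<lambda>x. 0 < x) (clk g)) False = 1 - \<theta>"
      by (metis pmf_False_conv_True)
    ultimately show "pmf (map_pmf (\<lambda>x. 0 < x) (clk g)) b = pmf (bernoulli_pmf \<theta>) b"
      using \<theta> by (cases b) auto
  qed
  have "Pi_pmf V False (\<lambda>_. bernoulli_pmf \<theta>) =
      map_pmf (\<lambda>b. b \<circ> Inl) (Pi_pmf (Inl ` V :: ('v + 'v set) set) False (\<lambda>_. bernoulli_pmf \<theta>))"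
    using finV by (intro Pi_pmf_bij_betw) (auto simp: bij_betw_def)
  also have "Pi_pmf (Inl ` V :: ('v + 'v set) set) False (\<lambda>_. bernoulli_pmf \<theta>) =
      Pi_pmf (Inl ` V) False (\<lambda>x. map_pmf (\<lambda>x. 0 < x) (\<mu> x))"
    using deg by (intro Pi_pmf_cong refl) (auto simp: \<mu>_def clk0)
  also have "\<dots> = map_pmf (\<lambda>f. (\<lambda>x. 0 < x) \<circ> f) (Pi_pmf (Inl ` V) 0 \<mu>)"
    using finV by (intro Pi_pmf_map) auto
  also have "Pi_pmf (Inl ` V) 0 \<mu> = map_pmf (\<lambda>f x. if x \<in> Inl ` V then f x else 0) \<Omega>"
    unfolding \<Omega>_def by (rule Pi_pmf_subset[OF fin_nodes]) (auto simp: nodes_def)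
  finally show ?thesis
    by (auto simp: rset_def pmf.map_comp o_def intro!: map_pmf_cong)
qed

text \<open>Clocks are specified only up to time \<open>R\<close>, so \<open>\<Omega>\<close> may
  have infinite support; the counts are integrable because they are bounded.\<close>

lemma finite_\<Omega>: "integrable (measure_pmf \<Omega>) (\<lambda>f. real (card {T \<in> Ts. P f T}))"
  "integrable (measure_pmf \<Omega>) (\<lambda>f. real (card {x \<in> pairs. Q f x}))"
proof -
  have fp: "finite pairs" by (rule finite_subset[of _ "Ts \<times> Ts"]) (use finTs in \<open>auto simp: pairs_def\<close>)
  show "integrable (measure_pmf \<Omega>) (\<lambda>f. real (card {T \<in> Ts. P f T}))"
    by (rule measure_pmf.integrable_const_bound[where B = "real (card Ts)"])
       (use finTs in \<open>auto intro!: card_mono\<close>)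
  show "integrable (measure_pmf \<Omega>) (\<lambda>f. real (card {x \<in> pairs. Q f x}))"
    by (rule measure_pmf.integrable_const_bound[where B = "real (card pairs)"])
       (use fp in \<open>auto intro!: card_mono\<close>)
qed

lemma expect_card_\<Omega>:
  assumes "finite A"
  shows "expect \<Omega> (\<lambda>f. real (card {x \<in> A. P f x})) = (\<Sum>x\<in>A. prb (\<lambda>f. P f x))"
proof -
  have "(\<lambda>f. real (card {x \<in> A. P f x})) = (\<lambda>f. \<Sum>x\<in>A. of_bool (P f x))"
    using assms by (auto simp: fun_eq_iff of_bool_def sum.If_cases Int_def)
  then have "expect \<Omega> (\<lambda>f. real (card {x \<in> A. P f x})) = (\<Sum>x\<in>A. expect \<Omega> (\<lambda>f. of_bool (P f x)))"
    by (simp add: Bochner_Integration.integral_sum measure_pmf.integrable_const_bound[where B = 1])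
  then show ?thesis by (simp only: expect_of_bool)
qed

end

text \<open>One member of every intersecting pair is discarded, selected by an auxiliary order
  \<open>r\<close>. The pairs on the right are ordered, so each conflict is counted twice; hence the
  factors two.\<close>

lemma ex_disjoint_subfamily:
  assumes "finite C"
  shows "\<exists>C'\<subseteq>C. disjoint C' \<and>
    2 * card C \<le> 2 * card C' + card {(S, T). S \<in> C \<and> T \<in> C \<and> S \<noteq> T \<and> S \<inter> T \<noteq> {}}"
proof -
  define P where "P = {(S, T). S \<in> C \<and> T \<in> C \<and> S \<noteq> T \<and> S \<inter> T \<noteq> {}}"
  obtain r :: "'a set \<Rightarrow> nat" where r: "inj_on r C" using finite_imp_inj_to_nat_seg[OF assms] by blast
  define P1 where "P1 = {(S, T) \<in> P. r S < r T}"
  define C' where "C' = C - fst ` P1"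
  have finP: "finite P"
    by (rule finite_subset[of _ "C \<times> C"]) (use assms in \<open>auto simp: P_def\<close>)
  have fin1: "finite P1" by (rule finite_subset[OF _ finP]) (auto simp: P1_def)
  have "card P1 + card (prod.swap ` P1) = card (P1 \<union> prod.swap ` P1)"
    using fin1 by (intro card_Un_disjoint[symmetric]) (auto simp: P1_def)
  also have "\<dots> \<le> card P"
    by (rule card_mono[OF finP]) (auto simp: P1_def P_def)
  also have "card (prod.swap ` P1) = card P1" by (intro card_image) auto
  finally have two: "2 * card P1 \<le> card P" by simp
  have "disjoint C'"
  proof (rule disjointI)
    fix S T assume ST: "S \<in> C'" "T \<in> C'" "S \<noteq> T"
    show "S \<inter> T = {}"
    proof (rule ccontr)
      assume "S \<inter> T \<noteq> {}"
      moreover have "r S \<noteq> r T" using ST r by (auto simp: C'_def inj_on_def)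
      ultimately have "(S, T) \<in> P1 \<or> (T, S) \<in> P1" using ST by (auto simp: P1_def P_def C'_def)
      then have "S \<in> fst ` P1 \<or> T \<in> fst ` P1" by (metis fst_conv image_eqI)
      then show False using ST by (auto simp: C'_def)
    qed
  qed
  moreover have "card C \<le> card C' + card P1"
  proof -
    have "card C \<le> card (C' \<union> fst ` P1)"
      by (rule card_mono) (use assms fin1 in \<open>auto simp: C'_def\<close>)
    also have "\<dots> \<le> card C' + card (fst ` P1)" by (rule card_Un_le)
    also have "card (fst ` P1) \<le> card P1" using fin1 by (rule card_image_le)
    finally show ?thesis by simp
  qed
  ultimately show ?thesis using two unfolding P_def[symmetric] C'_def
    by (intro exI[of _ "C - fst ` P1"]) auto
qed

text \<open>Discarding one candidate per tie leaves a packing inside the retained vertices. The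
  functional \<open>m\<close> stands for the packing number of the retained set, and
  \<open>3 * d\<close> bounds the number of triples meeting a given one.\<close>

theorem (in nibble) packing_lower_bound:
  fixes m :: "'v set \<Rightarrow> real"
  assumes m: "\<And>W C. W \<subseteq> V \<Longrightarrow> C \<subseteq> Ts \<Longrightarrow> disjoint C \<Longrightarrow> \<Union>C \<subseteq> W \<Longrightarrow> real (card C) \<le> m W"
  shows "expect (rset V \<theta>) m \<ge> real (card Ts) *
    (\<theta> ^ 3 / lam * (1 - 1 / sqrt (1 + 2 * lam)) - 3 * real d * (h * (1 + 2 * lam) / lam))"
proof -
  define X where "X = (\<lambda>f :: 'v + 'v set \<Rightarrow> nat. {x \<in> pairs. f (Inr (fst x)) < R \<and> f (Inr (fst x)) = f (Inr (snd x))})"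
  define W where "W = (\<lambda>f :: 'v + 'v set \<Rightarrow> nat. {v \<in> V. 0 < f (Inl v)})"
  have finp: "finite pairs" by (rule finite_subset[of _ "Ts \<times> Ts"]) (use finTs in \<open>auto simp: pairs_def\<close>)
  have pt: "real (card {T \<in> Ts. candidate f T}) - real (card (X f)) \<le> m (W f)" for f
  proof -
    define C where "C = {T \<in> Ts. candidate f T}"
    have "finite C" using finTs by (simp add: C_def)
    from ex_disjoint_subfamily[OF this] obtain C' where C': "C' \<subseteq> C" "disjoint C'"
      "2 * card C \<le> 2 * card C' + card {(S, T). S \<in> C \<and> T \<in> C \<and> S \<noteq> T \<and> S \<inter> T \<noteq> {}}" by blast
    have "card {(S, T). S \<in> C \<and> T \<in> C \<and> S \<noteq> T \<and> S \<inter> T \<noteq> {}} \<le> card (X f)"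
    proof (rule card_mono)
      show "finite (X f)" using finp by (simp add: X_def)
      show "{(S, T). S \<in> C \<and> T \<in> C \<and> S \<noteq> T \<and> S \<inter> T \<noteq> {}} \<subseteq> X f"
      proof clarify
        fix S T assume ST: "S \<in> C" "T \<in> C" "S \<noteq> T" "S \<inter> T \<noteq> {}"
        then obtain v where "v \<in> S" "v \<in> T" by blast
        then have "f (Inr S) = f (Inr T)" using ST by (intro candidate_conflict) (auto simp: C_def)
        then show "(S, T) \<in> X f" using ST by (auto simp: X_def C_def pairs_def candidate_def)
      qed
    qed
    moreover have "real (card C') \<le> m (W f)"
    proof (rule m)
      show "\<Union>C' \<subseteq> W f"
      proof
        fix v assume "v \<in> \<Union>C'"
        then obtain T where T: "T \<in> Ts" "candidate f T" "v \<in> T" using C' by (auto simp: C_def)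
        then have "alive Ts f (f (Inr T)) v T" by (simp add: candidate_def)
        then have "0 < f (Inl v)" by (subst (asm) alive_unfold) auto
        then show "v \<in> W f" using T TsV by (auto simp: W_def)
      qed
    qed (use C' in \<open>auto simp: W_def C_def\<close>)
    ultimately show ?thesis using C' by (simp add: C_def)
  qed
  have "real (card Ts) * (\<theta> ^ 3 / lam * (1 - 1 / sqrt (1 + 2 * lam)) - 3 * real d * (h * (1 + 2 * lam) / lam))
     \<le> expect \<Omega> (\<lambda>f. real (card {T \<in> Ts. candidate f T})) - expect \<Omega> (\<lambda>f. real (card (X f)))"
  proof -
    have "expect \<Omega> (\<lambda>f. real (card {T \<in> Ts. candidate f T})) = real (card Ts) * (\<Sum>k<R. wt k * a k ^ 3)"
      using finTs by (simp add: expect_card_\<Omega> prb_candidate)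
    moreover have "real (card Ts) * (\<theta> ^ 3 / lam * (1 - 1 / sqrt (1 + 2 * lam))) \<le>
        real (card Ts) * (\<Sum>k<R. wt k * a k ^ 3)"
      by (intro mult_left_mono wt_a3) auto
    moreover have "expect \<Omega> (\<lambda>f. real (card (X f))) \<le> (\<Sum>x\<in>pairs. h * (1 + 2 * lam) / lam)"
      unfolding X_def expect_card_\<Omega>[OF finp]
      by (intro sum_mono) (auto simp: pairs_def intro!: prb_same_label)
    moreover have "(\<Sum>x\<in>pairs. h * (1 + 2 * lam) / lam) \<le> real (card Ts * (3 * d)) * (h * (1 + 2 * lam) / lam)"
      unfolding sum_constant using h_pos lam_pos
      by (intro mult_right_mono of_nat_mono[OF card_pairs]) auto
    ultimately show ?thesis by (simp add: algebra_simps)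
  qed
  also have "\<dots> = expect \<Omega> (\<lambda>f. real (card {T \<in> Ts. candidate f T}) - real (card (X f)))"
    unfolding X_def by (intro Bochner_Integration.integral_diff[symmetric] finite_\<Omega>)
  also have "\<dots> \<le> expect \<Omega> (\<lambda>f. m (W f))"
  proof (rule integral_mono_AE)
    have "integrable (measure_pmf (map_pmf W \<Omega>)) m"
      unfolding W_def retained using finV by simp
    then show "integrable (measure_pmf \<Omega>) (\<lambda>f. m (W f))" by (simp add: map_pmf_rep_eq integrable_distr_eq)
    show "integrable (measure_pmf \<Omega>) (\<lambda>f. real (card {T \<in> Ts. candidate f T}) - real (card (X f)))"
      unfolding X_def by (intro Bochner_Integration.integrable_diff finite_\<Omega>)
  qed (use pt in auto)
  also have "\<dots> = expect (map_pmf W \<Omega>) m" by simp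
  also have "map_pmf W \<Omega> = rset V \<theta>" unfolding W_def by (rule retained)
  finally show ?thesis .
qed

subsection \<open>Packings and covers\<close>

lemma all_edges_mono: "s \<subseteq> t \<Longrightarrow> all_edges s \<subseteq> all_edges t"
  by (auto simp: all_edges_def)

lemma all_edges_Int: "all_edges s \<inter> all_edges t = all_edges (s \<inter> t)"
  by (auto simp: all_edges_def)

lemma finite_all_edges [simp]: "finite X \<Longrightarrow> finite (all_edges X)"
  by (rule finite_subset[of _ "Pow X"]) (auto simp: all_edges_def)

lemma card_all_edges: "finite X \<Longrightarrow> card (all_edges X) = card X choose 2"
  unfolding all_edges_def by (rule n_subsets)

lemma doubleton_in_all_edges [simp]: "{a, b} \<in> all_edges X \<longleftrightarrow> a \<in> X \<and> b \<in> X \<and> a \<noteq> b"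
  by (auto simp: all_edges_def card_insert_if)

lemma all_edges_triple:
  assumes "a \<noteq> b" "b \<noteq> c" "a \<noteq> c"
  shows "all_edges {a, b, c} = {{a, b}, {b, c}, {a, c}}"
proof
  show "all_edges {a, b, c} \<subseteq> {{a, b}, {b, c}, {a, c}}"
  proof
    fix e assume "e \<in> all_edges {a, b, c}"
    then obtain x y where "e = {x, y}" "x \<noteq> y" "x \<in> {a, b, c}" "y \<in> {a, b, c}"
      by (auto simp: all_edges_def card_2_iff)
    then show "e \<in> {{a, b}, {b, c}, {a, c}}" by auto
  qed
qed (use assms in auto)

text \<open>Triangles through their three-element vertex sets, the form in which they are counted
  later.\<close>

lemma triangles_altdef: "triangles E = all_edges ` {t. card t = 3 \<and> all_edges t \<subseteq> E}"
proof (intro equalityI subsetI)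
  fix T assume "T \<in> triangles E"
  then obtain a b c where *: "T = {{a, b}, {b, c}, {a, c}}" "a \<noteq> b" "b \<noteq> c" "a \<noteq> c"
    "{a, b} \<in> E" "{b, c} \<in> E" "{a, c} \<in> E" by (auto simp: triangles_def)
  then have "T = all_edges {a, b, c}" "card {a, b, c} = 3" by (auto simp: all_edges_triple)
  moreover have "all_edges {a, b, c} \<subseteq> E" using * by (simp add: all_edges_triple)
  ultimately show "T \<in> all_edges ` {t. card t = 3 \<and> all_edges t \<subseteq> E}" by blast
next
  fix T assume "T \<in> all_edges ` {t. card t = 3 \<and> all_edges t \<subseteq> E}"
  then obtain t where t: "T = all_edges t" "card t = 3" "T \<subseteq> E" by blast
  then obtain a b c where abc: "t = {a, b, c}" "a \<noteq> b" "b \<noteq> c" "a \<noteq> c" unfolding card_3_iff by blast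
  then have "T = {{a, b}, {b, c}, {a, c}}" using t by (simp add: all_edges_triple)
  moreover from this have "{a, b} \<in> E" "{b, c} \<in> E" "{a, c} \<in> E" using t(3) by auto
  ultimately show "T \<in> triangles E" unfolding triangles_def using abc(2-4) by blast
qed

lemma Union_all_edges: "card t = 3 \<Longrightarrow> \<Union>(all_edges t) = t"
  by (auto simp: card_3_iff all_edges_triple)

lemma inj_on_all_edges: "inj_on all_edges {t. card t = 3}"
  by (rule inj_on_inverseI[of _ Union]) (auto simp: Union_all_edges)

lemma card_triangle: "card t = 3 \<Longrightarrow> card (all_edges t) = 3"
  by (subst card_all_edges) (auto simp: card_ge_0_finite numeral_3_eq_3 choose_two)

lemma triangle_subset: "T \<in> triangles E \<Longrightarrow> T \<subseteq> E" by (auto simp: triangles_altdef)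

lemma triangle_nonempty:
  assumes "T \<in> triangles E"
  shows "T \<noteq> {}"
proof -
  obtain t where "T = all_edges t" "card t = 3" using assms unfolding triangles_altdef by blast
  then have "card T = 3" by (simp add: card_triangle)
  then show ?thesis by auto
qed

lemma finite_triangles: "finite E \<Longrightarrow> finite (triangles E)"
  by (rule finite_subset[of _ "Pow E"]) (use triangle_subset in blast, simp)

lemma triangles_mono: "E \<subseteq> E' \<Longrightarrow> triangles E \<subseteq> triangles E'"
  by (auto simp: triangles_altdef)

lemma triangle_of_subset: "T \<in> triangles E \<Longrightarrow> T \<subseteq> E' \<Longrightarrow> T \<in> triangles E'"
  by (auto simp: triangles_altdef)

context
  fixes E :: "'a set set"
  assumes fin: "finite E"
begin

lemma finite_packings: "finite {card T | T. triangle_packing E T}"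
proof -
  have "{card T | T. triangle_packing E T} \<subseteq> card ` Pow (triangles E)"
    by (auto simp: triangle_packing_def)
  then show ?thesis using finite_triangles[OF fin] finite_subset by blast
qed

lemma nu_ge: "triangle_packing E T \<Longrightarrow> card T \<le> nu E"
  unfolding nu_def using finite_packings by (intro Max_ge) auto

lemma nu_attained: "\<exists>T. triangle_packing E T \<and> card T = nu E"
proof -
  have "triangle_packing E {}" by (auto simp: triangle_packing_def)
  then have "nu E \<in> {card T | T. triangle_packing E T}"
    unfolding nu_def using finite_packings by (intro Max_in) auto
  then show ?thesis by auto
qed

lemma finite_covers: "finite {card F | F. triangle_cover E F}"
proof -
  have "{card F | F. triangle_cover E F} \<subseteq> card ` Pow E" by (auto simp: triangle_cover_def)
  then show ?thesis using fin finite_subset by blast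
qed

lemma tau_le: "triangle_cover E F \<Longrightarrow> tau E \<le> card F"
  unfolding tau_def using finite_covers by (intro Min_le) auto

lemma tau_attained: "\<exists>F. triangle_cover E F \<and> card F = tau E"
proof -
  have "triangle_cover E E"
    unfolding triangle_cover_def
  proof (intro conjI ballI subset_refl)
    fix t assume t: "t \<in> triangles E"
    then show "t \<inter> E \<noteq> {}" using triangle_subset[OF t] triangle_nonempty[OF t] by (simp add: Int_absorb2)
  qed
  then have "tau E \<in> {card F | F. triangle_cover E F}"
    unfolding tau_def using finite_covers by (intro Min_in) auto
  then show ?thesis by auto
qed

end

lemma nu_superadditive:
  assumes "finite A" "finite B" "A \<inter> B = {}"
  shows "nu A + nu B \<le> nu (A \<union> B)"
proof -
  obtain S T where S: "triangle_packing A S" "card S = nu A" and T: "triangle_packing B T" "card T = nu B"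
    using nu_attained assms by metis
  have cross: "x \<inter> y = {}" "x \<noteq> y" if "x \<in> S" "y \<in> T" for x y
  proof -
    have xy: "x \<in> triangles A" "y \<in> triangles B"
      using that S(1) T(1) by (auto simp: triangle_packing_def)
    then show "x \<inter> y = {}" using triangle_subset assms(3) by blast
    then show "x \<noteq> y" using xy(1) triangle_nonempty by auto
  qed
  have "triangle_packing (A \<union> B) (S \<union> T)"
    unfolding triangle_packing_def
  proof
    show "S \<union> T \<subseteq> triangles (A \<union> B)"
      using S(1) T(1) triangles_mono[of A "A \<union> B"] triangles_mono[of B "A \<union> B"]
      by (auto simp: triangle_packing_def)
    show "disjoint (S \<union> T)"
    proof (rule disjointI)
      fix x y assume "x \<in> S \<union> T" "y \<in> S \<union> T" "x \<noteq> y"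
      then consider "x \<in> S" "y \<in> S" | "x \<in> T" "y \<in> T" | "x \<in> S" "y \<in> T" | "x \<in> T" "y \<in> S" by blast
      then show "x \<inter> y = {}"
        using S(1) T(1) cross \<open>x \<noteq> y\<close>
        by cases (auto simp: triangle_packing_def disjoint_def)
    qed
  qed
  then have "card (S \<union> T) \<le> nu (A \<union> B)" using assms by (intro nu_ge) auto
  moreover have "card (S \<union> T) = card S + card T"
  proof (rule card_Un_disjoint)
    show "finite S" "finite T"
      using S(1) T(1) finite_triangles assms(1,2) by (auto simp: triangle_packing_def intro: finite_subset)
    show "S \<inter> T = {}" using cross(2) by blast
  qed
  ultimately show ?thesis using S T by simp
qed

lemma nu_mono: "finite B \<Longrightarrow> A \<subseteq> B \<Longrightarrow> nu A \<le> nu B"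
  using nu_superadditive[of A "B - A"] finite_subset[of A B] by (auto simp: Un_absorb1)

text \<open>At most one triangle of a packing contains \<open>e\<close>; discarding it leaves a
  packing of \<open>E\<close>.\<close>

lemma nu_insert_le:
  assumes "finite E"
  shows "nu (insert e E) \<le> nu E + 1"
proof -
  obtain T where T: "triangle_packing (insert e E) T" "card T = nu (insert e E)"
    using nu_attained[of "insert e E"] assms by auto
  have finT: "finite T"
    using T(1) finite_triangles[of "insert e E"] assms by (auto simp: triangle_packing_def intro: finite_subset)
  define T' where "T' = {x \<in> T. e \<notin> x}"
  have "triangle_packing E T'"
    unfolding triangle_packing_def
  proof
    show "T' \<subseteq> triangles E"
    proof
      fix x assume x: "x \<in> T'"
      then have "x \<in> triangles (insert e E)" using T(1) by (auto simp: triangle_packing_def T'_def)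
      moreover from triangle_subset[OF this] have "x \<subseteq> E" using x by (auto simp: T'_def)
      ultimately show "x \<in> triangles E" by (rule triangle_of_subset)
    qed
    show "disjoint T'" using T(1) by (auto simp: triangle_packing_def T'_def disjoint_def)
  qed
  then have 1: "card T' \<le> nu E" using assms by (intro nu_ge)
  have "card (T - T') \<le> 1"
  proof (subst card_le_Suc0_iff_eq[simplified One_nat_def[symmetric]])
    show "\<forall>x\<in>T - T'. \<forall>y\<in>T - T'. x = y"
      using T(1) by (auto simp: T'_def triangle_packing_def disjoint_def)
  qed (use finT in auto)
  moreover have "card T = card T' + card (T - T')"
    using finT by (metis (no_types, lifting) T'_def card_Diff_subset card_mono finite_subset le_add_diff_inverse mem_Collect_eq subsetI)
  ultimately show ?thesis using 1 T(2) by linarith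
qed

lemma tau_mono:
  assumes "finite B" "A \<subseteq> B"
  shows "tau A \<le> tau B"
proof -
  obtain F where F: "triangle_cover B F" "card F = tau B" using tau_attained assms by metis
  have finF: "finite F" using F(1) assms(1) by (auto simp: triangle_cover_def intro: finite_subset)
  have "triangle_cover A (F \<inter> A)"
    unfolding triangle_cover_def
  proof (intro conjI ballI)
    fix t assume t: "t \<in> triangles A"
    then have "t \<inter> F \<noteq> {}" using F(1) triangles_mono[OF assms(2)] by (auto simp: triangle_cover_def)
    then show "t \<inter> (F \<inter> A) \<noteq> {}" using triangle_subset[OF t] by auto
  qed auto
  then have "tau A \<le> card (F \<inter> A)" using assms finite_subset by (intro tau_le) auto
  also have "\<dots> \<le> card F" using finF by (intro card_mono) auto
  finally show ?thesis using F by simp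
qed

lemma tau_insert_le:
  assumes "finite E"
  shows "tau (insert e E) \<le> tau E + 1"
proof -
  obtain F where F: "triangle_cover E F" "card F = tau E" using tau_attained[OF assms] by auto
  have "triangle_cover (insert e E) (insert e F)"
    unfolding triangle_cover_def
  proof (intro conjI ballI)
    fix t assume t: "t \<in> triangles (insert e E)"
    show "t \<inter> insert e F \<noteq> {}"
    proof (cases "e \<in> t")
      case False
      then have "t \<subseteq> E" using triangle_subset[OF t] by auto
      then have "t \<in> triangles E" using t triangle_of_subset by blast
      then show ?thesis using F(1) by (auto simp: triangle_cover_def)
    qed auto
  qed (use F in \<open>auto simp: triangle_cover_def\<close>)
  then have "tau (insert e E) \<le> card (insert e F)" using assms by (intro tau_le) auto
  also have "\<dots> \<le> card F + 1" by (simp add: card_insert_le_m1 card_insert_if[of F] finite_subset)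
  finally show ?thesis using F by simp
qed

lemma triangles_insert_eq:
  assumes "\<And>t. t \<in> triangles (insert e E) \<Longrightarrow> e \<notin> t"
  shows "triangles (insert e E) = triangles E"
proof
  show "triangles (insert e E) \<subseteq> triangles E"
  proof
    fix t assume t: "t \<in> triangles (insert e E)"
    then have "t \<subseteq> E" using triangle_subset[OF t] assms by auto
    then show "t \<in> triangles E" using t triangle_of_subset by blast
  qed
qed (intro triangles_mono, auto)

lemma nu_tau_insert_eq:
  assumes "finite E" "\<And>t. t \<in> triangles (insert e E) \<Longrightarrow> e \<notin> t"
  shows "nu (insert e E) = nu E" "tau (insert e E) = tau E"
proof -
  have eq: "triangles (insert e E) = triangles E" by (rule triangles_insert_eq) (rule assms(2))
  show "nu (insert e E) = nu E" unfolding nu_def triangle_packing_def eq ..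
  obtain F where F: "triangle_cover E F" "card F = tau E" using tau_attained[OF assms(1)] by auto
  then have "triangle_cover (insert e E) F" by (auto simp: triangle_cover_def eq)
  then have "tau (insert e E) \<le> tau E" using F assms(1) tau_le[of "insert e E" F] by simp
  then show "tau (insert e E) = tau E" using tau_mono[of "insert e E" E] assms(1) by (simp add: subset_insertI)
qed

definition surplus :: "'a set set \<Rightarrow> real" where
  "surplus E = 2 * real (nu E) - real (tau E)"

text \<open>The common neighbours of the ends of \<open>e\<close>. The edge \<open>e\<close> itself
  is left out of the required edges, so in a random graph the number of apexes is independent of the
  presence of \<open>e\<close>.\<close>

definition apexes :: "'a set \<Rightarrow> 'a set set \<Rightarrow> 'a set \<Rightarrow> 'a set" where
  "apexes X E e = {w \<in> X - e. all_edges (insert w e) - {e} \<subseteq> E}"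

lemma edge_triangle:
  assumes "e \<in> all_edges X" "w \<in> X - e"
  shows "card (insert w e) = 3" "e \<in> all_edges (insert w e)" "card (all_edges (insert w e) - {e}) = 2"
    "insert w e \<subseteq> X" "all_edges (insert w e) \<subseteq> all_edges X"
proof -
  have e: "e \<subseteq> X" "card e = 2" using assms by (auto simp: all_edges_def)
  then have "finite e" by (simp add: card_ge_0_finite)
  then show 1: "card (insert w e) = 3" using e assms by simp
  show 2: "e \<in> all_edges (insert w e)" using e by (auto simp: all_edges_def)
  show "card (all_edges (insert w e) - {e}) = 2" using card_triangle[OF 1] 2 by simp
  show "insert w e \<subseteq> X" "all_edges (insert w e) \<subseteq> all_edges X"
    using e assms by (auto simp: all_edges_def)
qed

lemma triangle_apex:
  assumes "card t = 3" "e \<in> all_edges t" "all_edges t \<subseteq> E" "t \<subseteq> X"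
  shows "\<exists>w\<in>apexes X E e. t = insert w e"
proof -
  have e: "e \<subseteq> t" "card e = 2" using assms by (auto simp: all_edges_def)
  have "finite e" "finite t" using e assms by (auto simp: card_ge_0_finite)
  then have "card (t - e) = 1" using e assms by (simp add: card_Diff_subset)
  then obtain w where "t - e = {w}" by (auto simp: card_1_singleton_iff)
  then have "t = insert w e" "w \<notin> e" "w \<in> t" using e by auto
  then show ?thesis using assms by (auto simp: apexes_def)
qed

text \<open>Adding \<open>e\<close> raises \<open>nu\<close> and \<open>tau\<close> by zero or one
  each, so the surplus moves by at most two. Without an apex no triangle contains \<open>e\<close>,
  and neither number changes.\<close>

lemma surplus_diff_le:
  assumes "finite X" "A \<subseteq> all_edges X" "e \<in> all_edges X"
  shows "(surplus (insert e A) - surplus (A - {e}))\<^sup>2 \<le> 4 * of_bool (apexes X A e \<noteq> {})"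
proof -
  define A' where "A' = A - {e}"
  have fin: "finite A'" using assms by (auto simp: A'_def intro: finite_subset)
  have ins: "insert e A = insert e A'" by (auto simp: A'_def)
  show ?thesis
  proof (cases "apexes X A e = {}")
    case True
    have "e \<notin> t" if t: "t \<in> triangles (insert e A')" for t
    proof
      assume "e \<in> t"
      obtain s where s: "t = all_edges s" "card s = 3" "all_edges s \<subseteq> insert e A"
        using t ins by (auto simp: triangles_altdef)
      have "s \<subseteq> X"
      proof -
        have "all_edges s \<subseteq> all_edges X" using s assms by auto
        then have "\<Union>(all_edges s) \<subseteq> X" by (auto simp: all_edges_def)
        then show ?thesis using s Union_all_edges by metis
      qed
      then obtain w where "w \<in> apexes X (insert e A) e"
        using triangle_apex[of s e "insert e A" X] s \<open>e \<in> t\<close> by auto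
      then have "w \<in> apexes X A e" by (auto simp: apexes_def)
      then show False using True by simp
    qed
    then show ?thesis
      using nu_tau_insert_eq[OF fin, of e] by (simp add: surplus_def ins A'_def[symmetric])
  next
    case False
    define x where "x = surplus (insert e A) - surplus (A - {e})"
    have "nu A' \<le> nu (insert e A')" "tau A' \<le> tau (insert e A')"
      using fin by (auto intro: nu_mono tau_mono)
    then have "\<bar>x\<bar> \<le> 2"
      using nu_insert_le[OF fin, of e] tau_insert_le[OF fin, of e]
      unfolding x_def surplus_def ins A'_def[symmetric] by linarith
    then have "x\<^sup>2 \<le> 2\<^sup>2" by (metis abs_le_square_iff abs_numeral)
    then show ?thesis using False by (simp add: x_def)
  qed
qed

subsection \<open>Expected numbers of triangles\<close>

definition ksets :: "nat \<Rightarrow> 'a set \<Rightarrow> 'a set set" where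
  "ksets k X = {t. t \<subseteq> X \<and> card t = k}"

lemma finite_ksets [simp]: "finite X \<Longrightarrow> finite (ksets k X)"
  by (rule finite_subset[of _ "Pow X"]) (auto simp: ksets_def)

lemma card_ksets: "finite X \<Longrightarrow> card (ksets k X) = card X choose k"
  unfolding ksets_def by (rule n_subsets)

lemma rset_all_edges:
  assumes "finite X" "G \<in> set_pmf (rset (all_edges X) p)"
  shows "G \<subseteq> all_edges X" "finite G"
proof -
  show 1: "G \<subseteq> all_edges X" using assms by (intro rset_subset) auto
  show "finite G" by (rule finite_subset[OF 1]) (use assms in simp)
qed

lemma subset_of_all_edges:
  assumes "card t = 3" "all_edges t \<subseteq> all_edges X"
  shows "t \<subseteq> X"
proof -
  have "\<Union>(all_edges t) \<subseteq> X" using assms(2) by (auto simp: all_edges_def)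
  then show ?thesis using assms Union_all_edges by metis
qed

lemma triangles_eq_ksets:
  assumes "G \<subseteq> all_edges X"
  shows "triangles G = all_edges ` {t \<in> ksets 3 X. all_edges t \<subseteq> G}"
  unfolding triangles_altdef ksets_def using assms subset_of_all_edges by blast

lemma card_triangles:
  assumes "finite X" "G \<subseteq> all_edges X"
  shows "real (card (triangles G)) = (\<Sum>t\<in>ksets 3 X. of_bool (all_edges t \<subseteq> G))"
proof -
  have "card (triangles G) = card {t \<in> ksets 3 X. all_edges t \<subseteq> G}"
    unfolding triangles_eq_ksets[OF assms(2)]
    by (intro card_image inj_on_subset[OF inj_on_all_edges]) (auto simp: ksets_def)
  then show ?thesis using assms by (simp add: of_bool_def sum.If_cases Int_def)
qed

lemma expect_triangles:
  assumes "finite X" "0 \<le> p" "p \<le> 1"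
  shows "expect (rset (all_edges X) p) (\<lambda>G. real (card (triangles G))) = real (card X choose 3) * p ^ 3"
proof -
  have "expect (rset (all_edges X) p) (\<lambda>G. real (card (triangles G))) =
     expect (rset (all_edges X) p) (\<lambda>G. \<Sum>t\<in>ksets 3 X. of_bool (all_edges t \<subseteq> G))"
    using assms by (intro expect_cong card_triangles) (auto dest: rset_all_edges)
  also have "\<dots> = (\<Sum>t\<in>ksets 3 X. expect (rset (all_edges X) p) (\<lambda>G. of_bool (all_edges t \<subseteq> G)))"
    using assms by (intro expect_rset_sum) auto
  also have "\<dots> = (\<Sum>t\<in>ksets 3 X. p ^ card (all_edges t))"
    using assms by (intro sum.cong expect_rset_supset) (auto simp: ksets_def all_edges_mono)
  also have "\<dots> = (\<Sum>t\<in>ksets 3 X. p ^ 3)"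
    by (intro sum.cong) (auto simp: ksets_def card_triangle)
  finally show ?thesis using assms by (simp add: card_ksets)
qed

definition tpairs :: "'a set set \<Rightarrow> ('a set set \<times> 'a set set) set" where
  "tpairs G = {(S, T). S \<in> triangles G \<and> T \<in> triangles G \<and> S \<noteq> T \<and> S \<inter> T \<noteq> {}}"

text \<open>With \<open>t\<close> triangles and \<open>c\<close> ordered pairs in conflict, dropping
  one triangle per conflict gives \<open>nu G \<ge> t - c / 2\<close>, and one edge from each
  triangle gives \<open>tau G \<le> t\<close>.\<close>

lemma surplus_ge:
  assumes "finite G"
  shows "real (card (triangles G)) - real (card (tpairs G)) \<le> surplus G"
proof -
  obtain C where C: "C \<subseteq> triangles G" "disjoint C" "2 * card (triangles G) \<le> 2 * card C + card (tpairs G)"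
    using ex_disjoint_subfamily[OF finite_triangles[OF assms]] unfolding tpairs_def by blast
  have nu: "card C \<le> nu G" using C assms by (intro nu_ge) (auto simp: triangle_packing_def)
  define F where "F = (\<lambda>t. SOME e. e \<in> t) ` triangles G"
  have some: "(SOME e. e \<in> t) \<in> t" if "t \<in> triangles G" for t
    using triangle_nonempty[OF that] by (simp add: some_in_eq)
  have "triangle_cover G F"
    unfolding triangle_cover_def F_def using some triangle_subset by blast
  then have "tau G \<le> card F" using assms by (intro tau_le)
  also have "\<dots> \<le> card (triangles G)" unfolding F_def using finite_triangles[OF assms] by (rule card_image_le)
  finally show ?thesis using nu C(3) unfolding surplus_def by linarith
qed

text \<open>Two triangles that share an edge have five edges together, and the second arises from
  the first by exchanging one of three vertices for one of at most \<open>card X\<close>.\<close>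

lemma expect_tpairs:
  assumes X: "finite X" and p: "0 \<le> p" "p \<le> 1"
  shows "expect (rset (all_edges X) p) (\<lambda>G. real (card (tpairs G))) \<le>
    real (card X choose 3) * (3 * real (card X)) * p ^ 5"
proof -
  define K where "K = (SIGMA s:ksets 3 X. {t \<in> ksets 3 X. card (s \<inter> t) = 2})"
  have finK: "finite K" using X by (auto simp: K_def)
  have "card K = (\<Sum>s\<in>ksets 3 X. card {t \<in> ksets 3 X. card (s \<inter> t) = 2})"
    unfolding K_def using X by (intro card_SigmaI) auto
  also have "\<dots> \<le> (\<Sum>s\<in>ksets 3 X. 3 * card X)"
  proof (intro sum_mono)
    fix s assume s: "s \<in> ksets 3 X"
    have fs: "finite s" using s X by (auto simp: ksets_def intro: finite_subset)
    have "{t \<in> ksets 3 X. card (s \<inter> t) = 2} \<subseteq> (\<lambda>(x, y). insert y (s - {x})) ` (s \<times> X)"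
    proof
      fix t assume t: "t \<in> {t \<in> ksets 3 X. card (s \<inter> t) = 2}"
      have ft: "finite t" using t X by (auto simp: ksets_def intro: finite_subset)
      have "card (s - s \<inter> t) = 1" "card (t - s \<inter> t) = 1"
        using s t fs ft by (auto simp: card_Diff_subset ksets_def)
      then obtain x y where xy: "s - s \<inter> t = {x}" "t - s \<inter> t = {y}"
        by (auto simp: card_1_singleton_iff)
      then have "t = insert y (s - {x})" "x \<in> s" "y \<in> X" using t by (auto simp: ksets_def)
      then show "t \<in> (\<lambda>(x, y). insert y (s - {x})) ` (s \<times> X)" by auto
    qed
    then have "card {t \<in> ksets 3 X. card (s \<inter> t) = 2} \<le> card (s \<times> X)"
      using fs X by (meson card_image_le card_mono finite_SigmaI finite_imageI order_trans)
    then show "card {t \<in> ksets 3 X. card (s \<inter> t) = 2} \<le> 3 * card X"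
      using s by (simp add: card_cartesian_product ksets_def)
  qed
  finally have cK: "card K \<le> (card X choose 3) * (3 * card X)" using X by (simp add: card_ksets)
  have bound: "real (card (tpairs G)) \<le> (\<Sum>x\<in>K. of_bool (all_edges (fst x) \<union> all_edges (snd x) \<subseteq> G))"
    if G: "G \<subseteq> all_edges X" for G
  proof -
    have "tpairs G \<subseteq> (\<lambda>(s, t). (all_edges s, all_edges t)) ` {x \<in> K. all_edges (fst x) \<union> all_edges (snd x) \<subseteq> G}"
    proof
      fix z assume "z \<in> tpairs G"
      then obtain s t where z: "z = (all_edges s, all_edges t)" "s \<in> ksets 3 X" "t \<in> ksets 3 X"
        "all_edges s \<subseteq> G" "all_edges t \<subseteq> G" "all_edges s \<noteq> all_edges t" "all_edges s \<inter> all_edges t \<noteq> {}"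
        by (auto simp: tpairs_def triangles_eq_ksets[OF G])
      have fs: "finite s" "finite t" using z X by (auto simp: ksets_def intro: finite_subset)
      have "card (s \<inter> t) = 2"
      proof -
        obtain e where "e \<subseteq> s \<inter> t" "card e = 2" using z(7) by (auto simp: all_edges_Int all_edges_def)
        then have "2 \<le> card (s \<inter> t)" using fs by (metis card_mono finite_Int)
        moreover have "card (s \<inter> t) \<noteq> 3"
        proof
          assume "card (s \<inter> t) = 3"
          then have "s \<inter> t = s" "s \<inter> t = t"
            using z fs card_subset_eq[of s "s \<inter> t"] card_subset_eq[of t "s \<inter> t"] by (auto simp: ksets_def)
          then show False using z by auto
        qed
        moreover have "card (s \<inter> t) \<le> 3"
          using z card_mono[OF fs(1), of "s \<inter> t"] by (auto simp: ksets_def)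
        ultimately show ?thesis by linarith
      qed
      then have "(s, t) \<in> {x \<in> K. all_edges (fst x) \<union> all_edges (snd x) \<subseteq> G}"
        using z by (auto simp: K_def)
      then show "z \<in> (\<lambda>(s, t). (all_edges s, all_edges t)) ` {x \<in> K. all_edges (fst x) \<union> all_edges (snd x) \<subseteq> G}"
        using z(1) by (intro image_eqI[of _ _ "(s, t)"]) auto
    qed
    then have "card (tpairs G) \<le> card {x \<in> K. all_edges (fst x) \<union> all_edges (snd x) \<subseteq> G}"
      using finK by (intro surj_card_le) auto
    also have "real \<dots> = (\<Sum>x\<in>K. of_bool (all_edges (fst x) \<union> all_edges (snd x) \<subseteq> G))"
      using finK by (simp add: of_bool_def sum.If_cases Int_def)
    finally show ?thesis by simp
  qed
  have "expect (rset (all_edges X) p) (\<lambda>G. real (card (tpairs G))) \<le>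
     expect (rset (all_edges X) p) (\<lambda>G. \<Sum>x\<in>K. of_bool (all_edges (fst x) \<union> all_edges (snd x) \<subseteq> G))"
    using X by (intro expect_mono bound) (auto dest: rset_all_edges)
  also have "\<dots> = (\<Sum>x\<in>K. expect (rset (all_edges X) p) (\<lambda>G. of_bool (all_edges (fst x) \<union> all_edges (snd x) \<subseteq> G)))"
    using X by (intro expect_rset_sum) auto
  also have "\<dots> = (\<Sum>x\<in>K. p ^ 5)"
  proof (intro sum.cong refl)
    fix x assume x: "x \<in> K"
    then obtain s t where st: "x = (s, t)" "s \<subseteq> X" "t \<subseteq> X" "card s = 3" "card t = 3" "card (s \<inter> t) = 2"
      by (auto simp: K_def ksets_def)
    have "card (all_edges s \<inter> all_edges t) = 1"
      unfolding all_edges_Int using st by (subst card_all_edges) (auto simp: card_ge_0_finite)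
    moreover have "finite s" "finite t" using st by (auto simp: card_ge_0_finite)
    ultimately have "card (all_edges s \<union> all_edges t) = 5"
      using card_Un_Int[of "all_edges s" "all_edges t"] st by (simp add: card_triangle)
    moreover have "expect (rset (all_edges X) p) (\<lambda>G. of_bool (all_edges s \<union> all_edges t \<subseteq> G)) =
        p ^ card (all_edges s \<union> all_edges t)"
      using st(2,3)[THEN all_edges_mono] X p by (intro expect_rset_supset) auto
    ultimately show "expect (rset (all_edges X) p) (\<lambda>G. of_bool (all_edges (fst x) \<union> all_edges (snd x) \<subseteq> G)) = p ^ 5"
      by (simp only: st(1) fst_conv snd_conv)
  qed
  also have "\<dots> = real (card K) * p ^ 5" by simp
  also have "\<dots> \<le> real ((card X choose 3) * (3 * card X)) * p ^ 5"
    using cK p by (intro mult_right_mono of_nat_mono) auto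
  finally show ?thesis by simp
qed

text \<open>The first bound charges 4 to every edge. The second also uses that an edge has an apex
  with probability at most the expected number of apexes, which is at most
  \<open>card X * p\<^sup>2\<close>.\<close>

lemma surplus_influence:
  assumes X: "finite X" and p: "0 \<le> p" "p \<le> 1"
  shows "influence (all_edges X) p surplus \<le> 4 * p * real (card X choose 2)"
    and "influence (all_edges X) p surplus \<le> 4 * p * real (card X choose 2) * (real (card X) * p\<^sup>2)"
proof -
  define E where "E = (\<lambda>e. expect (rset (all_edges X) p) (\<lambda>A. (surplus (insert e A) - surplus (A - {e}))\<^sup>2))"
  have inf: "influence (all_edges X) p surplus = p * (\<Sum>e\<in>all_edges X. E e)"
    by (simp add: influence_def E_def)
  have 1: "E e \<le> 4 * expect (rset (all_edges X) p) (\<lambda>A. of_bool (apexes X A e \<noteq> {}))" if "e \<in> all_edges X" for e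
  proof -
    have "E e \<le> expect (rset (all_edges X) p) (\<lambda>A. 4 * of_bool (apexes X A e \<noteq> {}))"
      unfolding E_def using X that by (intro expect_mono surplus_diff_le) (auto dest: rset_all_edges)
    then show ?thesis by simp
  qed
  have 2: "E e \<le> 4" if "e \<in> all_edges X" for e
  proof -
    have "expect (rset (all_edges X) p) (\<lambda>A. of_bool (apexes X A e \<noteq> {})) \<le> expect (rset (all_edges X) p) (\<lambda>A. 1)"
      using X by (intro expect_mono) auto
    then show ?thesis using 1[OF that] by simp
  qed
  have 3: "E e \<le> 4 * (real (card X) * p\<^sup>2)" if e: "e \<in> all_edges X" for e
  proof -
    have "expect (rset (all_edges X) p) (\<lambda>A. of_bool (apexes X A e \<noteq> {})) \<le>
      expect (rset (all_edges X) p) (\<lambda>A. \<Sum>w\<in>X - e. of_bool (all_edges (insert w e) - {e} \<subseteq> A))"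
    proof (intro expect_mono)
      fix A
      show "of_bool (apexes X A e \<noteq> {}) \<le> (\<Sum>w\<in>X - e. of_bool (all_edges (insert w e) - {e} \<subseteq> A) :: real)"
      proof (cases "apexes X A e = {}")
        case True
        then show ?thesis by (simp add: sum_nonneg)
      next
        case False
        then obtain w where w: "w \<in> X - e" "all_edges (insert w e) - {e} \<subseteq> A" by (auto simp: apexes_def)
        have "of_bool (all_edges (insert w e) - {e} \<subseteq> A) \<le>
            (\<Sum>w\<in>X - e. of_bool (all_edges (insert w e) - {e} \<subseteq> A) :: real)"
          using X w by (intro member_le_sum[of w "X - e" "\<lambda>w. of_bool (all_edges (insert w e) - {e} \<subseteq> A)"]) auto
        then show ?thesis using w False by (simp del: sum_of_bool_eq)
      qed
    qed (use X in auto)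
    also have "\<dots> = (\<Sum>w\<in>X - e. expect (rset (all_edges X) p) (\<lambda>A. of_bool (all_edges (insert w e) - {e} \<subseteq> A)))"
      using X by (intro expect_rset_sum) auto
    also have "\<dots> = (\<Sum>w\<in>X - e. p ^ card (all_edges (insert w e) - {e}))"
    proof (intro sum.cong refl expect_rset_supset)
      fix w assume "w \<in> X - e"
      then show "all_edges (insert w e) - {e} \<subseteq> all_edges X" using edge_triangle(5)[OF e] by blast
    qed (use X p in auto)
    also have "\<dots> = (\<Sum>w\<in>X - e. p\<^sup>2)" using edge_triangle[OF e] by (intro sum.cong) auto
    also have "\<dots> \<le> real (card X) * p\<^sup>2"
      using X by (simp add: mult_right_mono card_mono)
    finally show ?thesis using 1[OF e] by simp
  qed
  have "(\<Sum>e\<in>all_edges X. E e) \<le> (\<Sum>e\<in>all_edges X. 4)" by (intro sum_mono 2)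
  then have "p * (\<Sum>e\<in>all_edges X. E e) \<le> p * (\<Sum>e\<in>all_edges X. 4)"
    using p(1) by (rule mult_left_mono)
  then show "influence (all_edges X) p surplus \<le> 4 * p * real (card X choose 2)"
    unfolding inf using X by (simp add: card_all_edges mult_ac)
  have "(\<Sum>e\<in>all_edges X. E e) \<le> (\<Sum>e\<in>all_edges X. 4 * (real (card X) * p\<^sup>2))" by (intro sum_mono 3)
  then have "p * (\<Sum>e\<in>all_edges X. E e) \<le> p * (\<Sum>e\<in>all_edges X. 4 * (real (card X) * p\<^sup>2))"
    using p(1) by (rule mult_left_mono)
  then show "influence (all_edges X) p surplus \<le> 4 * p * real (card X choose 2) * (real (card X) * p\<^sup>2)"
    unfolding inf using X by (simp add: card_all_edges mult_ac)
qed

text \<open>Without conflicts the surplus is at least the number of triangles, so a negative surplus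
  forces a conflicting pair, and the expected number of these bounds the probability.\<close>

lemma prob_surplus_neg_sparse:
  assumes X: "finite X" and p: "0 \<le> p" "p \<le> 1"
  shows "measure_pmf.prob (rset (all_edges X) p) {G. surplus G < 0} \<le>
    real (card X choose 3) * (3 * real (card X)) * p ^ 5"
proof -
  have "measure_pmf.prob (rset (all_edges X) p) {G. surplus G < 0} =
      expect (rset (all_edges X) p) (\<lambda>G. of_bool (surplus G < 0))"
    by (simp add: expect_of_bool)
  also have "\<dots> \<le> expect (rset (all_edges X) p) (\<lambda>G. real (card (tpairs G)))"
  proof (intro expect_mono)
    fix G assume "G \<in> set_pmf (rset (all_edges X) p)"
    then have "finite G" using X by (intro rset_all_edges)
    from surplus_ge[OF this] show "of_bool (surplus G < 0) \<le> real (card (tpairs G))"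
      by (cases "surplus G < 0") auto
  qed (use X in auto)
  also have "\<dots> \<le> real (card X choose 3) * (3 * real (card X)) * p ^ 5"
    using assms by (rule expect_tpairs)
  finally show ?thesis .
qed

text \<open>The 1/6 keeps the relative loss \<open>3 * (real (card X) * p\<^sup>2)\<close> to
  conflicts at most one half.\<close>

lemma expect_surplus_sparse:
  assumes X: "finite X" and p: "0 \<le> p" "p \<le> 1" and "real (card X) * p\<^sup>2 \<le> 1 / 6"
  shows "expect (rset (all_edges X) p) surplus \<ge> real (card X choose 3) * p ^ 3 / 2"
proof -
  have "real (card X choose 3) * p ^ 3 / 2 \<le> real (card X choose 3) * p ^ 3 * (1 - 3 * (real (card X) * p\<^sup>2))"
    using assms mult_left_mono[of "1 / 2" "1 - 3 * (real (card X) * p\<^sup>2)" "real (card X choose 3) * p ^ 3"] by simp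
  also have "\<dots> = real (card X choose 3) * p ^ 3 - real (card X choose 3) * (3 * real (card X)) * p ^ 5"
    by (simp add: algebra_simps power_numeral_reduce)
  also have "\<dots> \<le> expect (rset (all_edges X) p) (\<lambda>G. real (card (triangles G)) - real (card (tpairs G)))"
    using expect_triangles[OF X p] expect_tpairs[OF X p] X by simp
  also have "\<dots> \<le> expect (rset (all_edges X) p) surplus"
  proof (intro expect_mono surplus_ge)
    fix G assume "G \<in> set_pmf (rset (all_edges X) p)"
    then show "finite G" using X by (intro rset_all_edges)
  qed (use X in auto)
  finally show ?thesis .
qed

subsection \<open>Non-backtracking walks through triangles\<close>

text \<open>A walk from a triangle alternates between edges and triangles; the list pairs each edge
  with the triangle entered through it.\<close>

fun walk_nodes :: "'v set \<Rightarrow> ('v \<times> 'v set) list \<Rightarrow> ('v + 'v set) list" where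
  "walk_nodes T ps = Inr T # concat (map (\<lambda>(e, T'). [Inl e, Inr T']) ps)"

lemma nb_walk_tl: "nb_walk Ts (x # xs) \<Longrightarrow> nb_walk Ts xs"
  by (cases "(Ts, x # xs)" rule: nb_walk.cases) auto

lemma nb_walk_prefix: "nb_walk Ts (xs @ ys) \<Longrightarrow> nb_walk Ts xs"
proof (induction ys rule: rev_induct)
  case (snoc y ys)
  have "nb_walk Ts (y # rev (xs @ ys))" using snoc.prems nb_walk_rev[of Ts "y # rev (xs @ ys)"] by simp
  then have "nb_walk Ts (rev (xs @ ys))" by (rule nb_walk_tl)
  then show ?case using snoc.IH nb_walk_rev by blast
qed auto

lemma nb_walk_cases:
  assumes "nb_walk Ts (Inr T # xs)"
  shows "\<exists>ps. Inr T # xs = walk_nodes T ps \<or> (\<exists>e. Inr T # xs = walk_nodes T ps @ [Inl e])"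
  using assms
proof (induction "length xs" arbitrary: T xs rule: less_induct)
  case less
  show ?case
  proof (cases xs)
    case Nil
    then show ?thesis by (intro exI[of _ "[]"]) auto
  next
    case (Cons y ys)
    then have "incident Ts (Inr T) y" using less.prems by (cases ys) auto
    then obtain e where y: "y = Inl e" by (cases y) auto
    show ?thesis
    proof (cases ys)
      case Nil
      then show ?thesis using Cons y by (intro exI[of _ "[]"]) auto
    next
      case (Cons z zs)
      have nb_walk: "nb_walk Ts (y # z # zs)" using less.prems \<open>xs = y # ys\<close> Cons nb_walk_tl by blast
      then have "incident Ts y z" by (cases zs) auto
      then obtain T' where z: "z = Inr T'" using y by (cases z) auto
      have "nb_walk Ts (Inr T' # zs)" using nb_walk z nb_walk_tl by blast
      then obtain ps where "Inr T' # zs = walk_nodes T' ps \<or> (\<exists>e. Inr T' # zs = walk_nodes T' ps @ [Inl e])"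
        using less.hyps[of zs T'] \<open>xs = y # ys\<close> Cons by auto
      then show ?thesis using \<open>xs = y # ys\<close> Cons y z
        by (intro exI[of _ "(e, T') # ps"]) auto
    qed
  qed
qed

definition verts :: "'v set set \<Rightarrow> ('v set \<times> 'v set set) list \<Rightarrow> 'v set" where
  "verts T ps = \<Union>T \<union> (\<Union>(e, T')\<in>set ps. \<Union>T')"

lemma nb_walk_snoc2:
  assumes "nb_walk Ts (xs @ [x, y, z, w])"
  shows "incident Ts x y" "incident Ts y z" "incident Ts z w" "x \<noteq> z" "y \<noteq> w"
proof -
  have 1: "nb_walk Ts (xs @ [x, y, z])" "incident Ts z w" "y \<noteq> w"
    using assms nb_walk_snoc[of Ts "xs @ [x]" y z w] by simp_all
  have 2: "nb_walk Ts (xs @ [x, y])" "incident Ts y z" "x \<noteq> z" using 1(1) nb_walk_snoc[of Ts xs x y z] by simp_all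
  have "nb_walk Ts [x, y]" using 2(1) by (induction xs) (auto dest: nb_walk_tl)
  then show "incident Ts x y" "incident Ts y z" "incident Ts z w" "x \<noteq> z" "y \<noteq> w" using 1 2 by auto
qed

text \<open>In a graph all of whose small vertex sets \<open>S\<close> containing a chosen triangle span at most
  \<open>2 |S| - 3\<close> edges, a non-backtracking walk through chosen triangles reaches a new vertex in each
  step: the vertex reached last has degree two among those seen so far, so its only triangle is
  the one just traversed.\<close>

lemma walk_new_vertex:
  fixes G :: "'a set set" and Ts :: "'a set set set"
  assumes Ts: "Ts \<subseteq> triangles G" and fin: "finite X" "G \<subseteq> all_edges X"
    and sparse: "\<And>S T. T \<in> Ts \<Longrightarrow> \<Union>T \<subseteq> S \<Longrightarrow> S \<subseteq> X \<Longrightarrow> card S \<le> M \<Longrightarrow> 4 \<le> card S \<Longrightarrow>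
      card (all_edges S \<inter> G) \<le> 2 * card S - 3"
    and T0: "T0 \<in> Ts"
  shows "nb_walk Ts (walk_nodes T0 ps) \<Longrightarrow> length ps + 3 \<le> M \<Longrightarrow>
    verts T0 ps \<subseteq> X \<and> card (verts T0 ps) = length ps + 3 \<and>
    card (all_edges (verts T0 ps) \<inter> G) = 2 * length ps + 3 \<and>
    (\<forall>qs e T. ps = qs @ [(e, T)] \<longrightarrow> (\<exists>a. a \<notin> verts T0 qs \<and> \<Union>T = insert a e \<and>
      (\<forall>b\<in>verts T0 ps - {a}. {a, b} \<in> G \<longrightarrow> b \<in> e)))"
proof (induction ps rule: rev_induct)
  case Nil
  obtain t where t: "T0 = all_edges t" "card t = 3" "all_edges t \<subseteq> G"
    using T0 Ts by (auto simp: triangles_altdef)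
  have v: "verts T0 [] = t" using t by (simp add: verts_def Union_all_edges)
  have "t \<subseteq> X" using t fin subset_of_all_edges by blast
  then show ?case using t v by (simp add: Int_absorb2 card_triangle)
next
  case (snoc x ps)
  obtain e T' where x: "x = (e, T')" by force
  define V where "V = verts T0 ps"
  have walk_nodes: "walk_nodes T0 (ps @ [x]) = walk_nodes T0 ps @ [Inl e, Inr T']" using x by simp
  have nb1: "nb_walk Ts (walk_nodes T0 ps)" using snoc.prems(1) unfolding walk_nodes by (rule nb_walk_prefix)
  note IH = snoc.IH[OF nb1]
  have V: "V \<subseteq> X" "card V = length ps + 3" "card (all_edges V \<inter> G) = 2 * length ps + 3"
    using IH snoc.prems(2) by (auto simp: V_def)
  have finV: "finite V" using V(1) fin(1) by (rule finite_subset)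
  have T0V: "\<Union>T0 \<subseteq> V" by (auto simp: V_def verts_def)
  obtain T where T: "T \<in> Ts" "e \<in> T" "e \<in> T'" "T' \<in> Ts" "T \<noteq> T'" "\<Union>T \<subseteq> V"
    and Tps: "ps = [] \<Longrightarrow> T = T0" "\<And>qs e0 T1. ps = qs @ [(e0, T1)] \<Longrightarrow> T = T1 \<and> e0 \<noteq> e \<and> e0 \<in> T"
  proof (cases ps rule: rev_cases)
    case Nil
    then have "nb_walk Ts [Inr T0, Inl e, Inr T']" using snoc.prems(1) x by simp
    then show ?thesis using that[of T0] Nil T0V by auto
  next
    case (snoc qs y)
    obtain e0 T1 where y: "y = (e0, T1)" by force
    have "nb_walk Ts (walk_nodes T0 qs @ [Inl e0, Inr T1, Inl e, Inr T'])"
      using snoc.prems(1) snoc x y \<open>nb_walk Ts (walk_nodes T0 (ps @ [x]))\<close> by simp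
    from nb_walk_snoc2[OF this] have "e0 \<in> T1" "e \<in> T1" "T1 \<in> Ts" "e \<in> T'" "T' \<in> Ts" "e0 \<noteq> e" "T1 \<noteq> T'" by auto
    moreover have "\<Union>T1 \<subseteq> V" using snoc y by (auto simp: V_def verts_def)
    ultimately show ?thesis
      by (intro that[of T1]) (simp_all add: snoc y)
  qed
  obtain t where t: "T = all_edges t" "card t = 3" "all_edges t \<subseteq> G" "\<Union>T = t"
    using T(1) Ts Union_all_edges unfolding triangles_altdef by blast
  obtain t' where t': "T' = all_edges t'" "card t' = 3" "all_edges t' \<subseteq> G" "\<Union>T' = t'"
    using T(4) Ts Union_all_edges unfolding triangles_altdef by blast
  have t'X: "t' \<subseteq> X" using t' fin subset_of_all_edges by blast
  have e: "e \<subseteq> t" "e \<subseteq> t'" "card e = 2" using T t t' by (auto simp: all_edges_def)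
  have eV: "e \<subseteq> V" using e T(6) t by auto
  obtain c where c: "t' = insert c e" "c \<notin> e"
    using triangle_apex[OF t'(2) _ t'(3) t'X, of e] T(3) t'(1) by (auto simp: apexes_def)
  \<comment> \<open>An old apex would give \<open>t' = t\<close>. This is clear if only
    \<open>T0\<close> has been visited. Otherwise the last new vertex \<open>a\<close> lies on
    \<open>e\<close>, an edge of \<open>t\<close> other than \<open>e0\<close>; then
    \<open>{a, c}\<close> is an edge of \<open>G\<close>, and since the only neighbours of
    \<open>a\<close> seen so far are the ends of \<open>e0\<close>, the vertex \<open>c\<close>
    belongs to \<open>t\<close>.\<close>
  have cV: "c \<notin> V"
  proof
    assume cV: "c \<in> V"
    have t'V: "t' \<subseteq> V" using c eV cV by auto
    show False
    proof (cases ps rule: rev_cases)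
      case Nil
      then have "V = t" using Tps t by (simp add: V_def verts_def)
      moreover have "finite t" using t by (simp add: card_ge_0_finite)
      ultimately have "t' = t" using t'V t t' by (metis card_subset_eq)
      then show False using T t t' by simp
    next
      case (snoc qs y)
      obtain e0 T1 where y: "y = (e0, T1)" by force
      then have T1: "T1 = T" "e0 \<noteq> e" "e0 \<in> T" using Tps(2)[of qs e0 T1] snoc by auto
      obtain a where a: "a \<notin> verts T0 qs" "\<Union>T = insert a e0"
        "\<And>b. b \<in> V - {a} \<Longrightarrow> {a, b} \<in> G \<Longrightarrow> b \<in> e0"
        using IH snoc.prems snoc y T1 \<open>length (ps @ [x]) + 3 \<le> M\<close> by (auto simp: V_def)
      have te0: "t = insert a e0" using a t by simp
      have e0: "card e0 = 2" "e0 \<subseteq> t" using T1 t by (auto simp: all_edges_def)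
      have fin0: "finite e0" "finite e" using e0 e by (auto simp: card_ge_0_finite)
      have ae: "a \<in> e"
      proof (rule ccontr)
        assume "a \<notin> e"
        then have "e \<subseteq> e0" using e te0 by auto
        then show False using e0 e T1 fin0 card_subset_eq by metis
      qed
      then have "c \<noteq> a" using c by auto
      moreover have "{a, c} \<in> G"
      proof -
        have "{a, c} \<in> all_edges t'" using ae c \<open>c \<noteq> a\<close> by auto
        then show ?thesis using t' by blast
      qed
      ultimately have "c \<in> e0" using a(3) cV by auto
      then have "t' \<subseteq> t" using c e e0 by auto
      moreover have "finite t" using t by (simp add: card_ge_0_finite)
      ultimately have "t' = t" using t t' card_subset_eq by metis
      then show False using T t t' by simp
    qed
  qed
  define V' where "V' = insert c V"
  have V': "verts T0 (ps @ [x]) = V'"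
    using x c eV t' by (auto simp: V'_def V_def verts_def)
  have V'X: "V' \<subseteq> X" using V t'X c by (auto simp: V'_def)
  have cV': "card V' = length ps + 4" using V finV cV by (simp add: V'_def)
  define N where "N = (\<lambda>b. {c, b}) ` e"
  have finG: "finite (all_edges V' \<inter> G)" using finV by (simp add: V'_def)
  have fine: "finite e" using e by (simp add: card_ge_0_finite)
  have cardN: "card N = 2"
  proof -
    have "inj_on (\<lambda>b. {c, b}) e" by (auto simp: inj_on_def doubleton_eq_iff)
    then show ?thesis using e by (simp add: N_def card_image)
  qed
  have NG: "N \<subseteq> G"
  proof
    fix y assume "y \<in> N"
    then obtain b where b: "b \<in> e" "y = {c, b}" by (auto simp: N_def)
    then have "b \<noteq> c" using c by auto
    then have "y \<in> all_edges t'" using b c by auto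
    then show "y \<in> G" using t' by blast
  qed
  have NV: "N \<subseteq> all_edges V'" using c eV by (auto simp: N_def V'_def)
  have disj: "(all_edges V \<inter> G) \<inter> N = {}" using cV by (auto simp: N_def)
  have sub: "(all_edges V \<inter> G) \<union> N \<subseteq> all_edges V' \<inter> G"
    using NG NV all_edges_mono[of V V'] by (auto simp: V'_def)
  \<comment> \<open>The vertex \<open>c\<close> brings two edges, to the ends of \<open>e\<close>,
    and sparsity allows \<open>2 * card V' - 3 = 2 * length ps + 5\<close> edges in all. The bound
    is attained, so \<open>V'\<close> spans no further edge and \<open>c\<close> has degree two in
    it.\<close>
  have "card ((all_edges V \<inter> G) \<union> N) = 2 * length ps + 5"
    using V cardN disj finV by (subst card_Un_disjoint) (auto simp: N_def fine)
  moreover have le: "card (all_edges V' \<inter> G) \<le> 2 * length ps + 5"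
  proof -
    have "\<Union>T0 \<subseteq> V'" using T0V by (auto simp: V'_def)
    from sparse[OF T0 this V'X] show ?thesis using cV' snoc.prems(2) by simp
  qed
  ultimately have eq: "(all_edges V \<inter> G) \<union> N = all_edges V' \<inter> G"
    by (intro card_seteq[OF finG sub]) simp
  have cardE: "card (all_edges V' \<inter> G) = 2 * length ps + 5"
    unfolding eq[symmetric] using V cardN disj finV by (subst card_Un_disjoint) (auto simp: N_def fine)
  have nbrs: "b \<in> e" if "b \<in> V' - {c}" "{c, b} \<in> G" for b
  proof -
    have "{c, b} \<in> all_edges V' \<inter> G" using that by (auto simp: V'_def)
    then have "{c, b} \<in> N" unfolding eq[symmetric] using cV by auto
    then show "b \<in> e" using that by (auto simp: N_def doubleton_eq_iff)
  qed
  show ?case unfolding V'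
    using V'X cV' cardE nbrs cV c x t' by (auto simp: V_def)
qed

text \<open>The newest vertex decides. A walk between triangles ends at one with a vertex outside
  the first. A longer walk between edges ends, since it cannot turn back, at an edge through the
  newest vertex, which the first edge avoids; with only three nodes the two edges differ by
  definition.\<close>

lemma no_closed_walk_of_sparse:
  fixes G :: "'a set set" and Ts :: "'a set set set"
  assumes Ts: "Ts \<subseteq> triangles G" and fin: "finite X" "G \<subseteq> all_edges X"
    and sparse: "\<And>S T. T \<in> Ts \<Longrightarrow> \<Union>T \<subseteq> S \<Longrightarrow> S \<subseteq> X \<Longrightarrow> card S \<le> M \<Longrightarrow> 4 \<le> card S \<Longrightarrow>
      card (all_edges S \<inter> G) \<le> 2 * card S - 3"
    and LM: "L + 3 \<le> M"
  shows "no_closed_walk Ts L"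
  unfolding no_closed_walk_def
proof (intro allI impI)
  have new: "\<exists>a. a \<notin> verts T qs \<and> \<Union>T' = insert a e"
    if "T \<in> Ts" "nb_walk Ts (walk_nodes T (qs @ [(e, T')]))" "length qs + 4 \<le> M" for T qs e T'
    using walk_new_vertex[OF Ts fin _ that(1,2), of M] sparse that(3) by auto
  have len: "2 * length ps + 1 = length (walk_nodes T ps)" for T :: "'a set set" and ps
    by (induction ps) auto
  have vs: "\<Union>T \<subseteq> verts T ps" for T :: "'a set set" and ps by (auto simp: verts_def)
  fix xs assume xs: "nb_walk Ts xs \<and> 2 \<le> length xs \<and> length xs \<le> L"
  then obtain x y ys where xy: "xs = x # y # ys" by (cases xs; cases "tl xs") auto
  show "hd xs \<noteq> last xs"
  proof (cases x)
    case (Inr T)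
    have TT: "T \<in> Ts" using xs xy Inr by (cases y; cases ys) auto
    obtain ps where ps: "xs = walk_nodes T ps \<or> (\<exists>e. xs = walk_nodes T ps @ [Inl e])"
      using nb_walk_cases[of Ts T "y # ys"] xs xy Inr by auto
    show ?thesis
    proof (cases "xs = walk_nodes T ps")
      case True
      then have "ps \<noteq> []" using xy by auto
      then obtain qs e T' where qs: "ps = qs @ [(e, T')]" by (metis rev_exhaust surj_pair)
      have "\<exists>a. a \<notin> verts T qs \<and> \<Union>T' = insert a e"
        using new[OF TT, of qs e T'] qs xs True len[of ps T] LM by auto
      then have "\<Union>T' \<noteq> \<Union>T" using vs[of T qs] by blast
      then show ?thesis using True qs by auto
    next
      case False
      then show ?thesis using ps by auto
    qed
  next
    case (Inl e)
    have "incident Ts x y" using xs xy by (cases ys) auto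
    then obtain T where y: "y = Inr T" "e \<in> T" "T \<in> Ts" using Inl by (cases y) auto
    have nb_walk: "nb_walk Ts (y # ys)" using xs xy nb_walk_tl by blast
    then obtain ps where ps: "y # ys = walk_nodes T ps \<or> (\<exists>e. y # ys = walk_nodes T ps @ [Inl e])"
      using nb_walk_cases[of Ts T ys] y by auto
    show ?thesis
    proof (cases "y # ys = walk_nodes T ps")
      case True
      then have "last xs = last (walk_nodes T ps)" using xy by auto
      moreover have "last (walk_nodes T ps) \<noteq> Inl e"
        by (cases ps rule: rev_cases) (auto split: prod.splits)
      ultimately show ?thesis using xy Inl by simp
    next
      case False
      then obtain e' where e': "y # ys = walk_nodes T ps @ [Inl e']" using ps by auto
      then have last: "last xs = Inl e'" using xy by (metis last_ConsR last_snoc list.distinct(1))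
      show ?thesis
      proof (cases ps rule: rev_cases)
        case Nil
        then have "xs = [Inl e, Inr T, Inl e']" using e' xy Inl y by simp
        then show ?thesis using xs by auto
      next
        case (snoc qs z)
        obtain e0 T' where z: "z = (e0, T')" by force
        have nbp: "nb_walk Ts (walk_nodes T ps)" using nb_walk e' nb_walk_prefix by metis
        have "length (walk_nodes T ps) \<le> L" using xs xy e' by (metis Suc_leD length_Cons length_append_singleton)
        then have "\<exists>a. a \<notin> verts T qs \<and> \<Union>T' = insert a e0"
          using new[OF y(3), of qs e0 T'] nbp snoc z len[of ps T] LM by auto
        then obtain a where a: "a \<notin> verts T qs" "\<Union>T' = insert a e0" by blast
        obtain zs u where zs: "walk_nodes T qs = zs @ [u]" by (metis walk_nodes.simps list.distinct(1) rev_exhaust)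
        have "walk_nodes T ps @ [Inl e'] = walk_nodes T qs @ [Inl e0, Inr T', Inl e']" using snoc z by simp
        also have "\<dots> = zs @ [u, Inl e0, Inr T', Inl e']" unfolding zs by simp
        finally have "nb_walk Ts (zs @ [u, Inl e0, Inr T', Inl e'])" using nb_walk unfolding e' by simp
        from nb_walk_snoc2[OF this] have *: "e0 \<in> T'" "e' \<in> T'" "T' \<in> Ts" "e0 \<noteq> e'" by auto
        have "T' \<subseteq> all_edges X" using *(3) Ts fin(2) triangle_subset by blast
        then have c2: "card e0 = 2" "card e' = 2" using *(1,2) by (auto simp: all_edges_def)
        have "a \<in> e'"
        proof (rule ccontr)
          assume "a \<notin> e'"
          moreover have "e' \<subseteq> insert a e0" using Union_upper[OF *(2)] a(2) by simp
          ultimately have "e' \<subseteq> e0" by auto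
          moreover have "finite e0" using c2 by (simp add: card_ge_0_finite)
          ultimately show False using c2 * card_subset_eq by metis
        qed
        moreover have "a \<notin> e" using a vs[of T qs] y by blast
        ultimately show ?thesis using last xy Inl by auto
      qed
    qed
  qed
qed

subsection \<open>Locally sparse random graphs\<close>

lemma choose_le_power: "n choose k \<le> n ^ k"
proof (cases "k \<le> n")
  case True
  then show ?thesis by (rule binomial_le_pow)
qed (simp add: binomial_eq_0)

text \<open>The obstructions to local acyclicity. Up to constants,
  \<open>n ^ v * p ^ (2 * v - 2) = n * (n * p\<^sup>2) ^ (v - 1)\<close> of them of size
  \<open>v\<close> are expected: linear in \<open>n\<close> when \<open>n * p\<^sup>2\<close> is
  bounded, against order \<open>n powr (3 / 2)\<close> triangles.\<close>

definition dense_sets :: "'a set \<Rightarrow> nat \<Rightarrow> 'a set set \<Rightarrow> 'a set set" where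
  "dense_sets X M G = {S. S \<subseteq> X \<and> 4 \<le> card S \<and> card S \<le> M \<and> 2 * card S - 2 \<le> card (all_edges S \<inter> G)}"

definition good_triangles :: "'a set \<Rightarrow> nat \<Rightarrow> nat \<Rightarrow> 'a set set \<Rightarrow> 'a set set set" where
  "good_triangles X M d G =
    {T \<in> triangles G. (\<forall>e\<in>T. card (apexes X G e) \<le> d) \<and> (\<forall>S\<in>dense_sets X M G. \<not> \<Union>T \<subseteq> S)}"

lemma finite_apexes [simp]: "finite X \<Longrightarrow> finite (apexes X G e)"
  by (rule finite_subset[of _ X]) (auto simp: apexes_def)

lemma triangles_at_edge:
  assumes "G \<subseteq> all_edges X"
  shows "{T \<in> triangles G. e \<in> T} \<subseteq> (\<lambda>w. all_edges (insert w e)) ` apexes X G e"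
proof
  fix T assume T: "T \<in> {T \<in> triangles G. e \<in> T}"
  then obtain t where t: "T = all_edges t" "card t = 3" "all_edges t \<subseteq> G" "t \<subseteq> X" "e \<in> all_edges t"
    by (auto simp: triangles_eq_ksets[OF assms] ksets_def)
  then show "T \<in> (\<lambda>w. all_edges (insert w e)) ` apexes X G e"
    using triangle_apex[of t e G X] by auto
qed

text \<open>The edges of \<open>G\<close> become the vertices of the triple system and the good
  triangles its triples. Walks of \<open>4 * R + 8\<close> nodes require sparsity of vertex sets up
  to size \<open>4 * R + 11\<close>.\<close>

lemma nibble_good_triangles:
  assumes X: "finite X" "G \<subseteq> all_edges X"
    and "0 < \<theta>" "\<theta> \<le> 1" "0 < R" "1 \<le> d" "real d + ln (1 + 2 * (D * \<theta>\<^sup>2)) / 2 \<le> D" "0 < D" "4 * R + 11 \<le> M"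
  shows "nibble (good_triangles X M d G) G R d D \<theta>"
proof
  define Ts where "Ts = good_triangles X M d G"
  have sub: "Ts \<subseteq> triangles G" by (auto simp: Ts_def good_triangles_def)
  show finG: "finite G" by (rule finite_subset[OF X(2)]) (use X in simp)
  show "\<Union>(good_triangles X M d G) \<subseteq> G" using sub triangle_subset unfolding Ts_def by blast
  show "card T = 3" if "T \<in> good_triangles X M d G" for T
    using that sub card_triangle unfolding Ts_def triangles_altdef by blast
  show "card {T \<in> good_triangles X M d G. e \<in> T} \<le> d" if "e \<in> G" for e
  proof (cases "{T \<in> Ts. e \<in> T} = {}")
    case False
    then have le: "card (apexes X G e) \<le> d" by (auto simp: Ts_def good_triangles_def)
    have "{T \<in> Ts. e \<in> T} \<subseteq> (\<lambda>w. all_edges (insert w e)) ` apexes X G e"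
      using triangles_at_edge[OF X(2), of e] sub by blast
    then have "card {T \<in> Ts. e \<in> T} \<le> card (apexes X G e)"
      by (rule surj_card_le[rotated]) (use X in simp)
    then show ?thesis using le unfolding Ts_def by linarith
  next
    case True
    then have "card {T \<in> Ts. e \<in> T} = 0" by (simp only: card.empty)
    then show ?thesis unfolding Ts_def by simp
  qed
  show "no_closed_walk (good_triangles X M d G) (4 * R + 8)"
  proof (rule no_closed_walk_of_sparse[OF _ X])
    fix S T assume "T \<in> good_triangles X M d G" "\<Union>T \<subseteq> S" "S \<subseteq> X" "card S \<le> M" "4 \<le> card S"
    then have "S \<notin> dense_sets X M G" by (auto simp: good_triangles_def)
    then show "card (all_edges S \<inter> G) \<le> 2 * card S - 3"
      using \<open>S \<subseteq> X\<close> \<open>card S \<le> M\<close> \<open>4 \<le> card S\<close> by (auto simp: dense_sets_def)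
  qed (use sub assms in \<open>auto simp: Ts_def\<close>)
qed (use assms in auto)

lemma finite_dense_sets [simp]: "finite X \<Longrightarrow> finite (dense_sets X M G)"
  by (rule finite_subset[of _ "Pow X"]) (auto simp: dense_sets_def)

text \<open>A triangle that is not good either has an edge of codegree above \<open>d\<close>, and
  is charged to an apex of that edge, or lies in a dense set, which contains at most
  \<open>M ^ 3\<close> triangles.\<close>

lemma card_triangles_le:
  assumes X: "finite X" "G \<subseteq> all_edges X"
  shows "card (triangles G) \<le> card (good_triangles X M d G) +
    (\<Sum>e\<in>{e \<in> G. d < card (apexes X G e)}. card (apexes X G e)) + card (dense_sets X M G) * M ^ 3"
proof -
  define H where "H = {e \<in> G. d < card (apexes X G e)}"
  define A where "A = (\<Union>e\<in>H. (\<lambda>w. all_edges (insert w e)) ` apexes X G e)"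
  define B where "B = (\<Union>S\<in>dense_sets X M G. all_edges ` ksets 3 S)"
  have finG: "finite G" by (rule finite_subset[OF X(2)]) (use X in simp)
  have finH: "finite H" using finG by (simp add: H_def)
  have sub: "triangles G \<subseteq> good_triangles X M d G \<union> A \<union> B"
  proof
    fix T assume T: "T \<in> triangles G"
    then obtain t where t: "T = all_edges t" "card t = 3" by (auto simp: triangles_altdef)
    show "T \<in> good_triangles X M d G \<union> A \<union> B"
    proof (cases "T \<in> good_triangles X M d G")
      case False
      then consider e where "e \<in> T" "d < card (apexes X G e)" | S where "S \<in> dense_sets X M G" "\<Union>T \<subseteq> S"
        using T unfolding good_triangles_def by fastforce
      then show ?thesis
      proof cases
        case 1
        then have "e \<in> H" using triangle_subset[OF T] by (auto simp: H_def)
        moreover have "T \<in> (\<lambda>w. all_edges (insert w e)) ` apexes X G e"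
          using triangles_at_edge[OF X(2), of e] T 1(1) by blast
        ultimately have "T \<in> A" unfolding A_def by blast
        then show ?thesis by simp
      next
        case 2
        then have "t \<in> ksets 3 S" using t by (simp add: ksets_def Union_all_edges)
        then have "T \<in> B" using 2(1) t(1) unfolding B_def by blast
        then show ?thesis by simp
      qed
    qed simp
  qed
  have fg: "finite (good_triangles X M d G)"
    using finite_triangles[OF finG] by (simp add: good_triangles_def)
  have fA: "finite A" unfolding A_def using finH X by auto
  have fS: "finite S" if "S \<in> dense_sets X M G" for S
    using that X(1) finite_subset unfolding dense_sets_def by blast
  have fB: "finite B" unfolding B_def using X fS by auto
  have cA: "card A \<le> (\<Sum>e\<in>H. card (apexes X G e))"
  proof -
    have "card A \<le> (\<Sum>e\<in>H. card ((\<lambda>w. all_edges (insert w e)) ` apexes X G e))"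
      unfolding A_def using finH by (rule card_UN_le)
    also have "\<dots> \<le> (\<Sum>e\<in>H. card (apexes X G e))"
      using X by (intro sum_mono card_image_le) auto
    finally show ?thesis .
  qed
  have cB: "card B \<le> card (dense_sets X M G) * M ^ 3"
  proof -
    have "card B \<le> (\<Sum>S\<in>dense_sets X M G. card (all_edges ` ksets 3 S))"
      unfolding B_def using X by (intro card_UN_le) auto
    also have "\<dots> \<le> (\<Sum>S\<in>dense_sets X M G. M ^ 3)"
    proof (intro sum_mono)
      fix S assume S: "S \<in> dense_sets X M G"
      have "card (all_edges ` ksets 3 S) \<le> card (ksets 3 S)" using fS[OF S] by (intro card_image_le) auto
      also have "\<dots> = card S choose 3" using fS[OF S] by (rule card_ksets)
      also have "\<dots> \<le> card S ^ 3" by (rule choose_le_power)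
      also have "\<dots> \<le> M ^ 3" using S by (intro power_mono) (auto simp: dense_sets_def)
      finally show "card (all_edges ` ksets 3 S) \<le> M ^ 3" .
    qed
    finally show ?thesis by simp
  qed
  have "card (triangles G) \<le> card (good_triangles X M d G \<union> A \<union> B)"
    using sub fg fA fB by (intro card_mono) auto
  also have "\<dots> \<le> card (good_triangles X M d G) + card A + card B"
    by (meson add_mono_thms_linordered_semiring(3) card_Un_le order_trans)
  finally show ?thesis using cA cB unfolding H_def by linarith
qed

text \<open>Given \<open>e\<close>, its codegree is binomial with \<open>card X - 2\<close> trials
  of probability \<open>p\<^sup>2\<close>. The square is expanded: different apexes use disjoint
  pairs of edges, so together with \<open>e\<close> two apexes need five edges and one needs
  three.\<close>

lemma expect_codegree_variance:
  assumes X: "finite X" and p: "0 \<le> p" "p \<le> 1" and e: "e \<in> all_edges X"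
  shows "expect (rset (all_edges X) p)
      (\<lambda>G. of_bool (e \<in> G) * (real (card (apexes X G e)) - real (card X - 2) * p\<^sup>2)\<^sup>2) \<le> real (card X) * p ^ 3"
proof -
  define Y where "Y = X - e"
  define N where "N = real (card Y)"
  define m where "m = N * p\<^sup>2"
  define F where "F = (\<lambda>w. all_edges (insert w e) - {e})"
  have finY: "finite Y" using X by (simp add: Y_def)
  have ec: "e \<subseteq> X" "card e = 2" using e by (auto simp: all_edges_def)
  then have "finite e" by (simp add: card_ge_0_finite)
  then have cY: "card Y = card X - 2" unfolding Y_def using ec by (simp add: card_Diff_subset)
  have FX: "F w \<subseteq> all_edges X" "card (F w) = 2" "e \<notin> F w" if "w \<in> Y" for w
    using edge_triangle[OF e, of w] that unfolding F_def Y_def by blast+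
  have finF: "finite (F w)" if "w \<in> Y" for w
    using FX(2)[OF that] by (simp add: card_ge_0_finite)
  have mem: "w \<in> f" if "f \<in> F w" for f w
  proof (rule ccontr)
    assume "w \<notin> f"
    then have "f \<subseteq> e" "card f = 2" "f \<noteq> e" using that by (auto simp: F_def all_edges_def)
    then show False using ec \<open>finite e\<close> card_subset_eq by metis
  qed
  have disj: "F w \<inter> F w' = {}" if "w \<in> Y" "w' \<in> Y" "w \<noteq> w'" for w w'
  proof (rule ccontr)
    assume "F w \<inter> F w' \<noteq> {}"
    then obtain f where f: "f \<in> F w" "f \<in> F w'" by blast
    then have "w \<in> f" "f \<subseteq> insert w' e" using mem by (auto simp: F_def all_edges_def)
    then show False using that by (auto simp: Y_def)
  qed
  have c: "real (card (apexes X G e)) = (\<Sum>w\<in>Y. of_bool (F w \<subseteq> G))" for G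
  proof -
    have "apexes X G e = {w \<in> Y. F w \<subseteq> G}" by (auto simp: apexes_def Y_def F_def)
    then show ?thesis using finY by (simp add: of_bool_def sum.If_cases Int_def)
  qed
  define E where "E = expect (rset (all_edges X) p)"
  have Es: "E (\<lambda>G. of_bool (Z \<subseteq> G)) = p ^ card Z" if "Z \<subseteq> all_edges X" for Z
    unfolding E_def using that X p by (intro expect_rset_supset) auto
  have "of_bool (e \<in> G) * (real (card (apexes X G e)) - m)\<^sup>2 =
     (\<Sum>w\<in>Y. \<Sum>w'\<in>Y. of_bool (insert e (F w \<union> F w') \<subseteq> G)) - 2 * m * (\<Sum>w\<in>Y. of_bool (insert e (F w) \<subseteq> G))
     + m\<^sup>2 * of_bool ({e} \<subseteq> G)" for G
  proof -
    have "(\<Sum>w\<in>Y. \<Sum>w'\<in>Y. of_bool (insert e (F w \<union> F w') \<subseteq> G) :: real) =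
      of_bool (e \<in> G) * ((\<Sum>w\<in>Y. of_bool (F w \<subseteq> G)) * (\<Sum>w'\<in>Y. of_bool (F w' \<subseteq> G)))"
      unfolding sum_product sum_distrib_left by (intro sum.cong refl) (auto simp: of_bool_conj)
    moreover have "(\<Sum>w\<in>Y. of_bool (insert e (F w) \<subseteq> G) :: real) = of_bool (e \<in> G) * (\<Sum>w\<in>Y. of_bool (F w \<subseteq> G))"
      unfolding sum_distrib_left by (intro sum.cong refl) (auto simp: of_bool_conj)
    ultimately show ?thesis unfolding c by (simp add: power2_eq_square algebra_simps)
  qed
  then have "E (\<lambda>G. of_bool (e \<in> G) * (real (card (apexes X G e)) - m)\<^sup>2) =
    E (\<lambda>G. (\<Sum>w\<in>Y. \<Sum>w'\<in>Y. of_bool (insert e (F w \<union> F w') \<subseteq> G)) - 2 * m * (\<Sum>w\<in>Y. of_bool (insert e (F w) \<subseteq> G))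
     + m\<^sup>2 * of_bool ({e} \<subseteq> G))" by simp
  also have "\<dots> = (\<Sum>w\<in>Y. \<Sum>w'\<in>Y. E (\<lambda>G. of_bool (insert e (F w \<union> F w') \<subseteq> G)))
     - 2 * m * (\<Sum>w\<in>Y. E (\<lambda>G. of_bool (insert e (F w) \<subseteq> G))) + m\<^sup>2 * E (\<lambda>G. of_bool ({e} \<subseteq> G))"
    unfolding E_def using X by (simp only: expect_rset_add expect_rset_diff expect_rset_sum finite_all_edges
       integral_mult_right_zero)
  also have "(\<Sum>w\<in>Y. E (\<lambda>G. of_bool (insert e (F w) \<subseteq> G))) = (\<Sum>w\<in>Y. p ^ 3)"
  proof (intro sum.cong refl)
    fix w assume w: "w \<in> Y"
    have "card (insert e (F w)) = 3" using FX[OF w] finF[OF w] by simp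
    then show "E (\<lambda>G. of_bool (insert e (F w) \<subseteq> G)) = p ^ 3" using FX[OF w] e by (subst Es) auto
  qed
  also have "E (\<lambda>G. of_bool ({e} \<subseteq> G)) = p" using e by (subst Es) auto
  also have "(\<Sum>w\<in>Y. \<Sum>w'\<in>Y. E (\<lambda>G. of_bool (insert e (F w \<union> F w') \<subseteq> G))) =
     (\<Sum>w\<in>Y. \<Sum>w'\<in>Y. p ^ 5 + of_bool (w = w') * (p ^ 3 - p ^ 5))"
  proof (intro sum.cong refl)
    fix w w' assume w: "w \<in> Y" "w' \<in> Y"
    have "E (\<lambda>G. of_bool (insert e (F w \<union> F w') \<subseteq> G)) = p ^ card (insert e (F w \<union> F w'))"
      using FX w e by (intro Es) auto
    also have "card (insert e (F w \<union> F w')) = Suc (card (F w \<union> F w'))"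
      using FX w finF by simp
    also have "card (F w \<union> F w') = (if w = w' then 2 else 4)"
      using FX w finF disj by (auto simp: card_Un_disjoint)
    finally show "E (\<lambda>G. of_bool (insert e (F w \<union> F w') \<subseteq> G)) = p ^ 5 + of_bool (w = w') * (p ^ 3 - p ^ 5)"
      by (auto simp: eval_nat_numeral)
  qed
  also have "\<dots> = N\<^sup>2 * p ^ 5 + N * (p ^ 3 - p ^ 5)"
  proof -
    have "(\<Sum>w'\<in>Y. p ^ 5 + of_bool (w = w') * (p ^ 3 - p ^ 5)) = N * p ^ 5 + (p ^ 3 - p ^ 5)" if "w \<in> Y" for w
      using finY that by (simp add: sum.distrib N_def flip: sum_distrib_right)
    then have "(\<Sum>w\<in>Y. \<Sum>w'\<in>Y. p ^ 5 + of_bool (w = w') * (p ^ 3 - p ^ 5)) =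
        (\<Sum>w\<in>Y. N * p ^ 5 + (p ^ 3 - p ^ 5))" by (intro sum.cong) auto
    also have "\<dots> = N * (N * p ^ 5 + (p ^ 3 - p ^ 5))" by (simp add: N_def)
    finally show ?thesis by (simp add: power2_eq_square algebra_simps)
  qed
  finally have "E (\<lambda>G. of_bool (e \<in> G) * (real (card (apexes X G e)) - m)\<^sup>2) = N * p ^ 3 - N * p ^ 5"
    by (simp add: m_def N_def[symmetric] algebra_simps eval_nat_numeral)
  also have "\<dots> \<le> real (card X) * p ^ 3"
  proof -
    have "N * p ^ 3 \<le> real (card X) * p ^ 3" using p by (intro mult_right_mono) (auto simp: N_def cY)
    moreover have "0 \<le> N * p ^ 5" using p by (simp add: N_def)
    ultimately show ?thesis by linarith
  qed
  finally show ?thesis by (simp add: E_def m_def N_def cY)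
qed

text \<open>Union bound over the vertex set and over \<open>2 * v - 2\<close> edges present in it;
  \<open>2 ^ (M\<^sup>2)\<close> crudely counts the edge sets on at most \<open>M\<close>
  vertices.\<close>

lemma expect_dense_sets:
  assumes X: "finite X" and p: "0 \<le> p" "p \<le> 1"
  shows "expect (rset (all_edges X) p) (\<lambda>G. real (card (dense_sets X M G))) \<le>
    real (card X) * (\<Sum>v\<in>{4..M}. 2 ^ (M\<^sup>2) * (real (card X) * p\<^sup>2) ^ (v - 1))"
proof -
  define n where "n = card X"
  have bound: "real (card (dense_sets X M G)) \<le>
     (\<Sum>v\<in>{4..M}. \<Sum>S\<in>ksets v X. \<Sum>F\<in>ksets (2 * v - 2) (all_edges S). of_bool (F \<subseteq> G))" for G
  proof -
    have "dense_sets X M G \<subseteq> (\<Union>v\<in>{4..M}. {S \<in> ksets v X. 2 * v - 2 \<le> card (all_edges S \<inter> G)})"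
      by (auto simp: dense_sets_def ksets_def)
    then have "card (dense_sets X M G) \<le> card (\<Union>v\<in>{4..M}. {S \<in> ksets v X. 2 * v - 2 \<le> card (all_edges S \<inter> G)})"
      using X by (intro card_mono) auto
    also have "\<dots> \<le> (\<Sum>v\<in>{4..M}. card {S \<in> ksets v X. 2 * v - 2 \<le> card (all_edges S \<inter> G)})"
      by (rule card_UN_le) simp
    finally have "real (card (dense_sets X M G)) \<le>
       real (\<Sum>v\<in>{4..M}. card {S \<in> ksets v X. 2 * v - 2 \<le> card (all_edges S \<inter> G)})"
      by (rule of_nat_mono)
    also have "\<dots> = (\<Sum>v\<in>{4..M}. real (card {S \<in> ksets v X. 2 * v - 2 \<le> card (all_edges S \<inter> G)}))"
      by (rule of_nat_sum)
    also have "\<dots> = (\<Sum>v\<in>{4..M}. \<Sum>S\<in>ksets v X. of_bool (2 * v - 2 \<le> card (all_edges S \<inter> G)))"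
      using X by (simp add: of_bool_def sum.If_cases Int_def)
    also have "\<dots> \<le> (\<Sum>v\<in>{4..M}. \<Sum>S\<in>ksets v X. \<Sum>F\<in>ksets (2 * v - 2) (all_edges S). of_bool (F \<subseteq> G))"
    proof (intro sum_mono)
      fix v S assume S: "S \<in> ksets v X"
      have finS: "finite S" using S X by (auto simp: ksets_def intro: finite_subset)
      show "of_bool (2 * v - 2 \<le> card (all_edges S \<inter> G)) \<le>
          (\<Sum>F\<in>ksets (2 * v - 2) (all_edges S). of_bool (F \<subseteq> G) :: real)"
      proof (cases "2 * v - 2 \<le> card (all_edges S \<inter> G)")
        case True
        then obtain F where F: "F \<subseteq> all_edges S \<inter> G" "card F = 2 * v - 2"
          using obtain_subset_with_card_n by metis
        then have "of_bool (F \<subseteq> G) \<le> (\<Sum>F\<in>ksets (2 * v - 2) (all_edges S). of_bool (F \<subseteq> G) :: real)"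
          using finS by (intro member_le_sum[of F _ "\<lambda>F. of_bool (F \<subseteq> G)"]) (auto simp: ksets_def)
        then show ?thesis using F True by (simp del: sum_of_bool_eq)
      qed (simp add: sum_nonneg del: sum_of_bool_eq)
    qed
    finally show ?thesis .
  qed
  have "expect (rset (all_edges X) p) (\<lambda>G. real (card (dense_sets X M G))) \<le>
     expect (rset (all_edges X) p)
      (\<lambda>G. \<Sum>v\<in>{4..M}. \<Sum>S\<in>ksets v X. \<Sum>F\<in>ksets (2 * v - 2) (all_edges S). of_bool (F \<subseteq> G))"
    using X by (intro expect_mono bound) auto
  also have "\<dots> = (\<Sum>v\<in>{4..M}. \<Sum>S\<in>ksets v X. \<Sum>F\<in>ksets (2 * v - 2) (all_edges S).
      expect (rset (all_edges X) p) (\<lambda>G. of_bool (F \<subseteq> G)))"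
    using X by (simp only: expect_rset_sum finite_all_edges)
  also have "\<dots> = (\<Sum>v\<in>{4..M}. \<Sum>S\<in>ksets v X. \<Sum>F\<in>ksets (2 * v - 2) (all_edges S). p ^ (2 * v - 2))"
  proof (intro sum.cong refl)
    fix v S F assume "S \<in> ksets v X" "F \<in> ksets (2 * v - 2) (all_edges S)"
    then have "F \<subseteq> all_edges X" "card F = 2 * v - 2"
      using all_edges_mono[of S X] by (auto simp: ksets_def)
    then show "expect (rset (all_edges X) p) (\<lambda>G. of_bool (F \<subseteq> G)) = p ^ (2 * v - 2)"
      using X p by (simp add: expect_rset_supset)
  qed
  also have "\<dots> \<le> (\<Sum>v\<in>{4..M}. real n ^ v * (2 ^ (M\<^sup>2) * p ^ (2 * v - 2)))"
  proof (intro sum_mono)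
    fix v assume v: "v \<in> {4..M}"
    have "(\<Sum>F\<in>ksets (2 * v - 2) (all_edges S). p ^ (2 * v - 2)) \<le> 2 ^ (M\<^sup>2) * p ^ (2 * v - 2)"
      if S: "S \<in> ksets v X" for S
    proof -
      have finS: "finite S" using S X by (auto simp: ksets_def intro: finite_subset)
      have "card (ksets (2 * v - 2) (all_edges S)) \<le> card (Pow (all_edges S))"
        using finS by (intro card_mono) (auto simp: ksets_def)
      also have "\<dots> = 2 ^ (v choose 2)" using S finS by (simp add: card_Pow card_all_edges ksets_def)
      also have "\<dots> \<le> 2 ^ (M\<^sup>2)"
      proof (rule power_increasing)
        have "v choose 2 \<le> v ^ 2" by (rule choose_le_power)
        also have "\<dots> \<le> M ^ 2" using v by (intro power_mono) auto
        finally show "v choose 2 \<le> M\<^sup>2" .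
      qed simp
      finally have "real (card (ksets (2 * v - 2) (all_edges S))) \<le> real (2 ^ (M\<^sup>2))"
        by (rule of_nat_mono)
      then show ?thesis using p by (simp add: mult_right_mono)
    qed
    then have "(\<Sum>S\<in>ksets v X. \<Sum>F\<in>ksets (2 * v - 2) (all_edges S). p ^ (2 * v - 2)) \<le>
       (\<Sum>S\<in>ksets v X. 2 ^ (M\<^sup>2) * p ^ (2 * v - 2))" by (intro sum_mono)
    also have "\<dots> = real (n choose v) * (2 ^ (M\<^sup>2) * p ^ (2 * v - 2))"
      using X by (simp add: card_ksets n_def)
    also have "\<dots> \<le> real n ^ v * (2 ^ (M\<^sup>2) * p ^ (2 * v - 2))"
    proof (rule mult_right_mono)
      show "real (n choose v) \<le> real n ^ v"
        using of_nat_mono[OF choose_le_power[of n v], where ?'a = real] by simp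
    qed (use p in auto)
    finally show "(\<Sum>S\<in>ksets v X. \<Sum>F\<in>ksets (2 * v - 2) (all_edges S). p ^ (2 * v - 2)) \<le>
       real n ^ v * (2 ^ (M\<^sup>2) * p ^ (2 * v - 2))" .
  qed
  also have "\<dots> = (\<Sum>v\<in>{4..M}. real n * (2 ^ (M\<^sup>2) * (real n * p\<^sup>2) ^ (v - 1)))"
  proof (intro sum.cong refl)
    fix v assume "v \<in> {4..M}"
    then obtain k where k: "v = Suc k" by (cases v) auto
    have "p ^ (2 * v - 2) = (p\<^sup>2) ^ k" by (simp add: k power_mult[symmetric])
    then show "real n ^ v * (2 ^ (M\<^sup>2) * p ^ (2 * v - 2)) = real n * (2 ^ (M\<^sup>2) * (real n * p\<^sup>2) ^ (v - 1))"
      by (simp add: k power_mult_distrib)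
  qed
  finally show ?thesis by (simp add: n_def sum_distrib_left)
qed

text \<open>The hypothesis on \<open>K\<close> dominates a codegree above \<open>d\<close> by
  \<open>K\<close> times its squared deviation from the mean, so triangles on edges of large
  codegree cost at most \<open>K\<close> times the total variance.\<close>

lemma expect_good_triangles:
  assumes X: "finite X" and p: "0 \<le> p" "p \<le> 1" and K: "0 \<le> K"
    and Kd: "\<And>x. d < x \<Longrightarrow> real x \<le> K * (real x - real (card X - 2) * p\<^sup>2)\<^sup>2"
  shows "expect (rset (all_edges X) p) (\<lambda>G. real (card (good_triangles X M d G))) \<ge>
    real (card X choose 3) * p ^ 3 - K * real (card X choose 2) * real (card X) * p ^ 3
    - real M ^ 3 * (real (card X) * (\<Sum>v\<in>{4..M}. 2 ^ (M\<^sup>2) * (real (card X) * p\<^sup>2) ^ (v - 1)))"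
proof -
  define E where "E = expect (rset (all_edges X) p)"
  define q where "q = (\<lambda>e G. of_bool (e \<in> G) * (real (card (apexes X G e)) - real (card X - 2) * p\<^sup>2)\<^sup>2)"
  have pt: "real (card (triangles G)) - K * (\<Sum>e\<in>all_edges X. q e G) - real M ^ 3 * real (card (dense_sets X M G))
      \<le> real (card (good_triangles X M d G))" if G: "G \<subseteq> all_edges X" for G
  proof -
    have finG: "finite G" by (rule finite_subset[OF G]) (use X in simp)
    have "real (\<Sum>e\<in>{e \<in> G. d < card (apexes X G e)}. card (apexes X G e)) \<le> (\<Sum>e\<in>{e \<in> G. d < card (apexes X G e)}. K * q e G)"
      unfolding of_nat_sum using Kd by (intro sum_mono) (auto simp: q_def)
    also have "\<dots> \<le> (\<Sum>e\<in>all_edges X. K * q e G)"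
      using X G K by (intro sum_mono2) (auto simp: q_def)
    finally have "real (\<Sum>e\<in>{e \<in> G. d < card (apexes X G e)}. card (apexes X G e)) \<le> K * (\<Sum>e\<in>all_edges X. q e G)"
      by (simp add: sum_distrib_left)
    moreover have "real (card (triangles G)) \<le> real (card (good_triangles X M d G) +
      (\<Sum>e\<in>{e \<in> G. d < card (apexes X G e)}. card (apexes X G e)) + card (dense_sets X M G) * M ^ 3)"
      by (intro of_nat_mono card_triangles_le[OF X G])
    ultimately show ?thesis by (simp add: mult.commute)
  qed
  have "E (\<lambda>G. real (card (triangles G)) - K * (\<Sum>e\<in>all_edges X. q e G) - real M ^ 3 * real (card (dense_sets X M G)))
     \<le> E (\<lambda>G. real (card (good_triangles X M d G)))"
    unfolding E_def using X by (intro expect_mono pt) (auto dest: rset_all_edges)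
  moreover have "E (\<lambda>G. real (card (triangles G)) - K * (\<Sum>e\<in>all_edges X. q e G) - real M ^ 3 * real (card (dense_sets X M G)))
     = E (\<lambda>G. real (card (triangles G))) - K * (\<Sum>e\<in>all_edges X. E (q e)) - real M ^ 3 * E (\<lambda>G. real (card (dense_sets X M G)))"
    unfolding E_def using X by (simp only: expect_rset_diff expect_rset_sum finite_all_edges integral_mult_right_zero)
  moreover have "(\<Sum>e\<in>all_edges X. E (q e)) \<le> (\<Sum>e\<in>all_edges X. real (card X) * p ^ 3)"
    unfolding E_def q_def using X p by (intro sum_mono expect_codegree_variance)
  then have "K * (\<Sum>e\<in>all_edges X. E (q e)) \<le> K * real (card X choose 2) * real (card X) * p ^ 3"
    using mult_left_mono[OF _ K] X by (simp add: card_all_edges mult.assoc)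
  moreover have "real M ^ 3 * E (\<lambda>G. real (card (dense_sets X M G))) \<le>
     real M ^ 3 * (real (card X) * (\<Sum>v\<in>{4..M}. 2 ^ (M\<^sup>2) * (real (card X) * p\<^sup>2) ^ (v - 1)))"
    unfolding E_def using X p by (intro mult_left_mono expect_dense_sets) auto
  ultimately show ?thesis unfolding E_def expect_triangles[OF X p] by linarith
qed

text \<open>Exposure in two rounds: for each graph of density \<open>p\<close> the nibble packs
  triangles within its \<theta>-sample, and the sample is a random graph of density
  \<open>p * \<theta>\<close>. The factor \<open>\<kappa>\<close> is the selection probability of a
  good triangle less the cost of ties.\<close>

lemma expect_nu_ge:
  fixes X :: "'a set"
  assumes X: "finite X" and p: "0 \<le> p" "p \<le> 1"
    and \<theta>: "0 < \<theta>" "\<theta> \<le> 1" and R: "0 < R" and d: "1 \<le> d"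
    and D: "real d + ln (1 + 2 * (D * \<theta>\<^sup>2)) / 2 \<le> D" "0 < D" and M: "4 * R + 11 \<le> M"
  defines "l \<equiv> D * \<theta>\<^sup>2"
  defines "\<kappa> \<equiv> \<theta> ^ 3 / l * (1 - 1 / sqrt (1 + 2 * l)) - 3 * real d * (ln (1 + 2 * l) / 2 / real R * (1 + 2 * l) / l)"
  shows "expect (rset (all_edges X) (p * \<theta>)) (\<lambda>G. real (nu G)) \<ge>
    \<kappa> * expect (rset (all_edges X) p) (\<lambda>G. real (card (good_triangles X M d G)))"
proof -
  have "\<kappa> * expect (rset (all_edges X) p) (\<lambda>G. real (card (good_triangles X M d G))) =
      expect (rset (all_edges X) p) (\<lambda>G. real (card (good_triangles X M d G)) * \<kappa>)"
    by (simp add: mult.commute)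
  also have "\<dots> \<le> expect (rset (all_edges X) p) (\<lambda>G. expect (rset G \<theta>) (\<lambda>G. real (nu G)))"
  proof (rule expect_mono)
    fix G assume "G \<in> set_pmf (rset (all_edges X) p)"
    then have G: "G \<subseteq> all_edges X" "finite G" using X by (auto dest: rset_all_edges)
    interpret nibble "good_triangles X M d G" G R d D \<theta>
      by (rule nibble_good_triangles) (fact X G \<theta> R d D M)+
    have "real (card (good_triangles X M d G)) *
      (\<theta> ^ 3 / lam * (1 - 1 / sqrt (1 + 2 * lam)) - 3 * real d * (h * (1 + 2 * lam) / lam))
      \<le> expect (rset G \<theta>) (\<lambda>G. real (nu G))"
    proof (rule packing_lower_bound)
      fix W C assume WC: "W \<subseteq> G" "C \<subseteq> good_triangles X M d G" "disjoint C" "\<Union>C \<subseteq> W"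
      have finW: "finite W" using WC(1) G(2) by (rule finite_subset)
      have "triangle_packing W C" unfolding triangle_packing_def
      proof
        show "C \<subseteq> triangles W"
        proof
          fix T assume T: "T \<in> C"
          then have "T \<in> triangles G" using WC(2) by (auto simp: good_triangles_def)
          moreover have "T \<subseteq> W" using T WC(4) by blast
          ultimately show "T \<in> triangles W" by (rule triangle_of_subset)
        qed
      qed fact
      then show "real (card C) \<le> real (nu W)" using finW by (simp add: nu_ge)
    qed
    then show "real (card (good_triangles X M d G)) * \<kappa> \<le> expect (rset G \<theta>) (\<lambda>G. real (nu G))"
      unfolding \<kappa>_def l_def h_def S_def lam_def .
  qed (use X in auto)
  also have "\<dots> = expect (rset (all_edges X) (p * \<theta>)) (\<lambda>G. real (nu G))"
    using X p \<theta> by (intro expect_rset_thin) auto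
  finally show ?thesis .
qed

subsection \<open>A cover from a random bipartition\<close>

text \<open>A configuration consists of a side for each vertex and a presence bit for each edge.\<close>

definition cut_nodes :: "'a set \<Rightarrow> ('a + 'a set) set" where
  "cut_nodes X = Inl ` X \<union> Inr ` all_edges X"

definition cut_pmf :: "'a set \<Rightarrow> real \<Rightarrow> ('a + 'a set \<Rightarrow> bool) pmf" where
  "cut_pmf X p = Pi_pmf (cut_nodes X) False (\<lambda>x. case x of Inl v \<Rightarrow> bernoulli_pmf (1/2) | Inr e \<Rightarrow> bernoulli_pmf p)"

definition same_side :: "bool \<Rightarrow> 'a set \<Rightarrow> ('a + 'a set \<Rightarrow> bool) \<Rightarrow> bool" where
  "same_side b s f \<longleftrightarrow> (\<forall>u\<in>s. f (Inl u) = b)"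

definition hit :: "bool \<Rightarrow> 'a set \<Rightarrow> 'a \<Rightarrow> ('a + 'a set \<Rightarrow> bool) \<Rightarrow> bool" where
  "hit b s w f \<longleftrightarrow> f (Inl w) = (\<not> b) \<and> (\<forall>u\<in>s. f (Inr {w, u}))"

definition cut_edges :: "'a set \<Rightarrow> ('a + 'a set \<Rightarrow> bool) \<Rightarrow> 'a set set" where
  "cut_edges X f = {e \<in> all_edges X. \<exists>b. f (Inr e) \<and> same_side b e f \<and> (\<exists>w\<in>X - e. hit b e w f)}"

text \<open>The outer vertex ranges over \<open>X - t\<close>, as the third vertex of
  \<open>t\<close> is on the same side as the others and never hits. The conditions at different
  \<open>w\<close> then depend on disjoint sets of coordinates, all outside
  \<open>t\<close>.\<close>

definition free_triples :: "'a set \<Rightarrow> ('a + 'a set \<Rightarrow> bool) \<Rightarrow> 'a set set" where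
  "free_triples X f = {t \<in> ksets 3 X. \<exists>b. (\<forall>e\<in>all_edges t. f (Inr e)) \<and> same_side b t f \<and>
     (\<forall>w\<in>X - t. \<forall>e\<in>all_edges t. \<not> hit b e w f)}"

text \<open>A triangle meeting both sides has exactly two vertices on one of them, and the third
  vertex makes the edge between these two a cut edge. A triangle within one side has an edge hit
  from outside or is free, and then an edge of its own is added.\<close>

lemma tau_le_cut:
  assumes X: "finite X"
  shows "tau {e \<in> all_edges X. f (Inr e)} \<le> card (cut_edges X f) + card (free_triples X f)"
proof -
  define G where "G = {e \<in> all_edges X. f (Inr e)}"
  define ch where "ch = (\<lambda>t. SOME e. e \<in> all_edges (t :: 'a set))"
  have ch: "ch t \<in> all_edges t" if "t \<in> ksets 3 X" for t
  proof -
    have "card (all_edges t) = 3" using that by (intro card_triangle) (simp add: ksets_def)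
    then have "all_edges t \<noteq> {}" by auto
    then show ?thesis by (simp add: ch_def some_in_eq)
  qed
  define F where "F = cut_edges X f \<union> ch ` free_triples X f"
  have finF: "finite (cut_edges X f)" "finite (free_triples X f)"
    using X by (auto simp: cut_edges_def free_triples_def)
  have "triangle_cover G F"
    unfolding triangle_cover_def
  proof
    show "F \<subseteq> G"
    proof
      fix e assume "e \<in> F"
      then consider "e \<in> cut_edges X f" | t where "t \<in> free_triples X f" "e = ch t" by (auto simp: F_def)
      then show "e \<in> G"
      proof cases
        case 2
        then have "t \<in> ksets 3 X" "e \<in> all_edges t" "\<forall>e\<in>all_edges t. f (Inr e)"
          using ch by (auto simp: free_triples_def)
        moreover from this have "e \<in> all_edges X" using all_edges_mono[of t X] by (auto simp: ksets_def)
        ultimately show ?thesis by (auto simp: G_def)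
      qed (auto simp: cut_edges_def G_def)
    qed
    show "\<forall>T\<in>triangles G. T \<inter> F \<noteq> {}"
    proof
      fix T assume "T \<in> triangles G"
      then obtain t where t: "T = all_edges t" "t \<in> ksets 3 X" "all_edges t \<subseteq> G"
        using triangles_eq_ksets[of G X] unfolding G_def by blast
      have fe: "f (Inr e)" "e \<in> all_edges X" if "e \<in> all_edges t" for e
        using t(3) that by (auto simp: G_def)
      have tX: "t \<subseteq> X" "card t = 3" using t by (auto simp: ksets_def)
      show "T \<inter> F \<noteq> {}"
      proof (cases "\<exists>b. same_side b t f")
        case True
        then obtain b where b: "same_side b t f" by blast
        show ?thesis
        proof (cases "t \<in> free_triples X f")
          case True
          then have "ch t \<in> T \<inter> F" using ch[OF t(2)] t(1) by (auto simp: F_def)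
          then show ?thesis by blast
        next
          case False
          then obtain w e where we: "w \<in> X - t" "e \<in> all_edges t" "hit b e w f"
            using t(2) fe b unfolding free_triples_def by blast
          have "e \<subseteq> t" using we by (auto simp: all_edges_def)
          then have "same_side b e f" "w \<in> X - e" using b we by (auto simp: same_side_def)
          then have "e \<in> cut_edges X f" using we fe by (auto simp: cut_edges_def)
          then show ?thesis using we t by (auto simp: F_def)
        qed
      next
        case False
        obtain x y z where xyz: "t = {x, y, z}" "x \<noteq> y" "y \<noteq> z" "x \<noteq> z"
          using tX(2) unfolding card_3_iff by blast
        have *: "T \<inter> F \<noteq> {}" if "t = {x, y, z}" "x \<noteq> y" "y \<noteq> z" "x \<noteq> z"
          "f (Inl x) = f (Inl y)" "f (Inl z) = (\<not> f (Inl x))" for x y z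
        proof -
          have "{x, y} \<in> all_edges t" "{z, x} \<in> all_edges t" "{z, y} \<in> all_edges t" using that by auto
          moreover have "z \<in> X - {x, y}" using that tX by auto
          moreover have "hit (f (Inl x)) {x, y} z f" using fe calculation that by (auto simp: hit_def)
          moreover have "same_side (f (Inl x)) {x, y} f" using that by (auto simp: same_side_def)
          ultimately have "{x, y} \<in> cut_edges X f" using fe unfolding cut_edges_def by blast
          then show ?thesis using \<open>{x, y} \<in> all_edges t\<close> t by (auto simp: F_def)
        qed
        consider "f (Inl x) = f (Inl y)" "f (Inl z) = (\<not> f (Inl x))"
          | "f (Inl x) = f (Inl z)" "f (Inl y) = (\<not> f (Inl x))"
          | "f (Inl y) = f (Inl z)" "f (Inl x) = (\<not> f (Inl y))"
        proof -
          have "\<not> (f (Inl x) = f (Inl y) \<and> f (Inl z) = f (Inl x))"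
            using False xyz unfolding same_side_def by auto
          then show ?thesis using that by blast
        qed
        then show ?thesis
        proof cases
          case 1
          then show ?thesis using *[of x y z] xyz by auto
        next
          case 2
          then show ?thesis using *[of x z y] xyz by auto
        next
          case 3
          then show ?thesis using *[of y z x] xyz by auto
        qed
      qed
    qed
  qed
  moreover have "finite G" using X by (simp add: G_def)
  ultimately have "tau G \<le> card F" by (intro tau_le)
  also have "\<dots> \<le> card (cut_edges X f) + card (ch ` free_triples X f)"
    unfolding F_def by (rule card_Un_le)
  also have "card (ch ` free_triples X f) \<le> card (free_triples X f)" using finF by (intro card_image_le)
  finally show ?thesis unfolding G_def by simp
qed

lemma cut_pmf_edges:
  assumes "finite X"
  shows "map_pmf (\<lambda>f. {e \<in> all_edges X. f (Inr e)}) (cut_pmf X p) = rset (all_edges X) p"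
proof -
  have fin: "finite (cut_nodes X)" using assms by (simp add: cut_nodes_def)
  have "Pi_pmf (all_edges X) False (\<lambda>_. bernoulli_pmf p) =
      map_pmf (\<lambda>b. b \<circ> Inr) (Pi_pmf (Inr ` all_edges X :: ('a + 'a set) set) False (\<lambda>_. bernoulli_pmf p))"
    using assms by (intro Pi_pmf_bij_betw) (auto simp: bij_betw_def)
  also have "Pi_pmf (Inr ` all_edges X :: ('a + 'a set) set) False (\<lambda>_. bernoulli_pmf p) =
      Pi_pmf (Inr ` all_edges X) False (\<lambda>x. case x of Inl v \<Rightarrow> bernoulli_pmf (1/2) | Inr e \<Rightarrow> bernoulli_pmf p)"
    by (intro Pi_pmf_cong refl) auto
  also have "\<dots> = map_pmf (\<lambda>f x. if x \<in> Inr ` all_edges X then f x else False) (cut_pmf X p)"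
    unfolding cut_pmf_def by (rule Pi_pmf_subset[OF fin]) (auto simp: cut_nodes_def)
  finally show ?thesis
    by (auto simp: rset_def pmf.map_comp o_def intro!: map_pmf_cong)
qed

section \<open>Probabilities for the random bipartition\<close>

context
  fixes X :: "'a set" and p :: real
  assumes X: "finite X" and p: "0 \<le> p" "p \<le> 1"
begin

abbreviation cprob :: "(('a + 'a set \<Rightarrow> bool) \<Rightarrow> bool) \<Rightarrow> real" where
  "cprob P \<equiv> measure_pmf.prob (cut_pmf X p) {f. P f}"

lemma fin_nodes: "finite (cut_nodes X)" using X by (simp add: cut_nodes_def)

lemma cprob_coords:
  assumes "C \<subseteq> cut_nodes X"
  shows "cprob (\<lambda>f. \<forall>i\<in>C. f i = c i) =
    (\<Prod>i\<in>C. pmf (case i of Inl v \<Rightarrow> bernoulli_pmf (1/2) | Inr e \<Rightarrow> bernoulli_pmf p) (c i))"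
proof -
  have finC: "finite C" using assms fin_nodes by (rule finite_subset)
  have "cprob (\<lambda>f. \<forall>i\<in>C. f i = c i) = (\<Prod>i\<in>C. cprob (\<lambda>f. f i = c i))"
    unfolding cut_pmf_def
    by (rule prob_indep[where A = "\<lambda>i. {i}"]) (use fin_nodes finC assms in \<open>auto intro: dep_onI\<close>)
  also have "\<dots> = (\<Prod>i\<in>C. pmf (case i of Inl v \<Rightarrow> bernoulli_pmf (1/2) | Inr e \<Rightarrow> bernoulli_pmf p) (c i))"
    unfolding cut_pmf_def using assms fin_nodes
    by (intro prod.cong refl, subst prob_Pi_component) (auto simp: measure_pmf_single)
  finally show ?thesis .
qed

text \<open>The coordinates that decide whether \<open>w\<close> hits an edge inside
  \<open>s\<close>.\<close>

definition star :: "'a set \<Rightarrow> 'a \<Rightarrow> ('a + 'a set) set" where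
  "star s w = insert (Inl w) ((\<lambda>u. Inr {w, u}) ` s)"

lemma star_subset:
  assumes "s \<subseteq> X" "w \<in> X - s"
  shows "star s w \<subseteq> cut_nodes X"
proof -
  have "{w, u} \<in> all_edges X" if "u \<in> s" for u using assms that by auto
  then show ?thesis using assms(2) unfolding star_def cut_nodes_def by blast
qed

lemma star_disjoint: "w \<notin> s \<Longrightarrow> w' \<notin> s \<Longrightarrow> w \<noteq> w' \<Longrightarrow> star s w \<inter> star s w' = {}"
  by (auto simp: star_def doubleton_eq_iff)

text \<open>Sides and edges within \<open>s\<close> are disjoint from all stars, and stars of
  different outer vertices are disjoint from each other, so the probability factorises;
  \<open>q\<close> belongs to a single outer vertex.\<close>

lemma cprob_base:
  assumes s: "s \<subseteq> X" and Fs: "F \<subseteq> all_edges s"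
    and Q: "\<And>w. w \<in> X - s \<Longrightarrow> dep_on (Q w) (star s w)" "\<And>w. w \<in> X - s \<Longrightarrow> cprob (Q w) = q"
  shows "cprob (\<lambda>f. ((\<forall>e\<in>F. f (Inr e)) \<and> same_side b s f) \<and> (\<forall>w\<in>X - s. Q w f)) =
    p ^ card F * (1 / 2) ^ card s * q ^ (card X - card s)"
proof -
  have fins: "finite s" using s X by (rule finite_subset)
  have finF: "finite F" using Fs fins by (meson finite_all_edges finite_subset)
  define C where "C = Inl ` s \<union> Inr ` F"
  define c where "c = (\<lambda>i :: 'a + 'a set. case i of Inl v \<Rightarrow> b | Inr e \<Rightarrow> True)"
  have FX: "F \<subseteq> all_edges X" using Fs all_edges_mono[OF s] by blast
  have CX: "C \<subseteq> cut_nodes X" using s FX by (auto simp: C_def cut_nodes_def)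
  have base: "(\<forall>e\<in>F. f (Inr e)) \<and> same_side b s f \<longleftrightarrow> (\<forall>i\<in>C. f i = c i)" for f
    by (auto simp: C_def c_def same_side_def)
  have "cprob (\<lambda>f. ((\<forall>e\<in>F. f (Inr e)) \<and> same_side b s f) \<and> (\<forall>w\<in>X - s. Q w f)) =
    cprob (\<lambda>f. (\<forall>e\<in>F. f (Inr e)) \<and> same_side b s f) * cprob (\<lambda>f. \<forall>w\<in>X - s. Q w f)"
    unfolding cut_pmf_def
  proof (rule prob_indep2[where A = C and B = "\<Union>w\<in>X - s. star s w"])
    show "dep_on (\<lambda>f. (\<forall>e\<in>F. f (Inr e)) \<and> same_side b s f) C"
      unfolding base by (intro dep_onI) auto
    show "dep_on (\<lambda>f. \<forall>w\<in>X - s. Q w f) (\<Union>w\<in>X - s. star s w)"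
      by (intro dep_on_all Q)
    show "(\<Union>w\<in>X - s. star s w) \<subseteq> cut_nodes X" using star_subset[OF s] by blast
    show "C \<inter> (\<Union>w\<in>X - s. star s w) = {}"
      using Fs by (auto simp: C_def star_def all_edges_def)
  qed (use CX fin_nodes in auto)
  also have "cprob (\<lambda>f. (\<forall>e\<in>F. f (Inr e)) \<and> same_side b s f) = p ^ card F * (1 / 2) ^ card s"
  proof -
    define g where "g = (\<lambda>i. pmf (case i of Inl v \<Rightarrow> bernoulli_pmf (1/2) | Inr e \<Rightarrow> bernoulli_pmf p) (c i))"
    have "cprob (\<lambda>f. (\<forall>e\<in>F. f (Inr e)) \<and> same_side b s f) = (\<Prod>i\<in>C. g i)"
      unfolding base g_def using CX by (rule cprob_coords)
    also have "\<dots> = (\<Prod>i\<in>Inl ` s. g i) * (\<Prod>i\<in>Inr ` F. g i)"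
      unfolding C_def using fins finF by (intro prod.union_disjoint) auto
    also have "(\<Prod>i\<in>Inl ` s. g i) = (\<Prod>u\<in>s. g (Inl u))" by (subst prod.reindex) auto
    also have "(\<Prod>i\<in>Inr ` F. g i) = (\<Prod>e\<in>F. g (Inr e))" by (subst prod.reindex) auto
    finally show ?thesis using p by (simp add: g_def c_def mult.commute)
  qed
  also have "cprob (\<lambda>f. \<forall>w\<in>X - s. Q w f) = (\<Prod>w\<in>X - s. cprob (Q w))"
    unfolding cut_pmf_def
  proof (rule prob_indep[where A = "star s"])
    show "star s w \<inter> star s w' = {}" if "w \<in> X - s" "w' \<in> X - s" "w \<noteq> w'" for w w'
      using that by (intro star_disjoint) auto
  qed (use fin_nodes X Q star_subset[OF s] in auto)
  also have "\<dots> = q ^ (card X - card s)"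
    using Q(2) s fins by (simp add: card_Diff_subset)
  finally show ?thesis .
qed

lemma cprob_not: "cprob (\<lambda>f. \<not> P f) = 1 - cprob P"
proof -
  have "{f. \<not> P f} = UNIV - {f. P f}" by auto
  then show ?thesis using measure_pmf.prob_compl[of "{f. P f}" "cut_pmf X p"] by simp
qed

lemma cprob_star:
  assumes s: "s \<subseteq> X" "w \<in> X - s" "P \<subseteq> s"
  shows "cprob (\<lambda>f. f (Inl w) = b \<and> (\<forall>u\<in>s. f (Inr {w, u}) = (u \<in> P))) =
    1 / 2 * p ^ card P * (1 - p) ^ (card s - card P)"
proof -
  have fins: "finite s" using s(1) X by (rule finite_subset)
  then have finP: "finite P" using s(3) finite_subset by blast
  define c where "c = (\<lambda>i :: 'a + 'a set. case i of Inl v \<Rightarrow> b | Inr e \<Rightarrow> e \<inter> P \<noteq> {})"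
  have wP: "w \<notin> P" using s by auto
  have inj: "inj_on (\<lambda>u. Inr {w, u} :: 'a + 'a set) A" for A by (auto simp: inj_on_def doubleton_eq_iff)
  have "cprob (\<lambda>f. f (Inl w) = b \<and> (\<forall>u\<in>s. f (Inr {w, u}) = (u \<in> P))) = cprob (\<lambda>f. \<forall>i\<in>star s w. f i = c i)"
    using wP by (simp add: star_def c_def)
  also have "\<dots> = (\<Prod>i\<in>star s w. pmf (case i of Inl v \<Rightarrow> bernoulli_pmf (1/2) | Inr e \<Rightarrow> bernoulli_pmf p) (c i))"
    using s by (intro cprob_coords star_subset)
  also have "\<dots> = 1 / 2 * (\<Prod>u\<in>s. pmf (bernoulli_pmf p) (u \<in> P))"
    unfolding star_def using fins wP by (subst prod.insert) (auto simp: c_def prod.reindex[OF inj] )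
  also have "(\<Prod>u\<in>s. pmf (bernoulli_pmf p) (u \<in> P)) = (\<Prod>u\<in>P. p) * (\<Prod>u\<in>s - P. 1 - p)"
  proof -
    have "(\<Prod>u\<in>s. pmf (bernoulli_pmf p) (u \<in> P)) =
      (\<Prod>u\<in>P. pmf (bernoulli_pmf p) (u \<in> P)) * (\<Prod>u\<in>s - P. pmf (bernoulli_pmf p) (u \<in> P))"
      by (subst prod.subset_diff[OF s(3) fins]) (rule mult.commute)
    also have "(\<Prod>u\<in>P. pmf (bernoulli_pmf p) (u \<in> P)) = (\<Prod>u\<in>P. p)"
      using p by (intro prod.cong) auto
    also have "(\<Prod>u\<in>s - P. pmf (bernoulli_pmf p) (u \<in> P)) = (\<Prod>u\<in>s - P. 1 - p)"
      using p by (intro prod.cong) auto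
    finally show ?thesis .
  qed
  finally show ?thesis using s finP by (simp add: card_Diff_subset)
qed

text \<open>An outer vertex is on the opposite side and joined to both ends with probability
  \<open>p\<^sup>2 / 2\<close>. The two possible sides of \<open>e\<close> contribute
  \<open>p / 4\<close> each.\<close>

lemma prob_cut_edge:
  assumes e: "e \<in> all_edges X"
  shows "cprob (\<lambda>f. e \<in> cut_edges X f) = p / 2 * (1 - (1 - p\<^sup>2 / 2) ^ (card X - 2))"
proof -
  have eX: "e \<subseteq> X" "card e = 2" using e by (auto simp: all_edges_def)
  have ne: "e \<noteq> {}" using eX by auto
  define A where "A = (\<lambda>b f. (\<forall>e'\<in>{e}. f (Inr e')) \<and> same_side b e f)"
  have "cprob (\<lambda>f. e \<in> cut_edges X f) = cprob (\<lambda>f. \<exists>b\<in>UNIV. A b f \<and> (\<exists>w\<in>X - e. hit b e w f))"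
    using e by (intro arg_cong[of _ _ "measure_pmf.prob _"]) (auto simp: cut_edges_def A_def)
  also have "\<dots> = (\<Sum>b\<in>UNIV. cprob (\<lambda>f. A b f \<and> (\<exists>w\<in>X - e. hit b e w f)))"
    using ne by (intro prob_exclusive) (auto simp: A_def same_side_def)
  also have "\<dots> = (\<Sum>b\<in>(UNIV :: bool set). p / 4 * (1 - (1 - p\<^sup>2 / 2) ^ (card X - 2)))"
  proof (intro sum.cong refl)
    fix b :: bool
    have Q: "cprob (hit b e w) = p\<^sup>2 / 2" "dep_on (\<lambda>f. \<not> hit b e w f) (star e w)" if "w \<in> X - e" for w
    proof -
      have "cprob (hit b e w) = cprob (\<lambda>f. f (Inl w) = (\<not> b) \<and> (\<forall>u\<in>e. f (Inr {w, u}) = (u \<in> e)))"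
        by (intro arg_cong[of _ _ "measure_pmf.prob _"]) (auto simp: hit_def)
      then show "cprob (hit b e w) = p\<^sup>2 / 2" using cprob_star[OF eX(1) that, of e "\<not> b"] eX by simp
      show "dep_on (\<lambda>f. \<not> hit b e w f) (star e w)"
        by (intro dep_onI) (auto simp: hit_def star_def)
    qed
    have 1: "cprob (\<lambda>f. A b f \<and> (\<forall>w\<in>X - e. \<not> hit b e w f)) = p ^ 1 * (1 / 2) ^ 2 * (1 - p\<^sup>2 / 2) ^ (card X - 2)"
      unfolding A_def using Q eX cprob_base[of e "{e}" "\<lambda>w f. \<not> hit b e w f" "1 - p\<^sup>2 / 2" b]
      by (simp add: cprob_not all_edges_def)
    \<comment> \<open>A vacuous condition at the outer vertices gives the probability of
      \<open>A b\<close> itself, from which the case without a hit is subtracted.\<close>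
    have 2: "cprob (\<lambda>f. A b f \<and> (\<forall>w\<in>X - e. True)) = p ^ 1 * (1 / 2) ^ 2 * 1 ^ (card X - 2)"
      unfolding A_def using eX cprob_base[of e "{e}" "\<lambda>w f. True" 1 b]
      by (simp add: all_edges_def dep_on_def)
    have "cprob (\<lambda>f. A b f) = cprob (\<lambda>f. A b f \<and> (\<exists>w\<in>X - e. hit b e w f)) + cprob (\<lambda>f. A b f \<and> (\<forall>w\<in>X - e. \<not> hit b e w f))"
    proof -
      have "{f. A b f} = {f. A b f \<and> (\<exists>w\<in>X - e. hit b e w f)} \<union> {f. A b f \<and> (\<forall>w\<in>X - e. \<not> hit b e w f)}" by blast
      then show ?thesis by (simp only:) (intro measure_pmf.finite_measure_Union; auto)
    qed
    then show "cprob (\<lambda>f. A b f \<and> (\<exists>w\<in>X - e. hit b e w f)) = p / 4 * (1 - (1 - p\<^sup>2 / 2) ^ (card X - 2))"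
      using 1 2 by (simp add: algebra_simps power2_eq_square)
  qed
  finally show ?thesis by (simp add: UNIV_bool)
qed

text \<open>An outer vertex hits an edge of \<open>t\<close> if it is on the opposite side and sees
  at least two of the three vertices, which has probability
  \<open>(3 * p\<^sup>2 * (1 - p) + p ^ 3) / 2\<close>. Prescribing its exact neighbourhood
  \<open>P\<close> in \<open>t\<close> makes the cases exclusive.\<close>

lemma prob_free_triple:
  assumes t: "t \<in> ksets 3 X"
  shows "cprob (\<lambda>f. t \<in> free_triples X f) \<le> p ^ 3 / 4 * (1 - (3 * p\<^sup>2 - 2 * p ^ 3) / 2) ^ (card X - 3)"
proof -
  have tX: "t \<subseteq> X" "card t = 3" using t by (auto simp: ksets_def)
  have ne: "t \<noteq> {}" using tX by auto
  have fint: "finite t" using tX by (simp add: card_ge_0_finite)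
  define A where "A = (\<lambda>b f. (\<forall>e\<in>all_edges t. f (Inr e)) \<and> same_side b t f)"
  define J where "J = ksets 2 t \<union> ksets 3 t"
  define H where "H = (\<lambda>b w f. \<exists>P\<in>J. f (Inl w) = (\<not> b) \<and> (\<forall>u\<in>t. f (Inr {w, u}) = (u \<in> P)))"
  have H_hit: "\<exists>e\<in>all_edges t. hit b e w f" if "H b w f" for b w f
  proof -
    obtain P where P: "P \<in> J" "f (Inl w) = (\<not> b)" "\<forall>u\<in>t. f (Inr {w, u}) = (u \<in> P)"
      using \<open>H b w f\<close> unfolding H_def by blast
    then have "P \<subseteq> t" "2 \<le> card P" by (auto simp: J_def ksets_def)
    then obtain e where e: "e \<subseteq> P" "card e = 2" using obtain_subset_with_card_n by metis
    then have "e \<in> all_edges t" using \<open>P \<subseteq> t\<close> by (auto simp: all_edges_def)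
    moreover have "hit b e w f" using e P \<open>P \<subseteq> t\<close> unfolding hit_def by blast
    ultimately show ?thesis by blast
  qed
  have pH: "cprob (H b w) = (3 * p\<^sup>2 - 2 * p ^ 3) / 2" if w: "w \<in> X - t" for b w
  proof -
    have "cprob (H b w) = (\<Sum>P\<in>J. cprob (\<lambda>f. f (Inl w) = (\<not> b) \<and> (\<forall>u\<in>t. f (Inr {w, u}) = (u \<in> P))))"
      unfolding H_def
    proof (rule prob_exclusive)
      show "finite J" using fint by (simp add: J_def)
      fix P P' :: "'a set" and f :: "'a + 'a set \<Rightarrow> bool"
      assume "P \<in> J" "P' \<in> J" "f (Inl w) = (\<not> b) \<and> (\<forall>u\<in>t. f (Inr {w, u}) = (u \<in> P))"
        "f (Inl w) = (\<not> b) \<and> (\<forall>u\<in>t. f (Inr {w, u}) = (u \<in> P'))"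
      moreover from this have "P \<subseteq> t" "P' \<subseteq> t" by (auto simp: J_def ksets_def)
      ultimately show "P = P'" by blast
    qed
    also have "\<dots> = (\<Sum>P\<in>J. 1 / 2 * p ^ card P * (1 - p) ^ (3 - card P))"
      using cprob_star[OF tX(1) w] tX by (intro sum.cong refl) (auto simp: J_def ksets_def)
    also have "\<dots> = (\<Sum>P\<in>ksets 2 t. 1 / 2 * p ^ card P * (1 - p) ^ (3 - card P)) +
       (\<Sum>P\<in>ksets 3 t. 1 / 2 * p ^ card P * (1 - p) ^ (3 - card P))"
      unfolding J_def using fint by (intro sum.union_disjoint) (auto simp: ksets_def)
    also have "(\<Sum>P\<in>ksets 2 t. 1 / 2 * p ^ card P * (1 - p) ^ (3 - card P)) = (\<Sum>P\<in>ksets 2 t. 1 / 2 * p\<^sup>2 * (1 - p))"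
      by (intro sum.cong) (auto simp: ksets_def)
    also have "(\<Sum>P\<in>ksets 3 t. 1 / 2 * p ^ card P * (1 - p) ^ (3 - card P)) = (\<Sum>P\<in>ksets 3 t. 1 / 2 * p ^ 3)"
      by (intro sum.cong) (auto simp: ksets_def)
    finally show ?thesis using fint tX
      by (simp add: card_ksets field_simps power3_eq_cube power2_eq_square choose_two)
  qed
  have dH: "dep_on (\<lambda>f. \<not> H b w f) (star t w)" for b w
  proof (rule dep_on_not, rule dep_onI)
    fix f g :: "'a + 'a set \<Rightarrow> bool" assume fg: "\<And>x. x \<in> star t w \<Longrightarrow> f x = g x"
    then have "f (Inl w) = g (Inl w)" "\<And>u. u \<in> t \<Longrightarrow> f (Inr {w, u}) = g (Inr {w, u})" by (auto simp: star_def)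
    then show "H b w f = H b w g" unfolding H_def by (intro bex_cong refl) auto
  qed
  have "cprob (\<lambda>f. t \<in> free_triples X f) \<le> cprob (\<lambda>f. \<exists>b\<in>UNIV. A b f \<and> (\<forall>w\<in>X - t. \<not> H b w f))"
    using H_hit by (intro measure_pmf.finite_measure_mono) (fastforce simp: free_triples_def A_def)+
  also have "\<dots> = (\<Sum>b\<in>UNIV. cprob (\<lambda>f. A b f \<and> (\<forall>w\<in>X - t. \<not> H b w f)))"
    using ne by (intro prob_exclusive) (auto simp: A_def same_side_def)
  also have "\<dots> = (\<Sum>b\<in>(UNIV :: bool set). p ^ 3 * (1 / 2) ^ 3 * (1 - (3 * p\<^sup>2 - 2 * p ^ 3) / 2) ^ (card X - 3))"
    unfolding A_def using cprob_base[OF tX(1) order_refl, of "\<lambda>w f. \<not> H b w f" for b] dH pH tX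
    by (intro sum.cong refl) (simp add: cprob_not card_triangle)
  finally show ?thesis by (simp add: UNIV_bool power3_eq_cube)
qed

lemma expect_tau_le:
  "expect (rset (all_edges X) p) (\<lambda>G. real (tau G)) \<le>
    real (card X choose 2) * (p / 2 * (1 - (1 - p\<^sup>2 / 2) ^ (card X - 2))) +
    real (card X choose 3) * (p ^ 3 / 4 * (1 - (3 * p\<^sup>2 - 2 * p ^ 3) / 2) ^ (card X - 3))"
proof -
  have fin: "finite (set_pmf (cut_pmf X p))"
    unfolding cut_pmf_def using fin_nodes
    by (intro finite_subset[OF set_Pi_pmf_subset'[OF fin_nodes]] finite_PiE_dflt) auto
  note [simp] = integrable_measure_pmf_finite[OF fin]
  have "expect (rset (all_edges X) p) (\<lambda>G. real (tau G)) =
     expect (cut_pmf X p) (\<lambda>f. real (tau {e \<in> all_edges X. f (Inr e)}))"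
    unfolding cut_pmf_edges[OF X, symmetric] by simp
  also have "\<dots> \<le> expect (cut_pmf X p) (\<lambda>f. (\<Sum>e\<in>all_edges X. of_bool (e \<in> cut_edges X f)) +
     (\<Sum>t\<in>ksets 3 X. of_bool (t \<in> free_triples X f)))"
  proof (rule expect_mono[OF fin])
    fix f
    have "(\<Sum>e\<in>all_edges X. of_bool (e \<in> cut_edges X f) :: real) = real (card (cut_edges X f))"
      using X by (simp add: of_bool_def sum.If_cases) (simp add: cut_edges_def Int_def)
    moreover have "(\<Sum>t\<in>ksets 3 X. of_bool (t \<in> free_triples X f) :: real) = real (card (free_triples X f))"
      using X by (simp add: of_bool_def sum.If_cases) (simp add: free_triples_def Int_def)
    ultimately show "real (tau {e \<in> all_edges X. f (Inr e)}) \<le> (\<Sum>e\<in>all_edges X. of_bool (e \<in> cut_edges X f)) +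
       (\<Sum>t\<in>ksets 3 X. of_bool (t \<in> free_triples X f))"
      using of_nat_mono[OF tau_le_cut[OF X, of f], where ?'a = real] by simp
  qed
  also have "\<dots> = (\<Sum>e\<in>all_edges X. cprob (\<lambda>f. e \<in> cut_edges X f)) + (\<Sum>t\<in>ksets 3 X. cprob (\<lambda>f. t \<in> free_triples X f))"
    by (simp add: Bochner_Integration.integral_sum expect_of_bool[symmetric] del: sum_of_bool_eq)
  also have "\<dots> \<le> (\<Sum>e\<in>all_edges X. p / 2 * (1 - (1 - p\<^sup>2 / 2) ^ (card X - 2))) +
      (\<Sum>t\<in>ksets 3 X. p ^ 3 / 4 * (1 - (3 * p\<^sup>2 - 2 * p ^ 3) / 2) ^ (card X - 3))"
    by (intro add_mono sum_mono prob_free_triple) (simp add: prob_cut_edge)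
  finally show ?thesis using X by (simp add: card_all_edges card_ksets)
qed

end

subsection \<open>The packing number for constant average codegree\<close>

lemma choose2_real: "real (n choose 2) = real n * (real n - 1) / 2"
proof (induction n)
  case (Suc n)
  have "Suc n choose 2 = n + (n choose 2)"
    unfolding numeral_2_eq_2 by simp
  then have "real (Suc n choose 2) = real n + real (n choose 2)" by simp
  then show ?case unfolding Suc.IH by (simp add: field_simps)
qed auto

lemma choose3_real: "real (n choose 3) = real n * (real n - 1) * (real n - 2) / 6"
proof (induction n)
  case (Suc n)
  have "Suc n choose 3 = (n choose 2) + (n choose 3)"
    unfolding numeral_3_eq_3 numeral_2_eq_2 by simp
  then have "real (Suc n choose 3) = real (n choose 2) + real (n choose 3)" by simp
  then show ?case unfolding Suc.IH choose2_real by (simp add: field_simps)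
qed auto

abbreviation gnp :: "nat \<Rightarrow> real \<Rightarrow> nat set set pmf" where
  "gnp n p \<equiv> rset (all_edges {1..n}) p"

definition Enu :: "nat \<Rightarrow> real \<Rightarrow> real" where "Enu n p = expect (gnp n p) (\<lambda>G. real (nu G))"
definition Etau :: "nat \<Rightarrow> real \<Rightarrow> real" where "Etau n p = expect (gnp n p) (\<lambda>G. real (tau G))"

text \<open>The fraction of the triangles of the thinned graph that the nibble packs when the
  average codegree after thinning is about \<open>l\<close>.\<close>

definition packing_rate :: "real \<Rightarrow> real" where
  "packing_rate l = (1 - 1 / sqrt (1 + 2 * l)) / l"

text \<open>Three parameters are free: \<theta> for the thinning, \<epsilon> for the tolerated
  excess of codegrees, \<open>R\<close> for the number of time steps. In the last hypothesis
  \<open>1 / 6\<close> counts triangles and \<open>K / 2\<close> is the loss to edges of large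
  codegree; the loss to dense sets vanishes as \<open>n\<close> grows.\<close>

lemma nu_liminf_params:
  fixes l\<^sub>0 \<theta> \<epsilon> L' :: real and d R :: nat
  assumes l0: "0 < l\<^sub>0" and \<theta>: "0 < \<theta>" "\<theta> \<le> 1" and R: "0 < R" and \<epsilon>: "0 < \<epsilon>" "\<epsilon> \<le> 1"
    and d: "(1 + \<epsilon>) * (l\<^sub>0 / \<theta>\<^sup>2) \<le> real d" "real d \<le> (1 + \<epsilon>) * (l\<^sub>0 / \<theta>\<^sup>2) + 1" "1 \<le> d"
  defines "l \<equiv> (real d + (1 + 2 * l\<^sub>0)) * \<theta>\<^sup>2"
  defines "\<kappa> \<equiv> \<theta> ^ 3 * packing_rate l - 3 * real d * (ln (1 + 2 * l) / 2 / real R * (1 + 2 * l) / l)"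
  defines "K \<equiv> (1 + \<epsilon>) / (\<epsilon>\<^sup>2 * (l\<^sub>0 / \<theta>\<^sup>2))"
  assumes \<kappa>: "0 < \<kappa>"
    and L': "L' < \<kappa> * (l\<^sub>0 * sqrt l\<^sub>0 / \<theta> ^ 3) * (1 / 6 - K / 2)"
  shows "eventually (\<lambda>n. Enu n (sqrt (l\<^sub>0 / real n)) \<ge> L' * (real n * sqrt (real n))) sequentially"
proof -
  define m where "m = l\<^sub>0 / \<theta>\<^sup>2"
  define M where "M = 4 * R + 11"
  define c where "c = (\<Sum>v\<in>{4..M}. 2 ^ (M\<^sup>2) * m ^ (v - 1))"
  define A where "A = l\<^sub>0 * sqrt l\<^sub>0 / \<theta> ^ 3"
  have m: "0 < m" using l0 \<theta> by (simp add: m_def)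
  have K: "0 \<le> K" using \<epsilon> m by (simp add: K_def m_def[symmetric])
  \<comment> \<open>The summand \<open>1 + 2 * l\<^sub>0\<close>, called \<open>y\<close> below, is
    at least the required logarithm: the upper bound on \<open>d\<close> gives
    \<open>D * \<theta>\<^sup>2 \<le> 2 * y\<close>, and
    \<open>1 + 4 * y \<le> exp (2 * y)\<close>.\<close>
  define D where "D = real d + (1 + 2 * l\<^sub>0)"
  have D0: "0 < D" using l0 by (simp add: D_def)
  have Dd: "real d + ln (1 + 2 * (D * \<theta>\<^sup>2)) / 2 \<le> D"
  proof -
    define y where "y = 1 + 2 * l\<^sub>0"
    have "\<theta>\<^sup>2 \<le> 1" using \<theta> by (simp add: power_le_one)
    have "real d * \<theta>\<^sup>2 \<le> ((1 + \<epsilon>) * (l\<^sub>0 / \<theta>\<^sup>2) + 1) * \<theta>\<^sup>2"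
      using d(2) by (rule mult_right_mono) simp
    also have "\<dots> = (1 + \<epsilon>) * l\<^sub>0 + \<theta>\<^sup>2" using \<theta> by (simp add: field_simps)
    also have "\<dots> \<le> 2 * l\<^sub>0 + 1" using \<epsilon> l0 \<open>\<theta>\<^sup>2 \<le> 1\<close> by (intro add_mono mult_right_mono) auto
    finally have 1: "real d * \<theta>\<^sup>2 \<le> y" by (simp add: y_def)
    have 2: "y * \<theta>\<^sup>2 \<le> y" using \<open>\<theta>\<^sup>2 \<le> 1\<close> l0 by (intro mult_left_le) (auto simp: y_def)
    have "1 + 2 * (D * \<theta>\<^sup>2) \<le> 1 + 4 * y"
    proof -
      have "D * \<theta>\<^sup>2 = real d * \<theta>\<^sup>2 + y * \<theta>\<^sup>2" by (simp add: D_def y_def distrib_right)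
      then show ?thesis using 1 2 by linarith
    qed
    also have "\<dots> \<le> 1 + 2 * y + (2 * y)\<^sup>2 / 2"
    proof -
      have "y * 1 \<le> y * y" using l0 by (intro mult_left_mono) (auto simp: y_def)
      then show ?thesis by (simp add: power2_eq_square)
    qed
    also have "\<dots> \<le> exp (2 * y)" using l0 by (intro exp_lower_Taylor_quadratic) (auto simp: y_def)
    finally have "ln (1 + 2 * (D * \<theta>\<^sup>2)) \<le> ln (exp (2 * y))"
      using D0 by (subst ln_le_cancel_iff) (auto intro: add_pos_nonneg)
    then show ?thesis by (simp add: D_def y_def)
  qed
  \<comment> \<open>For \<open>x \<ge> (1 + \<epsilon>) * m\<close> the deviation is at least
    \<open>\<epsilon> * x / (1 + \<epsilon>)\<close> and at least \<open>\<epsilon> * m\<close>; the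
    product of these lower bounds is \<open>x / K\<close>.\<close>
  have Kd: "real x \<le> K * (real x - real (n - 2) * p\<^sup>2)\<^sup>2"
    if "d < x" "real n * p\<^sup>2 = m" for x n p
  proof -
    have x: "(1 + \<epsilon>) * m \<le> real x" using that d(1) by (simp add: m_def)
    have "real (n - 2) * p\<^sup>2 \<le> m" using that(2) by (metis diff_le_self mult_right_mono of_nat_mono zero_le_power2)
    then have ge: "real x - m \<le> real x - real (n - 2) * p\<^sup>2" by simp
    have 1: "\<epsilon> * real x / (1 + \<epsilon>) \<le> real x - m" using x \<epsilon> by (simp add: field_simps)
    have 2: "\<epsilon> * m \<le> real x - m" using x by (simp add: algebra_simps)
    have "0 < \<epsilon> * m" using \<epsilon> m by simp
    then have 0: "0 \<le> real x - m" using 2 by linarith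
    have "\<epsilon> * real x / (1 + \<epsilon>) * (\<epsilon> * m) \<le> (real x - m) * (real x - m)"
      using 1 2 0 \<epsilon> m by (intro mult_mono) auto
    also have "\<dots> = (real x - m)\<^sup>2" by (simp add: power2_eq_square)
    also have "\<dots> \<le> (real x - real (n - 2) * p\<^sup>2)\<^sup>2" using ge 0 by (intro power_mono)
    finally have "K * (\<epsilon> * real x / (1 + \<epsilon>) * (\<epsilon> * m)) \<le> K * (real x - real (n - 2) * p\<^sup>2)\<^sup>2"
      using K by (rule mult_left_mono)
    moreover have "K * (\<epsilon> * real x / (1 + \<epsilon>) * (\<epsilon> * m)) = real x"
    proof -
      have "K = (1 + \<epsilon>) / (\<epsilon>\<^sup>2 * m)" by (simp add: K_def m_def)
      then show ?thesis using \<epsilon> m by (simp add: power2_eq_square)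
    qed
    ultimately show ?thesis by simp
  qed
  define r where "r = (\<lambda>n. \<kappa> * ((1 - 1 / real n) * (1 - 2 / real n) / 6 * A - K * ((1 - 1 / real n) / 2) * A
    - real M ^ 3 * c / sqrt (real n)))"
  have bound: "r n * (real n * sqrt (real n)) \<le> Enu n (sqrt (l\<^sub>0 / real n))" if n: "n > 0" "real n \<ge> m" for n
  proof -
    define p where "p = sqrt (l\<^sub>0 / real n) / \<theta>"
    have p0: "0 \<le> p" using l0 \<theta> by (simp add: p_def)
    have np: "real n * p\<^sup>2 = m" using n l0 \<theta> by (simp add: p_def m_def power_divide)
    have p1: "p \<le> 1"
    proof -
      have "p\<^sup>2 = m / real n" using np n by (simp add: field_simps)
      also have "\<dots> \<le> 1" using n by simp
      finally have "p\<^sup>2 \<le> 1\<^sup>2" by simp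
      then show ?thesis by (rule power2_le_imp_le) simp
    qed
    have p3: "p ^ 3 * (real n * sqrt (real n)) = A"
    proof -
      have "p ^ 3 * (real n * sqrt (real n)) = (real n * p\<^sup>2) * (p * sqrt (real n))"
        by (simp add: power3_eq_cube power2_eq_square)
      also have "p * sqrt (real n) = sqrt l\<^sub>0 / \<theta>" using n by (simp add: p_def real_sqrt_divide)
      finally show ?thesis unfolding np by (simp add: m_def A_def power3_eq_cube power2_eq_square)
    qed
    define Q where "Q = real n * sqrt (real n)"
    have Q: "Q > 0" "Q * Q = real n ^ 3" using n by (auto simp: Q_def power3_eq_cube)
    have pQ: "p ^ 3 = A / Q" using p3 Q by (simp add: Q_def[symmetric] field_simps)
    have eq: "(1 - 1 / real n) * (1 - 2 / real n) / 6 * A * Q = real (n choose 3) * p ^ 3"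
      "K * ((1 - 1 / real n) / 2) * A * Q = K * real (n choose 2) * real n * p ^ 3"
      "real M ^ 3 * c / sqrt (real n) * Q = real M ^ 3 * (real n * c)"
    proof -
      have "real (n choose 3) * p ^ 3 = (1 - 1 / real n) * (1 - 2 / real n) / 6 * A * (real n ^ 3 / Q)"
        unfolding choose3_real pQ using n Q(1) by (simp add: field_simps power3_eq_cube)
      also have "real n ^ 3 / Q = Q" using Q by (simp add: field_simps)
      finally show "(1 - 1 / real n) * (1 - 2 / real n) / 6 * A * Q = real (n choose 3) * p ^ 3" by simp
      have "K * real (n choose 2) * real n * p ^ 3 = K * ((1 - 1 / real n) / 2) * A * (real n ^ 3 / Q)"
        unfolding choose2_real pQ using n Q(1) by (simp add: field_simps power3_eq_cube)
      also have "real n ^ 3 / Q = Q" using Q by (simp add: field_simps)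
      finally show "K * ((1 - 1 / real n) / 2) * A * Q = K * real (n choose 2) * real n * p ^ 3" by (rule sym)
      show "real M ^ 3 * c / sqrt (real n) * Q = real M ^ 3 * (real n * c)" using n by (simp add: Q_def)
    qed
    have "r n * Q = \<kappa> * (real (n choose 3) * p ^ 3 - K * real (n choose 2) * real n * p ^ 3 - real M ^ 3 * (real n * c))"
    proof -
      have "\<kappa> * (x - y - z) * Q = \<kappa> * (x * Q - y * Q - z * Q)" for x y z by (simp add: algebra_simps)
      then show ?thesis unfolding r_def by (simp only: eq)
    qed
    also have "\<dots> \<le> \<kappa> * expect (gnp n p) (\<lambda>G. real (card (good_triangles {1..n} M d G)))"
      using expect_good_triangles[of "{1..n}" p K d M] p0 p1 K Kd[OF _ np] \<kappa>
      by (intro mult_left_mono) (auto simp: np c_def)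
    also have "\<dots> \<le> expect (gnp n (p * \<theta>)) (\<lambda>G. real (nu G))"
      using expect_nu_ge[of "{1..n}" p \<theta> R d D M] p0 p1 \<theta> R d D0 Dd
      by (simp add: M_def \<kappa>_def l_def D_def packing_rate_def)
    also have "p * \<theta> = sqrt (l\<^sub>0 / real n)" using \<theta> by (simp add: p_def)
    finally show ?thesis by (simp add: Q_def Enu_def)
  qed
  have "r \<longlonglongrightarrow> \<kappa> * ((1 - 0) * (1 - 0) / 6 * A - K * ((1 - 0) / 2) * A - 0)"
  proof -
    have 1: "(\<lambda>n. 1 - 1 / real n) \<longlonglongrightarrow> 1 - 0" by real_asymp
    have 2: "(\<lambda>n. 1 - 2 / real n) \<longlonglongrightarrow> 1 - 0" by real_asymp
    have "(\<lambda>n. 1 / sqrt (real n)) \<longlonglongrightarrow> 0" by real_asymp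
    then have "(\<lambda>n. real M ^ 3 * c * (1 / sqrt (real n))) \<longlonglongrightarrow> real M ^ 3 * c * 0"
      by (rule tendsto_mult_left)
    then have 3: "(\<lambda>n. real M ^ 3 * c / sqrt (real n)) \<longlonglongrightarrow> 0" by simp
    show ?thesis unfolding r_def by (intro tendsto_mult tendsto_diff tendsto_divide tendsto_const 1 2 3) auto
  qed
  also have "\<kappa> * ((1 - 0) * (1 - 0) / 6 * A - K * ((1 - 0) / 2) * A - 0) = \<kappa> * A * (1 / 6 - K / 2)"
    by (simp add: algebra_simps)
  finally have "eventually (\<lambda>n. r n > L') sequentially"
    using L' unfolding A_def[symmetric] by (rule order_tendstoD)
  moreover have "eventually (\<lambda>n. real n \<ge> m) sequentially" by real_asymp
  moreover have "eventually (\<lambda>n. n > 0) sequentially" by (rule eventually_gt_at_top)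
  ultimately show ?thesis
  proof eventually_elim
    case (elim n)
    have "L' * (real n * sqrt (real n)) \<le> r n * (real n * sqrt (real n))"
      using elim by (intro mult_right_mono) auto
    also have "\<dots> \<le> Enu n (sqrt (l\<^sub>0 / real n))" using elim by (intro bound)
    finally show ?case .
  qed
qed

text \<open>The parameters are \<epsilon> = 1/k and \<theta> = 1/k^2. The denser graph has mean
  codegree \<open>l\<^sub>0 * k ^ 4\<close>, large enough for \<open>K\<close> to vanish in the
  limit, while \<open>l\<close> tends to \<open>l\<^sub>0\<close>. \<open>R\<close> is chosen after
  \<open>k\<close>, because the cost of ties is of order \<open>d / R\<close>.\<close>

lemma nu_liminf:
  assumes l0: "0 < l\<^sub>0" and a: "a < sqrt l\<^sub>0 / 6 * (1 - 1 / sqrt (1 + 2 * l\<^sub>0))"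
  shows "eventually (\<lambda>n. Enu n (sqrt (l\<^sub>0 / real n)) \<ge> a * (real n * sqrt (real n))) sequentially"
proof -
  define A where "A = l\<^sub>0 * sqrt l\<^sub>0"
  have A: "A > 0" using l0 by (simp add: A_def)
  have aF: "a < packing_rate l\<^sub>0 * A * (1 / 6 - 0 / 2)" using a l0 by (simp add: packing_rate_def A_def mult.commute)
  define d where "d = (\<lambda>k. nat \<lceil>(1 + 1 / real k) * (l\<^sub>0 * real k ^ 4)\<rceil>)"
  define l where "l = (\<lambda>k. (real (d k) + (1 + 2 * l\<^sub>0)) * (1 / real k ^ 2)\<^sup>2)"
  define K where "K = (\<lambda>k. (1 + 1 / real k) / ((1 / real k)\<^sup>2 * (l\<^sub>0 / (1 / real k ^ 2)\<^sup>2)))"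
  have d: "(1 + 1 / real k) * (l\<^sub>0 * real k ^ 4) \<le> real (d k)" "real (d k) \<le> (1 + 1 / real k) * (l\<^sub>0 * real k ^ 4) + 1" for k
  proof -
    have "0 \<le> (1 + 1 / real k) * (l\<^sub>0 * real k ^ 4)" using l0 by simp
    then show "(1 + 1 / real k) * (l\<^sub>0 * real k ^ 4) \<le> real (d k)" "real (d k) \<le> (1 + 1 / real k) * (l\<^sub>0 * real k ^ 4) + 1"
      unfolding d_def by linarith+
  qed
  have "l \<longlonglongrightarrow> l\<^sub>0"
  proof (rule tendsto_sandwich)
    show "eventually (\<lambda>k. (1 + 1 / real k) * l\<^sub>0 \<le> l k) sequentially"
      using eventually_gt_at_top[of 0]
    proof eventually_elim
      case (elim k)
      have "(1 + 1 / real k) * l\<^sub>0 = (1 + 1 / real k) * (l\<^sub>0 * real k ^ 4) * (1 / real k ^ 2)\<^sup>2"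
        using elim by (simp add: power_divide flip: power_mult)
      also have "\<dots> \<le> l k" unfolding l_def using d(1)[of k] l0 by (intro mult_right_mono) auto
      finally show ?case .
    qed
    show "eventually (\<lambda>k. l k \<le> (1 + 1 / real k) * l\<^sub>0 + (2 + 2 * l\<^sub>0) / real k ^ 4) sequentially"
      using eventually_gt_at_top[of 0]
    proof eventually_elim
      case (elim k)
      have "l k \<le> ((1 + 1 / real k) * (l\<^sub>0 * real k ^ 4) + (2 + 2 * l\<^sub>0)) * (1 / real k ^ 2)\<^sup>2"
        unfolding l_def using d(2)[of k] by (intro mult_right_mono) auto
      also have "\<dots> = (1 + 1 / real k) * l\<^sub>0 + (2 + 2 * l\<^sub>0) / real k ^ 4"
        using elim by (simp add: power_divide distrib_right add_divide_distrib flip: power_mult)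
      finally show ?case .
    qed
    show "(\<lambda>k. (1 + 1 / real k) * l\<^sub>0) \<longlonglongrightarrow> l\<^sub>0" by real_asymp
    show "(\<lambda>k. (1 + 1 / real k) * l\<^sub>0 + (2 + 2 * l\<^sub>0) / real k ^ 4) \<longlonglongrightarrow> l\<^sub>0" by real_asymp
  qed
  then have Fl: "(\<lambda>k. packing_rate (l k)) \<longlonglongrightarrow> packing_rate l\<^sub>0"
    unfolding packing_rate_def using l0 by (intro tendsto_intros) auto
  have "K \<longlonglongrightarrow> 0"
  proof -
    have "(\<lambda>k. (1 + 1 / real k) / (l\<^sub>0 * real k ^ 2)) \<longlonglongrightarrow> 0" using l0 by real_asymp
    moreover have "eventually (\<lambda>k. (1 + 1 / real k) / (l\<^sub>0 * real k ^ 2) = K k) sequentially"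
      using eventually_gt_at_top[of 0]
    proof eventually_elim
      case (elim k)
      have "(1 / real k)\<^sup>2 * (l\<^sub>0 / (1 / real k ^ 2)\<^sup>2) = l\<^sub>0 * real k ^ 2"
        using elim by (simp add: field_simps power2_eq_square)
      then show ?case unfolding K_def by (rule arg_cong[OF sym])
    qed
    ultimately show ?thesis by (rule Lim_transform_eventually)
  qed
  then have "(\<lambda>k. packing_rate (l k) * A * (1 / 6 - K k / 2)) \<longlonglongrightarrow> packing_rate l\<^sub>0 * A * (1 / 6 - 0 / 2)"
    by (intro tendsto_intros Fl) auto
  then have "eventually (\<lambda>k. a < packing_rate (l k) * A * (1 / 6 - K k / 2)) sequentially"
    using aF by (rule order_tendstoD)
  then have "eventually (\<lambda>k. a < packing_rate (l k) * A * (1 / 6 - K k / 2) \<and> k > 0) sequentially"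
    using eventually_gt_at_top[of 0] by (rule eventually_conj)
  then obtain k where k: "a < packing_rate (l k) * A * (1 / 6 - K k / 2)" "k > 0"
    by (auto dest: eventually_happens)
  define \<theta> where "\<theta> = 1 / real k ^ 2"
  have \<theta>: "0 < \<theta>" "\<theta> \<le> 1" using k(2) by (auto simp: \<theta>_def)
  have m: "l\<^sub>0 / \<theta>\<^sup>2 = l\<^sub>0 * real k ^ 4" by (simp add: \<theta>_def power_divide flip: power_mult)
  define \<kappa> where "\<kappa> = (\<lambda>R :: nat. \<theta> ^ 3 * packing_rate (l k) - 3 * real (d k) * (ln (1 + 2 * l k) / 2 / real R * (1 + 2 * l k) / l k))"
  have lk: "l k > 0" unfolding l_def using l0 k(2) by (intro mult_pos_pos) (auto intro: add_nonneg_pos)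
  have \<kappa>: "\<kappa> \<longlonglongrightarrow> \<theta> ^ 3 * packing_rate (l k) - 3 * real (d k) * (0 * (1 + 2 * l k) / l k)"
    unfolding \<kappa>_def by (intro tendsto_intros lim_const_over_n) (use lk in auto)
  have "packing_rate (l k) > 0" unfolding packing_rate_def using lk by (intro divide_pos_pos) auto
  then have "eventually (\<lambda>R. 0 < \<kappa> R) sequentially"
    by (intro order_tendstoD(1)[OF \<kappa>]) (use \<theta> in simp)
  moreover have "eventually (\<lambda>R. a < \<kappa> R * (A / \<theta> ^ 3) * (1 / 6 - K k / 2)) sequentially"
  proof (rule order_tendstoD(1))
    show "(\<lambda>R. \<kappa> R * (A / \<theta> ^ 3) * (1 / 6 - K k / 2)) \<longlonglongrightarrow>
       (\<theta> ^ 3 * packing_rate (l k) - 3 * real (d k) * (0 * (1 + 2 * l k) / l k)) * (A / \<theta> ^ 3) * (1 / 6 - K k / 2)"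
      by (intro tendsto_mult_right \<kappa>)
  qed (use k \<theta> in simp)
  moreover have "eventually (\<lambda>R. R > (0::nat)) sequentially" by (rule eventually_gt_at_top)
  ultimately have "eventually (\<lambda>R. 0 < \<kappa> R \<and> a < \<kappa> R * (A / \<theta> ^ 3) * (1 / 6 - K k / 2) \<and> 0 < R) sequentially"
    by eventually_elim auto
  then obtain R where R: "0 < \<kappa> R" "a < \<kappa> R * (A / \<theta> ^ 3) * (1 / 6 - K k / 2)" "0 < R"
    by (auto dest: eventually_happens)
  show ?thesis
  proof (rule nu_liminf_params[of l\<^sub>0 \<theta> R "1 / real k" "d k"])
    show "(1 + 1 / real k) * (l\<^sub>0 / \<theta>\<^sup>2) \<le> real (d k)" "real (d k) \<le> (1 + 1 / real k) * (l\<^sub>0 / \<theta>\<^sup>2) + 1"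
      using d[of k] by (auto simp: m)
    have "0 < (1 + 1 / real k) * (l\<^sub>0 * real k ^ 4)" using l0 k by (intro mult_pos_pos add_pos_nonneg) auto
    then show "1 \<le> d k" using d(1)[of k] by linarith
  qed (use l0 \<theta> k R in \<open>auto simp: \<kappa>_def l_def K_def A_def \<theta>_def\<close>)
qed

subsection \<open>An analytic inequality\<close>

text \<open>Tangent to the exponential: \<open>u \<le> c exp (u / c - 1)\<close>, so on an interval where
  \<open>x + u / c - 1 \<le> b\<close> it suffices to compare \<open>c exp b\<close> with the target.\<close>

lemma exp_tangent_piece:
  fixes s a b c :: real
  assumes s: "p \<le> s" "s \<le> q" and pq: "0 < p" "p < q" and c: "0 < c"
    and ends: "p\<^sup>2 / 4 + 4 / (c * p) \<le> b + 5 / 4 + 1 / c" "q\<^sup>2 / 4 + 4 / (c * q) \<le> b + 5 / 4 + 1 / c"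
    and eb: "c * exp b \<le> 14 / 5"
  shows "exp ((s\<^sup>2 - 1) / 4) * (4 / s - 1) \<le> 14 / 5"
proof -
  have s0: "0 < s" using s pq by simp
  define u where "u = 4 / s - 1"
  define k where "k = 4 / c"
  have k: "0 < k" using c by (simp add: k_def)
  define t where "t = (s - p) / (q - p)"
  have "t * (q - p) = s - p" using pq by (simp add: t_def)
  moreover have "(1 - t) * p + t * q = p + t * (q - p)" by (simp add: algebra_simps)
  ultimately have "s = (1 - t) * p + t * q" by simp
  moreover have "0 \<le> t" "t \<le> 1" using s pq by (auto simp: t_def)
  ultimately have t: "0 \<le> t" "t \<le> 1" "s = (1 - t) * p + t * q" by auto
  \<comment> \<open>\<open>s\<^sup>2\<close> and \<open>1 / s\<close> are convex and lie below their
    chords, so the exponent is controlled by its values at both ends. The bound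
    \<open>b + 5 / 4 + 1 / c\<close> is \<open>b\<close> with the constants of
    \<open>(s\<^sup>2 - 1) / 4 + u / c - 1\<close> moved across.\<close>
  have "0 \<le> (s - p) * (q - s)" using s by simp
  then have sq: "s\<^sup>2 \<le> (p + q) * s - p * q" by (simp add: power2_eq_square algebra_simps)
  have "1 / s \<le> (p + q - s) / (p * q)"
  proof -
    have "p * q \<le> (p + q - s) * s" using sq by (simp add: power2_eq_square algebra_simps)
    then show ?thesis using s0 pq by (simp add: field_simps)
  qed
  then have "k * (1 / s) \<le> k * ((p + q - s) / (p * q))" using k by (intro mult_left_mono) auto
  then have "k / s \<le> k * ((p + q - s) / (p * q))" by simp
  then have "s\<^sup>2 / 4 + k / s \<le> ((p + q) * s - p * q) / 4 + k * ((p + q - s) / (p * q))"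
    using sq by (intro add_mono divide_right_mono) auto
  also have "\<dots> = (1 - t) * (p\<^sup>2 / 4 + k / p) + t * (q\<^sup>2 / 4 + k / q)"
  proof -
    have ex: "(p + q) * s - p * q = (1 - t) * p\<^sup>2 + t * q\<^sup>2"
      unfolding t(3) by (simp add: power2_eq_square algebra_simps)
    have ey: "(p + q - s) / (p * q) = (1 - t) / p + t / q"
      unfolding t(3) using pq by (simp add: field_simps)
    show ?thesis unfolding ex ey
      by (simp add: algebra_simps add_divide_distrib diff_divide_distrib)
  qed
  also have "\<dots> \<le> (1 - t) * (b + 5 / 4 + 1 / c) + t * (b + 5 / 4 + 1 / c)"
  proof -
    have 1: "p\<^sup>2 / 4 + k / p \<le> b + 5 / 4 + 1 / c" "q\<^sup>2 / 4 + k / q \<le> b + 5 / 4 + 1 / c"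
      using ends by (simp_all add: k_def)
    have "0 \<le> 1 - t" using t by simp
    from mult_left_mono[OF 1(1) this] mult_left_mono[OF 1(2) t(1)] show ?thesis by (rule add_mono)
  qed
  also have "(1 - t) * (b + 5 / 4 + 1 / c) + t * (b + 5 / 4 + 1 / c) = b + 5 / 4 + 1 / c"
    by (simp flip: distrib_right)
  finally have main: "s\<^sup>2 / 4 + k / s \<le> b + 5 / 4 + 1 / c" .
  have uc: "u / c = k / s - 1 / c" by (simp add: u_def k_def field_simps diff_divide_distrib)
  have "u / c \<le> exp (u / c - 1)" using exp_ge_add_one_self[of "u / c - 1"] by simp
  then have "u \<le> c * exp (u / c - 1)" using c by (simp add: field_simps)
  then have "exp ((s\<^sup>2 - 1) / 4) * u \<le> exp ((s\<^sup>2 - 1) / 4) * (c * exp (u / c - 1))"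
    by (intro mult_left_mono) auto
  also have "\<dots> = c * exp ((s\<^sup>2 - 1) / 4 + (u / c - 1))" by (simp add: exp_add)
  also have "\<dots> \<le> c * exp b"
    using main c unfolding uc by (intro mult_left_mono) (auto simp: diff_divide_distrib)
  also note eb
  finally show ?thesis by (simp only: u_def)
qed

text \<open>After raising to the power \<open>k\<close>, the bound e < 2.72 reduces the claim to a
  comparison of rational numbers.\<close>

lemma exp_rational_le:
  fixes y :: real
  assumes "0 < k" "0 < y" "(68 / 25) ^ j \<le> y ^ k"
  shows "exp (real j / real k) \<le> y"
proof (rule power_le_imp_le_base)
  have "exp (real j / real k) ^ k = exp 1 ^ j"
    using assms(1) by (simp flip: exp_of_nat_mult)
  also have "\<dots> \<le> (68 / 25) ^ j" using e_less_272 by (intro power_mono) auto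
  finally have "exp (real j / real k) ^ k \<le> y ^ k" using assms(3) by simp
  then show "exp (real j / real k) ^ Suc (k - 1) \<le> y ^ Suc (k - 1)" using assms(1) by simp
qed (use assms in simp)

text \<open>On each of five intervals the tangent point \<open>c\<close> is a value that
  \<open>4 / s - 1\<close> takes there, and \<open>b\<close> is a rational slightly below
  \<open>ln (14 / (5 * c))\<close>. Beyond \<open>s = 4\<close> the left side is negative.\<close>

lemma exp_quartic_bound:
  fixes s :: real
  assumes "23 / 20 \<le> s"
  shows "exp ((s\<^sup>2 - 1) / 4) * (4 / s - 1) \<le> 14 / 5"
proof -
  consider "s \<le> 3 / 2" | "3 / 2 \<le> s" "s \<le> 13 / 5" | "13 / 5 \<le> s" "s \<le> 59 / 20" | "59 / 20 \<le> s" "s \<le> 7 / 2"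
    | "7 / 2 \<le> s" "s \<le> 4" | "4 < s" by linarith
  then show ?thesis
  proof cases
    case 1
    show ?thesis
      by (rule exp_tangent_piece[of "23 / 20" s "3 / 2" 2 "1 / 3"])
         (use assms 1 exp_rational_le[of 3 "7 / 5" 1] in \<open>auto simp: power2_eq_square power3_eq_cube\<close>)
  next
    case 2
    show ?thesis
      by (rule exp_tangent_piece[of "3 / 2" s "13 / 5" 1 1])
         (use 2 e_less_272 in \<open>auto simp: power2_eq_square\<close>)
  next
    case 3
    show ?thesis
      by (rule exp_tangent_piece[of "13 / 5" s "59 / 20" "1 / 2" "5 / 3"])
         (use 3 exp_rational_le[of 3 "28 / 5" 5] in \<open>auto simp: power2_eq_square eval_nat_numeral\<close>)
  next
    case 4
    show ?thesis
      by (rule exp_tangent_piece[of "59 / 20" s "7 / 2" "1 / 4" "12 / 5"])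
         (use 4 exp_rational_le[of 5 "56 / 5" 12] in \<open>auto simp: power2_eq_square eval_nat_numeral\<close>)
  next
    case 5
    show ?thesis
      by (rule exp_tangent_piece[of "7 / 2" s 4 "1 / 10" "13 / 4"])
         (use 5 exp_rational_le[of 4 28 13] in \<open>auto simp: power2_eq_square eval_nat_numeral\<close>)
  next
    case 6
    then have "4 / s - 1 \<le> 0" by simp
    then have "exp ((s\<^sup>2 - 1) / 4) * (4 / s - 1) \<le> 0" by (intro mult_nonneg_nonpos) auto
    then show ?thesis by linarith
  qed
qed

text \<open>Up to the factor \<open>sqrt l / 12\<close> the difference of the two sides is
  \<open>1 - 4 / s + 3 * E - l / 2 * (E * exp (- l))\<close>. As
  \<open>l * exp (- l) \<le> 1 / exp 1 < 2 / 5\<close>, the last term costs less than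
  \<open>E / 5\<close>, which leaves \<open>14 / 5 * E\<close> to dominate \<open>4 / s - 1\<close>.
  From \<open>1 / 6 \<le> l\<close> follows \<open>23 / 20 \<le> s\<close>.\<close>

lemma surplus_limit_pos:
  fixes l :: real
  assumes "1 / 6 \<le> l"
  shows "sqrt l / 4 * (1 - exp (- l / 2)) + l * sqrt l / 24 * exp (- 3 * l / 2) <
    2 * (sqrt l / 6 * (1 - 1 / sqrt (1 + 2 * l)))"
proof -
  define s where "s = sqrt (1 + 2 * l)"
  define E where "E = exp (- (l / 2))"
  have s2: "s\<^sup>2 = 1 + 2 * l" using assms by (simp add: s_def)
  have s: "23 / 20 \<le> s" unfolding s_def using assms by (intro real_le_rsqrt) (simp add: power2_eq_square)
  have E: "0 < E" by (simp add: E_def)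
  have E3: "exp (- 3 * l / 2) = E * exp (- l)"
    unfolding E_def exp_add[symmetric] by (simp add: field_simps)
  have "exp (l / 2) * (4 / s - 1) \<le> 14 / 5"
    using exp_quartic_bound[OF s] unfolding s2 by simp
  then have "E * (exp (l / 2) * (4 / s - 1)) \<le> E * (14 / 5)" using E by (intro mult_left_mono) auto
  moreover have "E * exp (l / 2) = 1" unfolding E_def exp_add[symmetric] by simp
  then have "E * (exp (l / 2) * (4 / s - 1)) = 4 / s - 1" by (simp flip: mult.assoc)
  ultimately have 1: "4 / s - 1 \<le> 14 / 5 * E" by simp
  have less: "l * exp (- l) < 2 / 5"
  proof (rule ccontr)
    assume "\<not> l * exp (- l) < 2 / 5"
    moreover have "l * exp (- l) \<le> 1 / exp 1"
    proof -
      have "l \<le> exp (l - 1)" using exp_ge_add_one_self[of "l - 1"] by simp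
      then have "l * exp (- l) \<le> exp (l - 1) * exp (- l)" by (intro mult_right_mono) auto
      also have "\<dots> = 1 / exp 1" by (simp add: exp_minus field_simps flip: exp_add)
      finally show ?thesis .
    qed
    moreover have "1 / exp (1 :: real) < 2 / 5"
    proof -
      have "(5 / 2 :: real) < exp 1"
        using exp_lower_Taylor_quadratic[of "1 / 2 :: real"] exp_double[of "1 / 2 :: real"]
          power_mono[of "13 / 8" "exp (1 / 2 :: real)" 2] by (simp add: power2_eq_square)
      then show ?thesis by (simp add: field_simps)
    qed
    ultimately show False by linarith
  qed
  then have "E * (l * exp (- l)) < E * (2 / 5)" using E by (intro mult_strict_left_mono)
  then have "0 < 1 - 4 / s + 3 * E - l / 2 * (E * exp (- l))" using 1 by (simp add: algebra_simps)
  then have "0 < sqrt l / 12 * (1 - 4 / s + 3 * E - l / 2 * (E * exp (- l)))"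
    using assms by (intro mult_pos_pos) auto
  also have "\<dots> = 2 * (sqrt l / 6 * (1 - 1 / s)) - (sqrt l / 4 * (1 - E) + l * sqrt l / 24 * (E * exp (- l)))"
    by (simp add: field_simps)
  finally show ?thesis unfolding E3 by (simp add: s_def[symmetric] E_def[symmetric])
qed

subsection \<open>Concentration in all ranges\<close>

text \<open>A cover of the union restricts to covers of both parts, and these are disjoint. This
  makes the mean of \<open>tau\<close> monotone in the density.\<close>

lemma tau_superadditive:
  assumes "finite A" "finite B" "A \<inter> B = {}"
  shows "tau A + tau B \<le> tau (A \<union> B)"
proof -
  obtain F where F: "triangle_cover (A \<union> B) F" "card F = tau (A \<union> B)"
    using tau_attained[of "A \<union> B"] assms by auto
  have sub: "triangle_cover C (F \<inter> C)" if "C \<subseteq> A \<union> B" for C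
    unfolding triangle_cover_def
  proof (intro conjI ballI)
    fix t assume t: "t \<in> triangles C"
    then have "t \<inter> F \<noteq> {}" using F(1) triangles_mono[OF that] by (auto simp: triangle_cover_def)
    then show "t \<inter> (F \<inter> C) \<noteq> {}" using triangle_subset[OF t] by auto
  qed auto
  have "tau A \<le> card (F \<inter> A)" "tau B \<le> card (F \<inter> B)"
    using assms by (auto intro!: tau_le sub)
  moreover have "card (F \<inter> A) + card (F \<inter> B) = card ((F \<inter> A) \<union> (F \<inter> B))"
    using assms by (intro card_Un_disjoint[symmetric]) auto
  moreover have "(F \<inter> A) \<union> (F \<inter> B) = F" using F(1) by (auto simp: triangle_cover_def)
  ultimately show ?thesis using F(2) by simp
qed

lemma finite_subset_all_edges: "finite X \<Longrightarrow> G \<subseteq> all_edges X \<Longrightarrow> finite G"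
  by (rule finite_subset[of _ "all_edges X"]) auto

lemma Enu_mono:
  assumes "0 \<le> p" "p \<le> q" "q \<le> 1"
  shows "Enu n p \<le> Enu n q"
  unfolding Enu_def
proof (rule expect_rset_mono)
  fix A B assume "A \<subseteq> all_edges {1..n}" "B \<subseteq> all_edges {1..n}" "A \<inter> B = {}"
  then have "nu A + nu B \<le> nu (A \<union> B)"
    by (intro nu_superadditive finite_subset_all_edges[of "{1..n}"]) auto
  then show "real (nu A) + real (nu B) \<le> real (nu (A \<union> B))" by linarith
qed (use assms in auto)

lemma Etau_mono:
  assumes "0 \<le> p" "p \<le> q" "q \<le> 1"
  shows "Etau n p \<le> Etau n q"
  unfolding Etau_def
proof (rule expect_rset_mono)
  fix A B assume "A \<subseteq> all_edges {1..n}" "B \<subseteq> all_edges {1..n}" "A \<inter> B = {}"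
  then have "tau A + tau B \<le> tau (A \<union> B)"
    by (intro tau_superadditive finite_subset_all_edges[of "{1..n}"]) auto
  then show "real (tau A) + real (tau B) \<le> real (tau (A \<union> B))" by linarith
qed (use assms in auto)

lemma Enu_mult:
  assumes "0 \<le> p" "real k * p \<le> 1"
  shows "real k * Enu n p \<le> Enu n (real k * p)"
  unfolding Enu_def
proof (rule expect_rset_superadditive_mult)
  fix A B assume "A \<subseteq> all_edges {1..n}" "B \<subseteq> all_edges {1..n}" "A \<inter> B = {}"
  then have "nu A + nu B \<le> nu (A \<union> B)"
    by (intro nu_superadditive finite_subset_all_edges[of "{1..n}"]) auto
  then show "real (nu A) + real (nu B) \<le> real (nu (A \<union> B))" by linarith
qed (use assms in auto)

lemma expect_surplus: "expect (gnp n p) surplus = 2 * Enu n p - Etau n p"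
  unfolding surplus_def Enu_def Etau_def by simp

section \<open>The mean covering number for constant average codegree\<close>

lemma Etau_le:
  assumes "0 \<le> p" "p \<le> 1"
  shows "Etau n p \<le> real (n choose 2) * (p / 2 * (1 - (1 - p\<^sup>2 / 2) ^ (n - 2))) +
    real (n choose 3) * (p ^ 3 / 4 * (1 - (3 * p\<^sup>2 - 2 * p ^ 3) / 2) ^ (n - 3))"
  using expect_tau_le[of "{1..n}" p] assms by (simp add: Etau_def)

lemma power_le_exp:
  fixes y :: real
  assumes "y \<le> 1"
  shows "(1 - y) ^ k \<le> exp (- (real k * y))"
proof -
  have "(1 - y) ^ k \<le> exp (- y) ^ k"
    using exp_ge_add_one_self[of "- y"] assms by (intro power_mono) auto
  also have "\<dots> = exp (- (real k * y))" by (simp flip: exp_of_nat_mult)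
  finally show ?thesis .
qed

lemma tau_limsup:
  assumes l: "0 < l" and b: "sqrt l / 4 * (1 - exp (- l / 2)) + l * sqrt l / 24 * exp (- 3 * l / 2) < b"
  shows "eventually (\<lambda>n. Etau n (sqrt (l / real n)) \<le> b * (real n * sqrt (real n))) sequentially"
proof -
  \<comment> \<open>\<open>U n\<close> is the cover bound divided by \<open>n powr (3 / 2)\<close>,
    and \<open>z n\<close> is the exponent for free triples. It tends to \<open>3 * l / 2\<close>,
    as the correction of order \<open>p ^ 3\<close> is of lower order.\<close>
  define z where "z = (\<lambda>n. (1 - 3 / real n) * ((3 * l - 2 * l * sqrt (l / real n)) / 2))"
  define U where "U = (\<lambda>n. (1 - 1 / real n) * (sqrt l / 4 * (1 - (1 + (- l / 2) / real n) ^ n)) +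
     (1 - 1 / real n) * (1 - 2 / real n) * (l * sqrt l / 24 * exp (- z n)))"
  have bound: "Etau n (sqrt (l / real n)) \<le> U n * (real n * sqrt (real n))" if n: "n \<ge> 3" "real n \<ge> 2 * l" for n
  proof -
    define p where "p = sqrt (l / real n)"
    have n0: "real n > 0" using n by simp
    have p2: "p\<^sup>2 = l / real n" using l n by (simp add: p_def)
    have p0: "0 \<le> p" using l by (simp add: p_def)
    have p2h: "p\<^sup>2 \<le> 1 / 2" unfolding p2 using n n0 by (simp add: field_simps)
    have p1: "p \<le> 1"
    proof -
      have "p\<^sup>2 \<le> 1\<^sup>2" using p2h by simp
      then show ?thesis by (rule power2_le_imp_le) simp
    qed
    have p3: "p ^ 3 = p * (l / real n)" using p2 by (simp add: power3_eq_cube power2_eq_square)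
    have pn: "p * real n = sqrt l * sqrt (real n)"
      unfolding p_def real_sqrt_divide using n0 by (simp add: real_div_sqrt divide_simps)
    define y where "y = (3 * p\<^sup>2 - 2 * p ^ 3) / 2"
    have "0 \<le> p ^ 3" using p0 by simp
    moreover have "y = 3 / 2 * p\<^sup>2 - p ^ 3" by (simp add: y_def field_simps)
    ultimately have y1: "y \<le> 1" using p2h by linarith
    have zy: "real (n - 3) * y = z n"
    proof -
      have "real (n - 3) = (1 - 3 / real n) * real n" using n by (simp add: field_simps of_nat_diff)
      moreover have "real n * y = (3 * l - 2 * l * p) / 2"
        unfolding y_def p2 p3 using n0 by (simp add: field_simps)
      ultimately show ?thesis by (simp add: z_def p_def[symmetric])
    qed
    \<comment> \<open>Passing to the exponent \<open>n\<close> only weakens the bound and permits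
      Euler's limit for the exponential.\<close>
    have "(1 - p\<^sup>2 / 2) ^ n \<le> (1 - p\<^sup>2 / 2) ^ (n - 2)"
      using p2h by (intro power_decreasing) auto
    moreover have "(1 - p\<^sup>2 / 2) ^ n = (1 + (- l / 2) / real n) ^ n"
      unfolding p2 by (simp add: field_simps)
    ultimately have 1: "1 - (1 - p\<^sup>2 / 2) ^ (n - 2) \<le> 1 - (1 + (- l / 2) / real n) ^ n" by linarith
    have 2: "(1 - y) ^ (n - 3) \<le> exp (- z n)" using power_le_exp[OF y1, of "n - 3"] zy by simp
    have "Etau n p \<le> real (n choose 2) * (p / 2 * (1 - (1 - p\<^sup>2 / 2) ^ (n - 2))) +
      real (n choose 3) * (p ^ 3 / 4 * (1 - y) ^ (n - 3))"
      unfolding y_def using p0 p1 by (rule Etau_le)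
    also have "\<dots> \<le> real (n choose 2) * (p / 2 * (1 - (1 + (- l / 2) / real n) ^ n)) +
      real (n choose 3) * (p ^ 3 / 4 * exp (- z n))"
      using 1 2 p0 by (intro add_mono mult_left_mono) auto
    also have "\<dots> = U n * (real n * sqrt (real n))"
    proof -
      have "real (n choose 2) * (p / 2 * x) = (1 - 1 / real n) * (sqrt l / 4 * x) * (real n * sqrt (real n))" for x
      proof -
        have "real (n choose 2) * (p / 2 * x) = (1 - 1 / real n) * real n * (p * real n) / 4 * x"
          unfolding choose2_real using n0 by (simp add: field_simps)
        then show ?thesis unfolding pn by (simp add: mult_ac)
      qed
      moreover have "real (n choose 3) * (p ^ 3 / 4 * x) =
          (1 - 1 / real n) * (1 - 2 / real n) * (l * sqrt l / 24 * x) * (real n * sqrt (real n))" for x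
      proof -
        have "real (n choose 3) * (p ^ 3 / 4 * x) =
          (1 - 1 / real n) * (1 - 2 / real n) * real n * (p * real n) * l / 24 * x"
          unfolding choose3_real p3 using n0 by (simp add: field_simps)
        then show ?thesis unfolding pn by (simp add: mult_ac)
      qed
      ultimately show ?thesis by (simp only: U_def distrib_right)
    qed
    finally show ?thesis by (simp add: p_def)
  qed
  have U: "U \<longlonglongrightarrow> (1 - 0) * (sqrt l / 4 * (1 - exp (- l / 2))) +
     (1 - 0) * (1 - 0) * (l * sqrt l / 24 * exp (- ((1 - 0) * ((3 * l - 2 * l * 0) / 2))))"
  proof -
    have 1: "(\<lambda>n. 1 - 1 / real n) \<longlonglongrightarrow> 1 - 0" by real_asymp
    have 2: "(\<lambda>n. 1 - 2 / real n) \<longlonglongrightarrow> 1 - 0" by real_asymp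
    have 3: "(\<lambda>n. 1 - 3 / real n) \<longlonglongrightarrow> 1 - 0" by real_asymp
    have 4: "(\<lambda>n. sqrt (l / real n)) \<longlonglongrightarrow> 0" using l by real_asymp
    have 5: "(\<lambda>n. (1 + (- l / 2) / real n) ^ n) \<longlonglongrightarrow> exp (- l / 2)"
      by (rule tendsto_exp_limit_sequentially)
    show ?thesis unfolding U_def z_def
      by (intro tendsto_add tendsto_mult tendsto_diff tendsto_divide tendsto_minus tendsto_exp tendsto_const 1 2 3 4 5) auto
  qed
  have "eventually (\<lambda>n. U n < b) sequentially"
    by (rule order_tendstoD(2)[OF U]) (use b in simp)
  moreover have "eventually (\<lambda>n. real n \<ge> 2 * l) sequentially" by real_asymp
  moreover have "eventually (\<lambda>n. n \<ge> 3) sequentially" by (rule eventually_ge_at_top)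
  ultimately show ?thesis
  proof eventually_elim
    case (elim n)
    have "U n * (real n * sqrt (real n)) \<le> b * (real n * sqrt (real n))"
      using elim by (intro mult_right_mono) auto
    then show ?case using bound[of n] elim by linarith
  qed
qed

text \<open>The asymptotic bounds hold for single values of \<lambda>, without control of when they
  set in. Since \<open>Enu\<close> and \<open>Etau\<close> increase with the density, the bound on
  \<open>Enu\<close> at the left end \<open>u\<close> and the one on \<open>Etau\<close> at the
  right end \<open>v\<close> serve every \<lambda> between.\<close>

lemma expect_surplus_local:
  fixes x :: real
  assumes x: "1 / 6 \<le> x"
  shows "\<exists>u v c N. 0 < u \<and> u < x \<and> x < v \<and> c > 0 \<and> (\<forall>n\<ge>N. \<forall>l\<in>{u..v}.
    c * (real n * sqrt (real n)) \<le> expect (gnp n (sqrt (l / real n))) surplus)"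
proof -
  define \<phi> where "\<phi> = (\<lambda>l :: real. sqrt l / 6 * (1 - 1 / sqrt (1 + 2 * l)))"
  define T where "T = (\<lambda>l :: real. sqrt l / 4 * (1 - exp (- l / 2)) + l * sqrt l / 24 * exp (- 3 * l / 2))"
  \<comment> \<open>One eighth of the gap: the bound on \<open>2 * Enu\<close> loses
    \<open>2 * c\<close>, the bound on \<open>Etau\<close> gains \<open>c\<close>, and
    \<open>5 * c\<close> remains.\<close>
  define c where "c = (2 * \<phi> x - T x) / 8"
  have c: "c > 0" using surplus_limit_pos[OF x] by (simp add: c_def \<phi>_def T_def)
  have x0: "x > 0" using x by simp
  have \<phi>: "isCont \<phi> x" unfolding \<phi>_def using x0 by (intro continuous_intros) auto
  have T: "isCont T x" unfolding T_def by (intro continuous_intros) auto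
  have "(\<phi> \<longlongrightarrow> \<phi> x) (at_left x)" using \<phi> by (simp add: isCont_def filterlim_at_split)
  then have "eventually (\<lambda>u. \<phi> x - c < \<phi> u) (at_left x)" using c by (intro order_tendstoD(1)) auto
  moreover have "eventually (\<lambda>u. u \<in> {0<..<x}) (at_left x)" using x0 by (intro eventually_at_leftI[of 0]) auto
  ultimately have "eventually (\<lambda>u. \<phi> x - c < \<phi> u \<and> u \<in> {0<..<x}) (at_left x)" by (rule eventually_conj)
  then obtain u where u: "\<phi> x - c < \<phi> u" "0 < u" "u < x"
    by (auto dest!: eventually_happens simp: trivial_limit_at_left_real)
  have "(T \<longlongrightarrow> T x) (at_right x)" using T by (simp add: isCont_def filterlim_at_split)
  then have "eventually (\<lambda>v. T v < T x + c) (at_right x)" using c by (intro order_tendstoD(2)) auto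
  moreover have "eventually (\<lambda>v. v \<in> {x<..<x + 1}) (at_right x)" by (intro eventually_at_rightI[of _ "x + 1"]) auto
  ultimately have "eventually (\<lambda>v. T v < T x + c \<and> v \<in> {x<..<x + 1}) (at_right x)" by (rule eventually_conj)
  then obtain v where v: "T v < T x + c" "x < v"
    by (auto dest!: eventually_happens simp: trivial_limit_at_right_real)
  have "eventually (\<lambda>n. Enu n (sqrt (u / real n)) \<ge> (\<phi> x - c) * (real n * sqrt (real n))) sequentially"
    using u by (intro nu_liminf) (auto simp: \<phi>_def)
  moreover have "eventually (\<lambda>n. Etau n (sqrt (v / real n)) \<le> (T x + c) * (real n * sqrt (real n))) sequentially"
    using v x0 by (intro tau_limsup) (auto simp: T_def)
  moreover have "eventually (\<lambda>n. real n \<ge> v) sequentially" by real_asymp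
  ultimately have "eventually (\<lambda>n. \<forall>l\<in>{u..v}. c * (real n * sqrt (real n)) \<le> expect (gnp n (sqrt (l / real n))) surplus) sequentially"
  proof eventually_elim
    case (elim n)
    show ?case
    proof
      fix l assume l: "l \<in> {u..v}"
      have n0: "real n > 0" using elim v x0 by linarith
      have "sqrt (u / real n) \<le> sqrt (l / real n)" "sqrt (l / real n) \<le> sqrt (v / real n)" "sqrt (v / real n) \<le> 1"
        using l n0 elim by (auto simp: divide_right_mono)
      then have "Enu n (sqrt (u / real n)) \<le> Enu n (sqrt (l / real n))" "Etau n (sqrt (l / real n)) \<le> Etau n (sqrt (v / real n))"
        using u l n0 by (auto intro!: Enu_mono Etau_mono)
      then have "2 * ((\<phi> x - c) * (real n * sqrt (real n))) - (T x + c) * (real n * sqrt (real n)) \<le>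
          expect (gnp n (sqrt (l / real n))) surplus"
        using elim(1,2) unfolding expect_surplus by linarith
      moreover have "2 * ((\<phi> x - c) * (real n * sqrt (real n))) - (T x + c) * (real n * sqrt (real n)) =
          5 * c * (real n * sqrt (real n))"
      proof -
        have "2 * ((\<phi> x - c) * q) - (T x + c) * q = (2 * (\<phi> x - c) - (T x + c)) * q" for q
          by (simp add: algebra_simps)
        moreover have "2 * (\<phi> x - c) - (T x + c) = 5 * c" by (simp add: c_def field_simps)
        ultimately show ?thesis by simp
      qed
      moreover have "c * (real n * sqrt (real n)) \<le> 5 * c * (real n * sqrt (real n))"
        using c by (intro mult_right_mono) auto
      ultimately show "c * (real n * sqrt (real n)) \<le> expect (gnp n (sqrt (l / real n))) surplus" by linarith
    qed
  qed
  then show ?thesis using u v c unfolding eventually_sequentially by blast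
qed

text \<open>Bisection in place of a finite subcover: a property that holds on small intervals around
  every point and passes to adjacent unions holds on all of \<open>{a..b}\<close>.\<close>

lemma expect_surplus_compact:
  fixes a b :: real
  assumes a: "1 / 6 \<le> a" "a \<le> b"
  shows "\<exists>c N. c > 0 \<and> (\<forall>n\<ge>N. \<forall>l\<in>{a..b}.
    c * (real n * sqrt (real n)) \<le> expect (gnp n (sqrt (l / real n))) surplus)"
proof -
  define Q where "Q = (\<lambda>c n l. c * (real n * sqrt (real n)) \<le> expect (gnp n (sqrt (l / real n))) surplus)"
  define P where "P = (\<lambda>u v. \<exists>c N. c > 0 \<and> (\<forall>n\<ge>N. \<forall>l\<in>{u..v}. Q c n l))"
  have Q_mono: "Q c' n l" if "Q c n l" "c' \<le> c" for c c' n l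
  proof -
    have "c' * (real n * sqrt (real n)) \<le> c * (real n * sqrt (real n))"
      using that(2) by (rule mult_right_mono) simp
    then show ?thesis using that(1) by (simp add: Q_def)
  qed
  have "P a b"
  proof (rule Bolzano[OF a(2)])
    fix u v w assume "P u v" "P v w"
    then obtain c1 N1 c2 N2 where 1: "c1 > 0" "\<And>n l. n \<ge> N1 \<Longrightarrow> l \<in> {u..v} \<Longrightarrow> Q c1 n l"
      and 2: "c2 > 0" "\<And>n l. n \<ge> N2 \<Longrightarrow> l \<in> {v..w} \<Longrightarrow> Q c2 n l"
      unfolding P_def by blast
    have "Q (min c1 c2) n l" if n: "n \<ge> max N1 N2" and l: "l \<in> {u..w}" for n l
    proof (cases "l \<le> v")
      case True
      then have "Q c1 n l" using n l by (intro 1) auto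
      then show ?thesis by (rule Q_mono) simp
    next
      case False
      then have "Q c2 n l" using n l by (intro 2) auto
      then show ?thesis by (rule Q_mono) simp
    qed
    moreover have "min c1 c2 > 0" using 1(1) 2(1) by simp
    ultimately show "P u w" unfolding P_def by blast
  next
    fix x assume "a \<le> x" "x \<le> b"
    then have "1 / 6 \<le> x" using a by simp
    from expect_surplus_local[OF this] obtain u v c N where uv: "u < x" "x < v" "c > 0"
      and *: "\<And>n l. n \<ge> N \<Longrightarrow> l \<in> {u..v} \<Longrightarrow> Q c n l"
      unfolding Q_def by blast
    show "\<exists>d>0. \<forall>a b. a \<le> x \<and> x \<le> b \<and> b - a < d \<longrightarrow> P a b"
    proof (intro exI[of _ "min (x - u) (v - x)"] conjI allI impI)
      show "0 < min (x - u) (v - x)" using uv by simp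
      fix a' b' assume ab: "a' \<le> x \<and> x \<le> b' \<and> b' - a' < min (x - u) (v - x)"
      have "\<forall>n\<ge>N. \<forall>l\<in>{a'..b'}. Q c n l" by (intro allI impI ballI *) (use ab in auto)
      then show "P a' b'" using uv(3) unfolding P_def by blast
    qed
  qed
  then show ?thesis unfolding P_def Q_def .
qed

text \<open>At \<lambda> = 40 the square root is 9, so the mean packing number is near 4/27 > 0.147
  times n^2 p. For \<lambda> \<ge> 4000 the density is at least ten times larger, so rounding down
  to an integer number of pieces keeps nine tenths. The cover costs at most 0.2504 n^2 p, and 2 *
  0.1323 exceeds this by more than 0.01.\<close>

lemma expect_surplus_dense:
  "eventually (\<lambda>n. \<forall>p. 0 \<le> p \<and> p \<le> 1 \<and> 4000 \<le> real n * p\<^sup>2 \<longrightarrow>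
    real n ^ 2 * p / 100 \<le> expect (gnp n p) surplus) sequentially"
proof -
  have "147 / 1000 * sqrt 40 < sqrt 40 / 6 * (1 - 1 / sqrt (1 + 2 * 40))"
  proof -
    have "sqrt (1 + 2 * 40) = (9 :: real)" by (rule real_sqrt_unique) auto
    then show ?thesis by simp
  qed
  then have "eventually (\<lambda>n. Enu n (sqrt (40 / real n)) \<ge> 147 / 1000 * sqrt 40 * (real n * sqrt (real n))) sequentially"
    by (intro nu_liminf) auto
  moreover have "eventually (\<lambda>n. n \<ge> 6) sequentially" by (rule eventually_ge_at_top)
  ultimately show ?thesis
  proof eventually_elim
    case (elim n)
    show ?case
    proof (intro allI impI)
      fix p assume p: "0 \<le> p \<and> p \<le> 1 \<and> 4000 \<le> real n * p\<^sup>2"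
      have n0: "real n > 0" using elim by simp
      define l where "l = real n * p\<^sup>2"
      have l: "4000 \<le> l" using p by (simp add: l_def)
      define p0 where "p0 = sqrt (40 / real n)"
      have p0: "p0 > 0" using n0 by (simp add: p0_def)
      have pp: "p > 0" using p by (cases "p = 0") auto
      have p0p: "p0 \<le> p / 10"
      proof (rule power2_le_imp_le)
        have "p0\<^sup>2 = 40 / real n" using n0 by (simp add: p0_def)
        also have "\<dots> \<le> (p / 10)\<^sup>2" using p n0 by (simp add: field_simps power2_eq_square)
        finally show "p0\<^sup>2 \<le> (p / 10)\<^sup>2" .
      qed (use pp in simp)
      define k where "k = nat \<lfloor>p / p0\<rfloor>"
      have k: "real k \<le> p / p0" "p / p0 - 1 \<le> real k"
      proof -
        have "0 \<le> p / p0" using p0 pp by simp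
        then show "real k \<le> p / p0" "p / p0 - 1 \<le> real k" unfolding k_def by linarith+
      qed
      have kp: "real k * p0 \<le> p" "9 / 10 * p \<le> real k * p0"
      proof -
        show "real k * p0 \<le> p" using k(1) p0 by (simp add: field_simps)
        have "(p / p0 - 1) * p0 \<le> real k * p0" using k(2) p0 by (intro mult_right_mono) auto
        then show "9 / 10 * p \<le> real k * p0" using p0 p0p by (simp add: algebra_simps)
      qed
      have sn: "sqrt 40 * (real n * sqrt (real n)) = p0 * (real n)\<^sup>2"
      proof -
        have "p0 * (real n)\<^sup>2 = sqrt 40 * real n * (real n / sqrt (real n))"
          unfolding p0_def real_sqrt_divide by (simp add: power2_eq_square)
        also have "real n / sqrt (real n) = sqrt (real n)" using n0 by (simp add: real_div_sqrt)
        finally show ?thesis by simp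
      qed
      have "147 / 1000 * (9 / 10 * p) * (real n)\<^sup>2 \<le> 147 / 1000 * (real k * p0) * (real n)\<^sup>2"
        using kp(2) by (intro mult_right_mono mult_left_mono) auto
      also have "\<dots> = real k * (147 / 1000 * (p0 * (real n)\<^sup>2))" by simp
      also have "\<dots> \<le> real k * Enu n p0"
        using elim(1) unfolding p0_def[symmetric] mult.assoc sn by (intro mult_left_mono) auto
      also have "\<dots> \<le> Enu n (real k * p0)" using p0 kp p by (intro Enu_mult) auto
      also have "\<dots> \<le> Enu n p" using p0 kp p by (intro Enu_mono) auto
      finally have nu: "1323 / 10000 * ((real n)\<^sup>2 * p) \<le> Enu n p" by (simp add: mult_ac)
      define y where "y = (3 * p\<^sup>2 - 2 * p ^ 3) / 2"
      have "p ^ 3 \<le> p\<^sup>2" using p by (intro power_decreasing) auto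
      then have y: "p\<^sup>2 / 2 \<le> y" "y \<le> 1"
      proof -
        show "p\<^sup>2 / 2 \<le> y" unfolding y_def using \<open>p ^ 3 \<le> p\<^sup>2\<close> by simp
        have "0 \<le> (1 - p)\<^sup>2 * (1 + 2 * p)" using p by simp
        also have "(1 - p)\<^sup>2 * (1 + 2 * p) = 1 - 2 * y"
          by (simp add: y_def power2_eq_square power3_eq_cube field_simps)
        finally show "y \<le> 1" by simp
      qed
      \<comment> \<open>Quadratic decay is enough: the number of triangles is of order
        \<open>l * (real n)\<^sup>2 * p\<close>, so free triples contribute only a fraction of order
        \<open>1 / l\<close> of \<open>(real n)\<^sup>2 * p\<close>.\<close>
      have "(1 - y) ^ (n - 3) \<le> 32 / l\<^sup>2"
      proof -
        have "(1 - y) ^ (n - 3) \<le> exp (- (real (n - 3) * y))" using y by (intro power_le_exp)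
        also have "\<dots> \<le> exp (- (l / 4))"
        proof -
          have "real n / 2 * (p\<^sup>2 / 2) \<le> real (n - 3) * y" using elim(2) y by (intro mult_mono) auto
          then show ?thesis by (simp add: l_def)
        qed
        also have "\<dots> = 1 / exp (l / 4)" by (simp add: exp_minus field_simps)
        also have "\<dots> \<le> 1 / ((l / 4)\<^sup>2 / 2)"
          using exp_lower_Taylor_quadratic[of "l / 4"] l by (intro divide_left_mono) auto
        finally show ?thesis by (simp add: power2_eq_square)
      qed
      then have small: "p ^ 3 / 4 * (1 - y) ^ (n - 3) \<le> p ^ 3 / 4 * (32 / l\<^sup>2)"
        using p by (intro mult_left_mono) auto
      have "Etau n p \<le> real (n choose 2) * (p / 2 * (1 - (1 - p\<^sup>2 / 2) ^ (n - 2))) +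
         real (n choose 3) * (p ^ 3 / 4 * (1 - y) ^ (n - 3))"
        unfolding y_def using p by (intro Etau_le) auto
      also have "\<dots> \<le> (real n)\<^sup>2 / 2 * (p / 2 * 1) + real n ^ 3 / 6 * (p ^ 3 / 4 * (32 / l\<^sup>2))"
      proof (rule add_mono)
        have c2: "real (n choose 2) \<le> (real n)\<^sup>2 / 2"
          unfolding choose2_real by (simp add: power2_eq_square mult_left_mono)
        have "p\<^sup>2 \<le> 1" using p by (simp add: power_le_one)
        then have "1 - (1 - p\<^sup>2 / 2) ^ (n - 2) \<le> 1" "0 \<le> 1 - (1 - p\<^sup>2 / 2) ^ (n - 2)"
          by (auto simp: power_le_one)
        then have a: "p / 2 * (1 - (1 - p\<^sup>2 / 2) ^ (n - 2)) \<le> p / 2 * 1" "0 \<le> p / 2 * (1 - (1 - p\<^sup>2 / 2) ^ (n - 2))"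
          using p by (intro mult_left_mono mult_nonneg_nonneg; simp)+
        show "real (n choose 2) * (p / 2 * (1 - (1 - p\<^sup>2 / 2) ^ (n - 2))) \<le> (real n)\<^sup>2 / 2 * (p / 2 * 1)"
          by (rule mult_mono[OF c2 a(1) _ a(2)]) simp
        have "real n * (real n - 1) * (real n - 2) \<le> real n * real n * real n"
          using elim(2) by (intro mult_mono) auto
        then have c3: "real (n choose 3) \<le> real n ^ 3 / 6" unfolding choose3_real by (simp add: power3_eq_cube)
        have d: "0 \<le> p ^ 3 / 4 * (1 - y) ^ (n - 3)" using p y by auto
        show "real (n choose 3) * (p ^ 3 / 4 * (1 - y) ^ (n - 3)) \<le> real n ^ 3 / 6 * (p ^ 3 / 4 * (32 / l\<^sup>2))"
          by (rule mult_mono[OF c3 small _ d]) simp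
      qed
      also have "\<dots> = (real n)\<^sup>2 * p * (1 / 4 + 4 / 3 / l)"
      proof -
        have "real n ^ 3 / 6 * (p ^ 3 / 4 * (32 / l\<^sup>2)) = (real n)\<^sup>2 * p * (4 / 3 * l / l\<^sup>2)"
          by (simp add: l_def power3_eq_cube power2_eq_square)
        also have "4 / 3 * l / l\<^sup>2 = 4 / 3 / l" using l by (simp add: power2_eq_square)
        finally show ?thesis by (simp add: algebra_simps)
      qed
      also have "\<dots> \<le> (real n)\<^sup>2 * p * (1 / 4 + 1 / 3000)"
      proof -
        have "4 / 3 / l \<le> 1 / 3000" using l by (simp add: field_simps)
        then show ?thesis using p by (intro mult_left_mono) auto
      qed
      finally have tau: "Etau n p \<le> (1 / 4 + 1 / 3000) * ((real n)\<^sup>2 * p)" by (simp add: mult_ac)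
      have arith: "q / 100 \<le> 2 * a - b"
        if "0 \<le> q" "1323 / 10000 * q \<le> a" "b \<le> 1 / 4 * q + 1 / 3000 * q" for q a b :: real
        using that by linarith
      have "0 \<le> (real n)\<^sup>2 * p" using p by simp
      from arith[OF this nu] show "(real n)\<^sup>2 * p / 100 \<le> expect (gnp n p) surplus"
        unfolding expect_surplus using tau by (simp only: distrib_right)
    qed
  qed
qed

text \<open>The bound is uniform in \<open>p\<close>, so \<open>p\<close> may vary with
  \<open>n\<close> in any way. Its terms come from the range where conflicts are unlikely, from
  Chebyshev with (n p)^(-3) \<le> n powr (-3/10), and from the two ranges with \<lambda> \<ge>
  1/6.\<close>

lemma prob_surplus_neg_le:
  "\<exists>C N. \<forall>n\<ge>N. \<forall>p. 0 \<le> p \<and> p \<le> 1 \<longrightarrow> measure_pmf.prob (gnp n p) {G. surplus G < 0} \<le>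
    real n powr (- 1 / 2) + 2048 * real n powr (- 3 / 10) + C / real n"
proof -
  have "\<exists>c N. c > 0 \<and> (\<forall>n\<ge>N. \<forall>l\<in>{1 / 6..4000}.
      c * (real n * sqrt (real n)) \<le> expect (gnp n (sqrt (l / real n))) surplus)"
    by (rule expect_surplus_compact) auto
  then obtain c N1 where c: "c > 0" and mid: "\<And>n l. n \<ge> N1 \<Longrightarrow> l \<in> {1 / 6..4000} \<Longrightarrow>
      c * (real n * sqrt (real n)) \<le> expect (gnp n (sqrt (l / real n))) surplus"
    by blast
  obtain N2 where dense: "\<And>n p. n \<ge> N2 \<Longrightarrow> 0 \<le> p \<Longrightarrow> p \<le> 1 \<Longrightarrow> 4000 \<le> real n * p\<^sup>2 \<Longrightarrow>
      (real n)\<^sup>2 * p / 100 \<le> expect (gnp n p) surplus"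
    using expect_surplus_dense unfolding eventually_sequentially by metis
  have "measure_pmf.prob (gnp n p) {G. surplus G < 0} \<le>
      real n powr (- 1 / 2) + 2048 * real n powr (- 3 / 10) + (2 / c\<^sup>2 + 5) / real n"
    if n: "n \<ge> max (max N1 N2) 4" and p: "0 \<le> p" "p \<le> 1" for n p
  proof -
    define Pr where "Pr = measure_pmf.prob (gnp n p) {G. surplus G < 0}"
    have n0: "real n > 0" using n by simp
    have nn: "0 \<le> real n powr (- 1 / 2)" "0 \<le> 2048 * real n powr (- 3 / 10)" "0 \<le> 2 / c\<^sup>2 / real n" "0 \<le> 5 / real n"
      by auto
    have choose2: "real (n choose 2) \<le> (real n)\<^sup>2 / 2"
      unfolding choose2_real by (simp add: power2_eq_square mult_left_mono)
    have V1: "4 * p * real (n choose 2) \<le> 2 * p * (real n)\<^sup>2"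
      using mult_left_mono[OF choose2, of "4 * p"] p by simp
    have cheb: "Pr \<le> V / E\<^sup>2" if "0 < E" "E \<le> expect (gnp n p) surplus"
      "influence (all_edges {1..n}) p surplus \<le> V" for V E
    proof -
      have V0: "0 \<le> V"
        using p unfolding influence_def
        by (intro order_trans[OF _ that(3)[unfolded influence_def]] mult_nonneg_nonneg sum_nonneg
            Bochner_Integration.integral_nonneg) auto
      have "Pr \<le> V / (expect (gnp n p) surplus)\<^sup>2"
        unfolding Pr_def using that p by (intro prob_neg_le_variance) auto
      also have "\<dots> \<le> V / E\<^sup>2"
        using that V0 by (intro divide_left_mono power_mono) auto
      finally show ?thesis .
    qed
    consider "p \<le> real n powr (- 9 / 10)" | "real n powr (- 9 / 10) < p" "real n * p\<^sup>2 \<le> 1 / 6"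
      | "1 / 6 \<le> real n * p\<^sup>2" "real n * p\<^sup>2 \<le> 4000" | "4000 \<le> real n * p\<^sup>2" by linarith
    then have "Pr \<le> real n powr (- 1 / 2) \<or> Pr \<le> 2048 * real n powr (- 3 / 10) \<or> Pr \<le> 2 / c\<^sup>2 / real n \<or> Pr \<le> 5 / real n"
    proof cases
      case 1
      have "Pr \<le> real (n choose 3) * (3 * real n) * p ^ 5"
        unfolding Pr_def using prob_surplus_neg_sparse[of "{1..n}" p] p by simp
      also have "\<dots> \<le> (real n ^ 3 / 6) * (3 * real n) * (real n powr (- 9 / 10)) ^ 5"
      proof (intro mult_mono power_mono 1 p)
        have "real n * (real n - 1) * (real n - 2) \<le> real n * real n * real n"
          using n by (intro mult_mono) auto
        then show "real (n choose 3) \<le> real n ^ 3 / 6" unfolding choose3_real by (simp add: power3_eq_cube)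
      qed (use p in auto)
      also have "\<dots> = real n powr 4 * real n powr (- 9 / 2) / 2"
      proof -
        have "(real n powr (- 9 / 10)) ^ 5 = real n powr (- 9 / 2)" using n0 by (simp add: powr_power)
        moreover have "real n ^ 3 / 6 * (3 * real n) = real n powr 4 / 2"
          using n0 by (simp add: eval_nat_numeral powr_numeral)
        ultimately show ?thesis by simp
      qed
      also have "\<dots> = real n powr (- 1 / 2) / 2" by (simp only: powr_add[symmetric]) simp
      finally show ?thesis using nn(1) by linarith
    next
      case 2
      have p0: "p > 0" using 2(1) n0 by (meson order_le_less_trans powr_ge_zero)
      have "real n ^ 3 / 16 \<le> real (n choose 3)"
      proof -
        have "real n / 2 \<le> real n - 2" "3 / 4 * real n \<le> real n - 1" using n by auto
        then have "real n * (3 / 4 * real n) * (real n / 2) \<le> real n * (real n - 1) * (real n - 2)"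
          by (intro mult_mono) auto
        then show ?thesis unfolding choose3_real by (simp add: power3_eq_cube)
      qed
      then have "real n ^ 3 / 16 * (p ^ 3 / 2) \<le> real (n choose 3) * (p ^ 3 / 2)"
        using p by (intro mult_right_mono) auto
      also have "\<dots> \<le> expect (gnp n p) surplus"
        using expect_surplus_sparse[of "{1..n}" p] p 2 by simp
      finally have E: "(real n * p) ^ 3 / 32 \<le> expect (gnp n p) surplus" by (simp add: power_mult_distrib)
      have "Pr \<le> 2 * (real n * p) ^ 3 / ((real n * p) ^ 3 / 32)\<^sup>2"
      proof (rule cheb[OF _ E])
        show "0 < (real n * p) ^ 3 / 32" using n0 p0 by simp
        have "influence (all_edges {1..n}) p surplus \<le>
          4 * p * real (n choose 2) * (real n * p\<^sup>2)"
          using surplus_influence(2)[of "{1..n}" p] p by simp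
        also have "\<dots> \<le> 2 * p * (real n)\<^sup>2 * (real n * p\<^sup>2)" using V1 by (intro mult_right_mono) auto
        finally show "influence (all_edges {1..n}) p surplus \<le>
          2 * (real n * p) ^ 3" by (simp add: power2_eq_square power3_eq_cube mult_ac)
      qed
      also have "\<dots> = 2048 / (real n * p) ^ 3"
      proof -
        have "2 * w / (w / 32)\<^sup>2 = 2048 / w" if "0 < w" for w :: real
          using that by (simp add: power2_eq_square)
        then show ?thesis using n0 p0 by (metis mult_pos_pos zero_less_power)
      qed
      also have "\<dots> \<le> 2048 / real n powr (3 / 10)"
      proof (intro divide_left_mono)
        have "real n powr (1 / 10) = real n * real n powr (- 9 / 10)"
          using n0 powr_add[of "real n" 1 "- 9 / 10"] by simp
        also have "\<dots> \<le> real n * p" using 2 n0 by (intro mult_left_mono) auto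
        finally have "(real n powr (1 / 10)) ^ 3 \<le> (real n * p) ^ 3" by (intro power_mono) auto
        then show "real n powr (3 / 10) \<le> (real n * p) ^ 3" using n0 by (simp add: powr_power)
      qed (use n0 p0 in auto)
      also have "\<dots> = 2048 * real n powr (- 3 / 10)" using n0 by (simp add: powr_minus_divide)
      finally show ?thesis by blast
    next
      case 3
      define l where "l = real n * p\<^sup>2"
      have "sqrt (l / real n) = p" using n0 p by (simp add: l_def)
      then have E: "c * (real n * sqrt (real n)) \<le> expect (gnp n p) surplus"
        using mid[of n l] n 3 by (simp add: l_def)
      have "Pr \<le> 2 * (real n)\<^sup>2 / (c * (real n * sqrt (real n)))\<^sup>2"
      proof (rule cheb[OF _ E])
        show "0 < c * (real n * sqrt (real n))" using c n0 by simp
        have "influence (all_edges {1..n}) p surplus \<le>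
          4 * p * real (n choose 2)"
          using surplus_influence(1)[of "{1..n}" p] p by simp
        also note V1
        also have "2 * p * (real n)\<^sup>2 \<le> 2 * 1 * (real n)\<^sup>2" using p by (intro mult_right_mono mult_left_mono) auto
        finally show "influence (all_edges {1..n}) p surplus \<le>
          2 * (real n)\<^sup>2" by simp
      qed
      also have "\<dots> = 2 / c\<^sup>2 / real n" using n0 by (simp add: power_mult_distrib power2_eq_square)
      finally show ?thesis by blast
    next
      case 4
      have E: "(real n)\<^sup>2 * p / 100 \<le> expect (gnp n p) surplus" using dense[of n p] n p 4 by simp
      have p0: "p > 0" using 4 p by (cases "p = 0") auto
      have "p * p \<le> p * 1" using p by (intro mult_left_mono) auto
      then have "real n * p\<^sup>2 \<le> real n * p" using n0 by (simp add: power2_eq_square)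
      then have np: "4000 \<le> real n * p" using 4 by linarith
      have "Pr \<le> 2 * p * (real n)\<^sup>2 / ((real n)\<^sup>2 * p / 100)\<^sup>2"
      proof (rule cheb[OF _ E])
        show "0 < (real n)\<^sup>2 * p / 100" using n0 p0 by simp
        have "influence (all_edges {1..n}) p surplus \<le>
          4 * p * real (n choose 2)"
          using surplus_influence(1)[of "{1..n}" p] p by simp
        also note V1
        finally show "influence (all_edges {1..n}) p surplus \<le>
          2 * p * (real n)\<^sup>2" .
      qed
      also have "\<dots> = 20000 / (real n * p) / real n" using n0 p0 by (simp add: power2_eq_square)
      also have "\<dots> \<le> 20000 / 4000 / real n"
        using np n0 by (intro divide_right_mono divide_left_mono) auto
      finally show ?thesis by simp
    qed
    then have "Pr \<le> real n powr (- 1 / 2) + 2048 * real n powr (- 3 / 10) + (2 / c\<^sup>2 / real n + 5 / real n)"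
      using nn by linarith
    then show ?thesis by (simp add: Pr_def add_divide_distrib)
  qed
  then show ?thesis by blast
qed

theorem theorem1p2:
  fixes p :: "nat \<Rightarrow> real"
  assumes "\<And>n. 0 \<le> p n \<and> p n \<le> 1"
  shows "(\<lambda>n. measure_pmf.prob (random_graph n (p n)) {G. tau G \<le> 2 * nu G}) \<longlonglongrightarrow> 1"
proof -
  define P where "P = (\<lambda>n. measure_pmf.prob (random_graph n (p n)) {G. tau G \<le> 2 * nu G})"
  obtain C N where *: "\<And>n p. n \<ge> N \<Longrightarrow> 0 \<le> p \<Longrightarrow> p \<le> 1 \<Longrightarrow> measure_pmf.prob (gnp n p) {G. surplus G < 0} \<le>
    real n powr (- 1 / 2) + 2048 * real n powr (- 3 / 10) + C / real n"
    using prob_surplus_neg_le by metis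
  have P: "P n = 1 - measure_pmf.prob (gnp n (p n)) {G. surplus G < 0}" for n
  proof -
    have eq: "{G. surplus G < 0} = UNIV - {G. tau G \<le> 2 * nu G}" by (auto simp: surplus_def)
    have compl: "measure_pmf.prob M (UNIV - A) = 1 - measure_pmf.prob M A" for M :: "nat set set pmf" and A
      using measure_pmf.prob_compl[of A M] by simp
    show ?thesis unfolding P_def random_graph_eq_rset eq compl by simp
  qed
  have "P \<longlonglongrightarrow> 1"
  proof (rule tendsto_sandwich)
    show "eventually (\<lambda>n. 1 - (real n powr (- 1 / 2) + 2048 * real n powr (- 3 / 10) + C / real n) \<le> P n) sequentially"
      using eventually_ge_at_top[of N]
    proof eventually_elim
      case (elim n)
      then show ?case using *[of n "p n"] assms[of n] unfolding P by simp
    qed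
    show "eventually (\<lambda>n. P n \<le> 1) sequentially" unfolding P_def by simp
    have "(\<lambda>n. C * (1 / real n)) \<longlonglongrightarrow> C * 0" by (intro tendsto_mult_left) real_asymp
    moreover have "(\<lambda>n. real n powr (- 1 / 2)) \<longlonglongrightarrow> 0" by real_asymp
    moreover have "(\<lambda>n. 2048 * real n powr (- 3 / 10)) \<longlonglongrightarrow> 0" by real_asymp
    ultimately have "(\<lambda>n. 1 - (real n powr (- 1 / 2) + 2048 * real n powr (- 3 / 10) + C * (1 / real n))) \<longlonglongrightarrow> 1 - (0 + 0 + C * 0)"
      by (intro tendsto_intros)
    then show "(\<lambda>n. 1 - (real n powr (- 1 / 2) + 2048 * real n powr (- 3 / 10) + C / real n)) \<longlonglongrightarrow> 1" by simp
  qed (rule tendsto_const)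
  then show ?thesis unfolding P_def .
qed

end
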